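(* Let $2\le\alpha<3$ and let $g:(0,1)^2\to\mathbb{R}$ be a BV function whose graph $G=\{(x_1,x_2,g(x_1,x_2)):0<x_1,x_2<1\}$ satisfies $\mathcal{H}^\alpha_d(G)<+\infty$. Then the approximate gradient of $g$ satisfies $\mathrm{ap}\,\nabla g(x)=(-x_2,x_1)$ for almost every $x=(x_1,x_2)\in(0,1)^2$.
   Context: $\mathbb{H}^1$ is identified with $\mathbb{R}^3$ equipped with the vector fields $X_1=\partial_{x_1}-x_2\partial_{x_3}$, $X_2=\partial_{x_2}+x_1\partial_{x_3}$; $d$ is the associated sub-Riemannian (Carnot–Carathéodory) distance, i.e. $d(p,q)$ is the infimum of $T$ over absolutely continuous $\gamma:[0,T]\to\mathbb{R}^3$ joining $p$ to $q$ with $\dot\gamma=a_1X_1(\gamma)+a_2X_2(\gamma)$ a.e., $a_1^2+a_2^2\le1$. $\mathcal{H}^\alpha_d$ is the $\alpha$-dimensional Hausdorff measure with respect to $d$. $\mathrm{ap}\,\nabla g$ is the approximate gradient of $g$, which exists a.e. for BV functions. *)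

theory Defs
  imports "HOL-Analysis.Analysis"
begin

type_synonym heis = "real \<times> real \<times> real"

definition X1 :: "heis \<Rightarrow> heis" where
  "X1 p = (case p of (x1, x2, x3) \<Rightarrow> (1, 0, - x2))"

definition X2 :: "heis \<Rightarrow> heis" where
  "X2 p = (case p of (x1, x2, x3) \<Rightarrow> (0, 1, x1))"

definition abs_continuous_on :: "real \<Rightarrow> real \<Rightarrow> (real \<Rightarrow> 'b::real_normed_vector) \<Rightarrow> bool" where
  "abs_continuous_on a b f \<longleftrightarrow>
     (\<forall>\<epsilon>>0. \<exists>\<delta>>0. \<forall>(n::nat) (u::nat \<Rightarrow> real) (v::nat \<Rightarrow> real).
        (\<forall>i<n. a \<le> u i \<and> u i \<le> v i \<and> v i \<le> b) \<and>
        (\<forall>i<n. \<forall>j<n. i \<noteq> j \<longrightarrow> v i \<le> u j \<or> v j \<le> u i) \<and>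
        (\<Sum>i<n. v i - u i) < \<delta>
        \<longrightarrow> (\<Sum>i<n. norm (f (v i) - f (u i))) < \<epsilon>)"

definition horizontal_curve :: "(real \<Rightarrow> heis) \<Rightarrow> real \<Rightarrow> bool" where
  "horizontal_curve \<gamma> T \<longleftrightarrow>
     0 \<le> T \<and> abs_continuous_on 0 T \<gamma> \<and>
     (AE t in lborel. t \<in> {0..T} \<longrightarrow>
        (\<exists>a1 a2. a1\<^sup>2 + a2\<^sup>2 \<le> 1 \<and>
           (\<gamma> has_vector_derivative (a1 *\<^sub>R X1 (\<gamma> t) + a2 *\<^sub>R X2 (\<gamma> t))) (at t)))"

definition cc_dist :: "heis \<Rightarrow> heis \<Rightarrow> real" where
  "cc_dist p q = Inf {T. \<exists>\<gamma>. horizontal_curve \<gamma> T \<and> \<gamma> 0 = p \<and> \<gamma> T = q}"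

definition dist_diam :: "('a \<Rightarrow> 'a \<Rightarrow> real) \<Rightarrow> 'a set \<Rightarrow> real" where
  "dist_diam d S = (if S = {} then 0 else Sup {d x y | x y. x \<in> S \<and> y \<in> S})"

definition hausdorff_pre :: "('a \<Rightarrow> 'a \<Rightarrow> real) \<Rightarrow> real \<Rightarrow> real \<Rightarrow> 'a set \<Rightarrow> ennreal" where
  "hausdorff_pre d \<alpha> \<delta> E =
     (INF C \<in> {C :: nat \<Rightarrow> 'a set. E \<subseteq> (\<Union>n. C n) \<and>
                 (\<forall>n. \<forall>x\<in>C n. \<forall>y\<in>C n. d x y \<le> \<delta>)}.
        (\<Sum>n. ennreal (dist_diam d (C n) powr \<alpha>)))"

definition hausdorff_measure :: "('a \<Rightarrow> 'a \<Rightarrow> real) \<Rightarrow> real \<Rightarrow> 'a set \<Rightarrow> ennreal" where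
  "hausdorff_measure d \<alpha> E = (SUP \<delta> \<in> {0<..}. hausdorff_pre d \<alpha> \<delta> E)"

definition C1c_on :: "(real \<times> real) set \<Rightarrow> (real \<times> real \<Rightarrow> real) \<Rightarrow> bool" where
  "C1c_on \<Omega> \<phi> \<longleftrightarrow>
     (\<exists>\<phi>'. (\<forall>x. (\<phi> has_derivative blinfun_apply (\<phi>' x)) (at x)) \<and> continuous_on UNIV \<phi>') \<and>
     compact (closure {x. \<phi> x \<noteq> 0}) \<and> closure {x. \<phi> x \<noteq> 0} \<subseteq> \<Omega>"

definition divergence :: "(real \<times> real \<Rightarrow> real) \<Rightarrow> (real \<times> real \<Rightarrow> real) \<Rightarrow> real \<times> real \<Rightarrow> real" where
  "divergence \<phi>1 \<phi>2 x = frechet_derivative \<phi>1 (at x) (1, 0) + frechet_derivative \<phi>2 (at x) (0, 1)"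

definition BV_on :: "(real \<times> real) set \<Rightarrow> (real \<times> real \<Rightarrow> real) \<Rightarrow> bool" where
  "BV_on \<Omega> g \<longleftrightarrow>
     set_integrable lebesgue \<Omega> g \<and>
     (\<exists>M. \<forall>\<phi>1 \<phi>2. C1c_on \<Omega> \<phi>1 \<and> C1c_on \<Omega> \<phi>2 \<and> (\<forall>x. (\<phi>1 x)\<^sup>2 + (\<phi>2 x)\<^sup>2 \<le> 1) \<longrightarrow>
        \<bar>LINT x:\<Omega>|lebesgue. g x * divergence \<phi>1 \<phi>2 x\<bar> \<le> M)"

definition density_zero_at :: "(real \<times> real) set \<Rightarrow> real \<times> real \<Rightarrow> bool" where
  "density_zero_at A x \<longleftrightarrow>
     ((\<lambda>r. measure lebesgue (A \<inter> ball x r) / measure lebesgue (ball x r)) \<longlongrightarrow> 0) (at_right 0)"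

definition has_ap_gradient :: "(real \<times> real) set \<Rightarrow> (real \<times> real \<Rightarrow> real) \<Rightarrow> real \<times> real \<Rightarrow> real \<times> real \<Rightarrow> bool" where
  "has_ap_gradient \<Omega> g x v \<longleftrightarrow>
     (\<forall>\<epsilon>>0. density_zero_at {y \<in> \<Omega>. \<bar>g y - g x - v \<bullet> (y - x)\<bar> > \<epsilon> * norm (y - x)} x)"

end

theory Submission
  imports Defs
begin

text \<open>
  A set of Carnot--Caratheodory diameter \<open>D\<close> lies in a box of size \<open>D \<times> D \<times> D\<^sup>2\<close> sheared along the
  horizontal plane. Projecting along the integral curves of \<open>X\<^sub>1\<close> sends such a box to a planar set
  of area \<open>O(D\<^sup>3)\<close>; as \<open>\<alpha> < 3\<close>, the graph therefore projects to a null set, and by Fubini for almost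
  every \<open>c\<close> the function \<open>s \<mapsto> g(s, c) + c s\<close> has a null range. Almost every such row also has bounded
  variation off a null set, and a function of bounded variation with null range has derivative zero
  almost everywhere. The same holds for \<open>t \<mapsto> g(c, t) - c t\<close> along columns, by the symmetry
  \<open>g(x\<^sub>1, x\<^sub>2) \<mapsto> - g(x\<^sub>2, x\<^sub>1)\<close>. Going from \<open>x\<close> to \<open>y\<close> through \<open>(y\<^sub>1, x\<^sub>2)\<close> and using density
  points of the row through \<open>x\<close> gives the approximate gradient.
\<close>

section \<open>Absolutely continuous curves\<close>

text \<open>The graph depends on every value of \<open>g\<close>, bounded variation only on its
  class modulo null sets. So a Borel version \<open>f\<close> carries the variation,
  \<open>g\<close> itself carries the null ranges, and the two meet on the points of a row where
  they agree; this is why variation is measured over subsets of the line. Distributional variation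
  reaches the rows through grid averages against C1 weights: differences of neighbouring averages
  are exact pairings with derivatives of test functions, and Fatou's lemma passes the bounds to the
  limit. Results on rows are assembled by Fubini, which requires Borel sets of good points. Flatness
  and density are therefore phrased with countable or almost-everywhere quantifiers only. Flatness
  of the column through x is not enough at the end: the estimate runs along the columns through
  nearby points (y1, x2), with common constants. Points admitting given constants form a Borel set,
  almost all of its points are density points of it along their rows, and countably many constants
  exhaust almost every point.\<close>

definition nonoverlapping :: "real \<Rightarrow> real \<Rightarrow> nat \<Rightarrow> (nat \<Rightarrow> real) \<Rightarrow> (nat \<Rightarrow> real) \<Rightarrow> bool" where
  "nonoverlapping a b n u v \<longleftrightarrow> (\<forall>i<n. a \<le> u i \<and> u i \<le> v i \<and> v i \<le> b) \<and>
     (\<forall>i<n. \<forall>j<n. i \<noteq> j \<longrightarrow> v i \<le> u j \<or> v j \<le> u i)"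

lemma abs_continuous_on_alt:
  "abs_continuous_on a b f \<longleftrightarrow> (\<forall>\<epsilon>>0. \<exists>\<delta>>0. \<forall>n u v. nonoverlapping a b n u v \<and> (\<Sum>i<n. v i - u i) < \<delta>
     \<longrightarrow> (\<Sum>i<n. norm (f (v i) - f (u i))) < \<epsilon>)"
  unfolding abs_continuous_on_def nonoverlapping_def conj_assoc ..

lemma abs_continuous_onE:
  assumes "abs_continuous_on a b f" "\<epsilon> > 0"
  obtains \<delta> where "\<delta> > 0" "\<forall>n u v. nonoverlapping a b n u v \<and> (\<Sum>i<n. v i - u i) < \<delta> \<longrightarrow> (\<Sum>i<n. norm (f (v i) - f (u i))) < \<epsilon>"
  by (rule exE[OF assms(1)[unfolded abs_continuous_on_alt, THEN spec[of _ \<epsilon>], THEN mp, OF assms(2)]])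
    (erule conjE, erule (1) that)

lemma abs_continuous_on_bounded_linear:
  assumes f: "abs_continuous_on a b f" and h: "bounded_linear h"
  shows "abs_continuous_on a b (\<lambda>t. h (f t))"
  unfolding abs_continuous_on_alt
proof (intro allI impI)
  fix \<epsilon> :: real assume "\<epsilon> > 0"
  obtain K where K: "K > 0" "\<And>x. norm (h x) \<le> norm x * K"
    using bounded_linear.pos_bounded[OF h] by blast
  have "\<epsilon> / K > 0" using K \<open>\<epsilon> > 0\<close> by simp
  obtain \<delta> where "\<delta> > 0" and \<delta>0: "\<forall>n u v. nonoverlapping a b n u v \<and> (\<Sum>i<n. v i - u i) < \<delta> \<longrightarrow> (\<Sum>i<n. norm (f (v i) - f (u i))) < \<epsilon> / K"
    using abs_continuous_onE[OF f \<open>\<epsilon> / K > 0\<close>] .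
  note \<delta> = \<delta>0[THEN spec, THEN spec, THEN spec, THEN mp]
  show "\<exists>\<delta>>0. \<forall>n u v. nonoverlapping a b n u v \<and> (\<Sum>i<n. v i - u i) < \<delta> \<longrightarrow> (\<Sum>i<n. norm (h (f (v i)) - h (f (u i)))) < \<epsilon>"
  proof (intro exI[of _ \<delta>] conjI allI impI \<open>\<delta> > 0\<close>)
    fix n :: nat and u v :: "nat \<Rightarrow> real"
    assume "nonoverlapping a b n u v \<and> (\<Sum>i<n. v i - u i) < \<delta>"
    from \<delta>[OF this] have *: "(\<Sum>i<n. norm (f (v i) - f (u i))) * K < \<epsilon>"
      using K by (simp add: field_simps)
    have "(\<Sum>i<n. norm (h (f (v i)) - h (f (u i)))) \<le> (\<Sum>i<n. norm (f (v i) - f (u i)) * K)"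
      by (intro sum_mono) (simp add: K linear_diff[OF bounded_linear.linear[OF h], symmetric])
    also have "\<dots> < \<epsilon>" using * by (simp add: sum_distrib_right)
    finally show "(\<Sum>i<n. norm (h (f (v i)) - h (f (u i)))) < \<epsilon>" .
  qed
qed

lemma abs_continuous_on_subinterval:
  assumes "abs_continuous_on a b f" "a \<le> c" "d \<le> b"
  shows "abs_continuous_on c d f"
  unfolding abs_continuous_on_alt
proof (intro allI impI)
  fix \<epsilon> :: real assume "\<epsilon> > 0"
  obtain \<delta> where "\<delta> > 0" and \<delta>0: "\<forall>n u v. nonoverlapping a b n u v \<and> (\<Sum>i<n. v i - u i) < \<delta> \<longrightarrow> (\<Sum>i<n. norm (f (v i) - f (u i))) < \<epsilon>"
    using abs_continuous_onE[OF assms(1) \<open>\<epsilon> > 0\<close>] .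
  note \<delta> = \<delta>0[THEN spec, THEN spec, THEN spec, THEN mp]
  show "\<exists>\<delta>>0. \<forall>n u v. nonoverlapping c d n u v \<and> (\<Sum>i<n. v i - u i) < \<delta> \<longrightarrow> (\<Sum>i<n. norm (f (v i) - f (u i))) < \<epsilon>"
    using \<open>\<delta> > 0\<close> by (intro exI[of _ \<delta>] conjI allI impI \<delta>) (use assms(2,3) in \<open>force simp: nonoverlapping_def\<close>)+
qed

lemma lipschitz_imp_abs_continuous_on:
  assumes "\<And>u v. a \<le> u \<Longrightarrow> u \<le> v \<Longrightarrow> v \<le> b \<Longrightarrow> norm (f v - f u) \<le> L * (v - u)"
  shows "abs_continuous_on a b f"
  unfolding abs_continuous_on_alt
proof (intro allI impI)
  fix \<epsilon> :: real assume "\<epsilon> > 0"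
  define K where "K = max L 1"
  have K: "K > 0" "L \<le> K" by (auto simp: K_def)
  show "\<exists>\<delta>>0. \<forall>n u v. nonoverlapping a b n u v \<and> (\<Sum>i<n. v i - u i) < \<delta> \<longrightarrow> (\<Sum>i<n. norm (f (v i) - f (u i))) < \<epsilon>"
  proof (intro exI[of _ "\<epsilon> / K"] conjI allI impI)
    show "\<epsilon> / K > 0" using K \<open>\<epsilon> > 0\<close> by simp
    fix n :: nat and u v :: "nat \<Rightarrow> real"
    assume A: "nonoverlapping a b n u v \<and> (\<Sum>i<n. v i - u i) < \<epsilon> / K"
    have "(\<Sum>i<n. norm (f (v i) - f (u i))) \<le> (\<Sum>i<n. K * (v i - u i))"
    proof (intro sum_mono)
      fix i assume "i \<in> {..<n}"
      then have "norm (f (v i) - f (u i)) \<le> L * (v i - u i)" "u i \<le> v i"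
        using assms A by (auto simp: nonoverlapping_def)
      moreover from this have "L * (v i - u i) \<le> K * (v i - u i)"
        using K by (intro mult_right_mono) auto
      ultimately show "norm (f (v i) - f (u i)) \<le> K * (v i - u i)" by linarith
    qed
    also have "\<dots> = K * (\<Sum>i<n. v i - u i)" by (simp add: sum_distrib_left)
    also have "\<dots> < \<epsilon>" using A K by (simp add: field_simps)
    finally show "(\<Sum>i<n. norm (f (v i) - f (u i))) < \<epsilon>" .
  qed
qed

lemma null_set_open_superset:
  fixes N :: "'a::euclidean_space set"
  assumes "N \<in> null_sets lebesgue" "e > 0"
  obtains U where "open U" "N \<subseteq> U" "U \<in> lmeasurable" "measure lebesgue U < e"
proof -
  obtain U where U: "open U" "N \<subseteq> U" "(U - N) \<in> lmeasurable" "emeasure lebesgue (U - N) < ennreal e"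
    using sets_lebesgue_outer_open[of N e] assms by (auto simp: null_sets_def)
  have N: "N \<in> lmeasurable" "measure lebesgue N = 0"
    using assms(1) by (auto simp: fmeasurable_def null_sets_def measure_def)
  have eq: "U = (U - N) \<union> N" using U by auto
  have L: "U \<in> lmeasurable" using fmeasurable.Un[OF U(3) N(1)] eq by simp
  have "emeasure lebesgue U \<le> emeasure lebesgue (U - N) + emeasure lebesgue N"
    using emeasure_subadditive[of "U - N" lebesgue N] U(3) N(1) eq by (simp add: fmeasurableD)
  also have "\<dots> < ennreal e" using U(4) assms(1) by (simp add: null_sets_def)
  finally have "measure lebesgue U < e"
    using L \<open>e > 0\<close> by (simp add: emeasure_eq_measure2 ennreal_less_iff)
  with U L show ?thesis using that by blast
qed

text \<open>Vitali coverings leave a negligible remainder uncovered, whereas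
  \<open>negligible_outer_le\<close> asks for a measurable superset of the whole set.
  \<open>E\<close> is not assumed measurable.\<close>

lemma lmeasurable_superset_of_almost_cover:
  assumes "negligible (E - W)" "W \<in> lmeasurable" "measure lebesgue W \<le> e"
  shows "\<exists>T. E \<subseteq> T \<and> T \<in> lmeasurable \<and> measure lebesgue T \<le> e"
proof -
  have N: "E - W \<in> lmeasurable" "measure lebesgue (E - W) = 0"
    using assms(1) by (simp_all add: negligible_imp_measurable negligible_imp_measure0)
  have "measure lebesgue ((E - W) \<union> W) \<le> measure lebesgue (E - W) + measure lebesgue W"
    using N(1) assms(2) by (intro measure_Un_le) (auto simp: fmeasurableD)
  then have "measure lebesgue ((E - W) \<union> W) \<le> e" using N(2) assms(3) by linarith
  moreover have "(E - W) \<union> W \<in> lmeasurable" by (rule fmeasurable.Un[OF N(1) assms(2)])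
  moreover have "E \<subseteq> (E - W) \<union> W" by blast
  ultimately show ?thesis by blast
qed

text \<open>A gauge argument in place of integrating the derivative: at points with a derivative
  bounded by \<open>L\<close> the gauge enforces slope at most \<open>L + e\<close>, and at the
  exceptional null set it confines the intervals to an open set of small measure, where absolute
  continuity bounds the total increment.\<close>

lemma abs_continuous_on_increment_le:
  fixes f :: "real \<Rightarrow> 'b::real_normed_vector"
  assumes ab: "a \<le> b" and ac: "abs_continuous_on a b f" and L0: "0 \<le> L"
    and der: "AE t in lborel. t \<in> {a..b} \<longrightarrow> (\<exists>d. norm d \<le> L \<and> (f has_vector_derivative d) (at t))"
  shows "norm (f b - f a) \<le> L * (b - a)"
proof -
  have main: "norm (f b - f a) \<le> (L + e) * (b - a) + e" if "e > 0" for e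
  proof -
    obtain N where N: "{t \<in> space lborel. \<not> (t \<in> {a..b} \<longrightarrow> (\<exists>d. norm d \<le> L \<and> (f has_vector_derivative d) (at t)))} \<subseteq> N"
      "N \<in> null_sets lborel"
      using der by (auto elim!: AE_E simp: null_sets_def)
    obtain \<delta> where "\<delta> > 0" and \<delta>0: "\<forall>n u v. nonoverlapping a b n u v \<and> (\<Sum>i<n. v i - u i) < \<delta> \<longrightarrow> (\<Sum>i<n. norm (f (v i) - f (u i))) < e"
      using abs_continuous_onE[OF ac \<open>e > 0\<close>] .
    note \<delta> = \<delta>0[THEN spec, THEN spec, THEN spec, THEN mp]
    have "N \<in> null_sets lebesgue" using N(2) by (rule null_sets_completionI)
    then obtain U where U: "open U" "N \<subseteq> U" "U \<in> lmeasurable" "measure lebesgue U < \<delta>"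
      using null_set_open_superset \<open>\<delta> > 0\<close> by blast
    have "\<exists>r>0. t \<in> {a..b} - N \<longrightarrow> (\<forall>y. \<bar>y - t\<bar> < r \<longrightarrow> norm (f y - f t) \<le> (L + e) * \<bar>y - t\<bar>)" for t
    proof (cases "t \<in> {a..b} - N")
      case True
      then obtain d where d: "norm d \<le> L" "(f has_vector_derivative d) (at t)"
        using N(1) by auto
      from d(2) obtain r where r: "r > 0" "\<And>y. norm (y - t) < r \<Longrightarrow>
          norm (f y - f t - (y - t) *\<^sub>R d) \<le> e * norm (y - t)"
        unfolding has_vector_derivative_def has_derivative_at_alt using \<open>e > 0\<close> by blast
      have "norm (f y - f t) \<le> (L + e) * \<bar>y - t\<bar>" if "\<bar>y - t\<bar> < r" for y
      proof -
        have "norm (f y - f t) \<le> norm (f y - f t - (y - t) *\<^sub>R d) + norm ((y - t) *\<^sub>R d)"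
          by (metis diff_add_cancel norm_triangle_ineq)
        also have "\<dots> \<le> e * \<bar>y - t\<bar> + \<bar>y - t\<bar> * L"
          using r(2)[of y] that d(1) by (intro add_mono) (auto intro: mult_left_mono)
        finally show ?thesis by (simp add: algebra_simps)
      qed
      with r(1) show ?thesis by blast
    qed (auto intro: exI[of _ 1])
    then obtain r where r: "\<And>t. r t > 0"
      "\<And>t y. t \<in> {a..b} - N \<Longrightarrow> \<bar>y - t\<bar> < r t \<Longrightarrow> norm (f y - f t) \<le> (L + e) * \<bar>y - t\<bar>"
      by metis
    define G where "G t = (if t \<in> N then U else ball t (r t))" for t
    have "gauge G" using U r(1) by (auto simp: gauge_def G_def)
    then obtain p where p: "p tagged_division_of {a..b}" "G fine p"
      using fine_division_exists_real by blast
    have fin: "finite p" using p(1) by blast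
    have kk: "\<exists>u v. K = {u..v} \<and> a \<le> u \<and> u \<le> v \<and> v \<le> b \<and> x \<in> {u..v} \<and> {u..v} \<subseteq> G x"
      if xK: "(x, K) \<in> p" for x K
    proof -
      obtain u v where "K = cbox u v" using tagged_division_ofD(4)[OF p(1) xK] by blast
      moreover have "x \<in> K" "K \<subseteq> {a..b}" using tagged_division_ofD(2,3)[OF p(1) xK] by auto
      moreover have "K \<subseteq> G x" using p(2) xK by (auto simp: fine_def)
      ultimately show ?thesis by (intro exI[of _ u] exI[of _ v]) (auto simp: cbox_interval)
    qed
    \<comment> \<open>Degenerate intervals are kept out of \<open>P\<close>: their interiors are
      empty, so a tagged division does not separate them from the others as
      \<open>nonoverlapping\<close> demands. Their increments vanish anyway.\<close>
    define P where "P = {y \<in> p. fst y \<in> N \<and> Inf (snd y) < Sup (snd y)}"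
    have finP: "finite P" using fin by (auto simp: P_def)
    have tel: "f b - f a = (\<Sum>y\<in>p. f (Sup (snd y)) - f (Inf (snd y)))"
      using additive_tagged_division_1[OF ab p(1), of f] by (simp add: case_prod_unfold)
    have tel2: "b - a = (\<Sum>y\<in>p. Sup (snd y) - Inf (snd y))"
      using additive_tagged_division_1[OF ab p(1), of "\<lambda>x. x"] by (simp add: case_prod_unfold)
    have good: "norm (f (Sup (snd y)) - f (Inf (snd y))) \<le> (L + e) * (Sup (snd y) - Inf (snd y))"
      if y: "y \<in> p - P" for y
    proof -
      obtain x K where yy: "y = (x, K)" by (cases y)
      obtain u v where K: "K = {u..v}" "a \<le> u" "u \<le> v" "v \<le> b" "x \<in> {u..v}" "{u..v} \<subseteq> G x"
        using kk[of x K] y yy by blast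
      have iv: "Inf K = u" "Sup K = v" using K by auto
      show ?thesis
      proof (cases "x \<in> N")
        case True
        then have "u = v" using y yy iv K(3) by (auto simp: P_def)
        then show ?thesis using yy iv by simp
      next
        case False
        then have x: "x \<in> {a..b} - N" using K by auto
        have sub: "{u..v} \<subseteq> ball x (r x)" using K(6) False by (simp add: G_def)
        have "u \<in> ball x (r x)" "v \<in> ball x (r x)" using K(3) subsetD[OF sub, of u] subsetD[OF sub, of v] by auto
        then have "\<bar>u - x\<bar> < r x" "\<bar>v - x\<bar> < r x" by (auto simp: dist_real_def)
        then have "norm (f u - f x) \<le> (L + e) * \<bar>u - x\<bar>" "norm (f v - f x) \<le> (L + e) * \<bar>v - x\<bar>"
          using r(2)[OF x] by blast+
        moreover have "norm (f v - f u) \<le> norm (f v - f x) + norm (f u - f x)"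
          by (metis norm_triangle_ineq4 diff_diff_eq2 diff_add_cancel)
        moreover have "(L + e) * \<bar>u - x\<bar> + (L + e) * \<bar>v - x\<bar> = (L + e) * (v - u)"
          using K(5) by (simp add: algebra_simps)
        ultimately show ?thesis using yy iv by simp
      qed
    qed
    have bad: "(\<Sum>y\<in>P. norm (f (Sup (snd y)) - f (Inf (snd y)))) < e"
    proof -
      obtain h where h: "bij_betw h {..<card P} P"
        using ex_bij_betw_nat_finite[OF finP] by (auto simp: lessThan_atLeast0)
      define u where "u i = Inf (snd (h i))" for i
      define v where "v i = Sup (snd (h i))" for i
      have hP: "h i \<in> P" if "i < card P" for i using h that by (auto simp: bij_betw_def)
      have uv: "a \<le> u i \<and> u i < v i \<and> v i \<le> b \<and> snd (h i) = {u i..v i} \<and> {u i..v i} \<subseteq> U"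
        if i: "i < card P" for i
      proof -
        obtain x K where yy: "h i = (x, K)" by (cases "h i")
        have "(x, K) \<in> p" "x \<in> N" "Inf K < Sup K" using hP[OF i] yy by (auto simp: P_def)
        moreover from this obtain u' v' where K: "K = {u'..v'}" "a \<le> u'" "u' \<le> v'" "v' \<le> b" "{u'..v'} \<subseteq> G x"
          using kk[of x K] by blast
        ultimately show ?thesis using yy by (auto simp: u_def v_def G_def)
      qed
      have disj: "{u i<..<v i} \<inter> {u j<..<v j} = {}" if "i < card P" "j < card P" "i \<noteq> j" for i j
      proof -
        have "h i \<noteq> h j" using h that by (auto simp: bij_betw_def inj_on_def)
        moreover have "h i \<in> p" "h j \<in> p" using hP that by (auto simp: P_def)
        ultimately have "interior (snd (h i)) \<inter> interior (snd (h j)) = {}"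
          using tagged_division_ofD(5)[OF p(1), of "fst (h i)" "snd (h i)" "fst (h j)" "snd (h j)"] by simp
        then show ?thesis using uv that by (simp add: interior_atLeastAtMost_real)
      qed
      have sep: "v i \<le> u j \<or> v j \<le> u i" if "i < card P" "j < card P" "i \<noteq> j" for i j
      proof (rule ccontr)
        assume "\<not> ?thesis"
        then have "max (u i) (u j) < min (v i) (v j)" using uv that by auto
        then obtain z where "max (u i) (u j) < z" "z < min (v i) (v j)" using dense by blast
        then have "z \<in> {u i<..<v i} \<inter> {u j<..<v j}" by auto
        then show False using disj[OF that] by blast
      qed
      have "(\<Sum>i<card P. v i - u i) = (\<Sum>i<card P. measure lebesgue {u i<..<v i})"
        using uv by (intro sum.cong) (auto simp: less_imp_le)
      also have "\<dots> = measure lebesgue (\<Union>i<card P. {u i<..<v i})"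
      proof (rule measure_finite_Union[symmetric])
        show "disjoint_family_on (\<lambda>i. {u i<..<v i}) {..<card P}"
          unfolding disjoint_family_on_def using disj by blast
        show "emeasure lebesgue {u i<..<v i} \<noteq> \<infinity>" if "i \<in> {..<card P}" for i
          using uv[of i] that by (simp add: emeasure_lborel_Ioo less_imp_le)
      qed auto
      also have "\<dots> \<le> measure lebesgue U"
      proof (rule measure_mono_fmeasurable)
        show "(\<Union>i<card P. {u i<..<v i}) \<subseteq> U"
        proof (rule UN_least)
          fix i assume "i \<in> {..<card P}"
          then have "{u i..v i} \<subseteq> U" using uv[of i] by simp
          then show "{u i<..<v i} \<subseteq> U" by (rule order_trans[rotated]) auto
        qed
      qed (use U in auto)
      finally have "(\<Sum>i<card P. v i - u i) < \<delta>" using U(4) by linarith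
      moreover have "\<forall>i<card P. a \<le> u i \<and> u i \<le> v i \<and> v i \<le> b"
        using uv less_imp_le by blast
      ultimately have "(\<Sum>i<card P. norm (f (v i) - f (u i))) < e"
        using sep by (intro \<delta>) (unfold nonoverlapping_def, blast)
      also have "(\<Sum>i<card P. norm (f (v i) - f (u i))) = (\<Sum>y\<in>P. norm (f (Sup (snd y)) - f (Inf (snd y))))"
        unfolding u_def v_def by (rule sum.reindex_bij_betw[OF h, of "\<lambda>y. norm (f (Sup (snd y)) - f (Inf (snd y)))"])
      finally show ?thesis .
    qed
    have mono: "0 \<le> Sup (snd y) - Inf (snd y)" if "y \<in> p" for y
      using kk[of "fst y" "snd y"] that by fastforce
    have "norm (f b - f a) \<le> (\<Sum>y\<in>p. norm (f (Sup (snd y)) - f (Inf (snd y))))"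
      unfolding tel by (rule norm_sum)
    also have "\<dots> = (\<Sum>y\<in>p - P. norm (f (Sup (snd y)) - f (Inf (snd y)))) + (\<Sum>y\<in>P. norm (f (Sup (snd y)) - f (Inf (snd y))))"
      by (rule sum.subset_diff) (auto simp: P_def fin)
    also have "\<dots> \<le> (\<Sum>y\<in>p - P. (L + e) * (Sup (snd y) - Inf (snd y))) + e"
      using bad by (intro add_mono sum_mono good) auto
    also have "(\<Sum>y\<in>p - P. (L + e) * (Sup (snd y) - Inf (snd y))) \<le> (\<Sum>y\<in>p. (L + e) * (Sup (snd y) - Inf (snd y)))"
      using L0 \<open>e > 0\<close> mono by (intro sum_mono2 fin) auto
    also have "\<dots> = (L + e) * (b - a)" unfolding tel2 by (simp add: sum_distrib_left)
    finally show ?thesis by simp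
  qed
  show ?thesis
  proof (rule field_le_epsilon)
    fix e :: real assume "e > 0"
    define e' where "e' = e / (b - a + 1)"
    have "e' > 0" using \<open>e > 0\<close> ab by (simp add: e'_def)
    have "(L + e') * (b - a) + e' = L * (b - a) + e' * (b - a + 1)" by (simp add: algebra_simps)
    also have "e' * (b - a + 1) = e" using ab by (simp add: e'_def)
    finally show "norm (f b - f a) \<le> L * (b - a) + e" using main[OF \<open>e' > 0\<close>] by simp
  qed
qed

section \<open>Carnot--Caratheodory boxes\<close>

text \<open>Up to a constant, Carnot--Caratheodory balls are boxes sheared along the left translates
  of the horizontal plane.\<close>

definition heis_box :: "heis \<Rightarrow> real \<Rightarrow> heis set" where
  "heis_box p D = {q. \<bar>fst q - fst p\<bar> \<le> D \<and> \<bar>fst (snd q) - fst (snd p)\<bar> \<le> D \<and>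
     \<bar>snd (snd q) - snd (snd p) - (fst p * fst (snd q) - fst (snd p) * fst q)\<bar> \<le> 2 * D\<^sup>2}"

lemma horizontal_direction:
  "a1 *\<^sub>R X1 p + a2 *\<^sub>R X2 p = (a1, a2, a2 * fst p - a1 * fst (snd p))"
  by (cases p) (simp add: X1_def X2_def)

text \<open>The planar coordinates move at speed at most one. The height above the horizontal plane
  at the starting point has a derivative that involves only the planar displacement from that point,
  hence is at most \<open>2 * T\<close> on a curve of duration \<open>T\<close>.\<close>

lemma horizontal_curve_in_heis_box:
  assumes "horizontal_curve \<gamma> T"
  shows "\<gamma> T \<in> heis_box (\<gamma> 0) T"
proof -
  have T: "0 \<le> T" and ac: "abs_continuous_on 0 T \<gamma>"
    and der: "AE t in lborel. t \<in> {0..T} \<longrightarrow> (\<exists>a1 a2. a1\<^sup>2 + a2\<^sup>2 \<le> 1 \<and>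
           (\<gamma> has_vector_derivative (a1, a2, a2 * fst (\<gamma> t) - a1 * fst (snd (\<gamma> t)))) (at t))"
    using assms by (simp_all add: horizontal_curve_def horizontal_direction)
  have sq: "\<bar>a1\<bar> \<le> 1 \<and> \<bar>a2\<bar> \<le> 1" if "a1\<^sup>2 + a2\<^sup>2 \<le> 1" for a1 a2 :: real
  proof -
    have "a1\<^sup>2 \<le> 1" "a2\<^sup>2 \<le> 1" using that zero_le_power2[of a1] zero_le_power2[of a2] by linarith+
    then show ?thesis by (simp add: abs_square_le_1)
  qed
  have inc: "norm (h (\<gamma> t) - h (\<gamma> 0)) \<le> L * t"
    if t: "0 \<le> t" "t \<le> T" and h: "bounded_linear h" and L: "0 \<le> L"
      and hL: "\<And>s a1 a2. 0 \<le> s \<Longrightarrow> s \<le> t \<Longrightarrow> \<bar>a1\<bar> \<le> 1 \<Longrightarrow> \<bar>a2\<bar> \<le> 1 \<Longrightarrow>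
         \<bar>h (a1, a2, a2 * fst (\<gamma> s) - a1 * fst (snd (\<gamma> s)))\<bar> \<le> L"
    for h :: "heis \<Rightarrow> real" and t L
  proof -
    have "norm (h (\<gamma> t) - h (\<gamma> 0)) \<le> L * (t - 0)"
    proof (rule abs_continuous_on_increment_le[OF t(1) _ L])
      show "abs_continuous_on 0 t (\<lambda>t. h (\<gamma> t))"
        by (rule abs_continuous_on_bounded_linear[OF abs_continuous_on_subinterval[OF ac] h]) (use t in auto)
      show "AE s in lborel. s \<in> {0..t} \<longrightarrow> (\<exists>d. norm d \<le> L \<and> ((\<lambda>t. h (\<gamma> t)) has_vector_derivative d) (at s))"
        using der
      proof eventually_elim
        case (elim s)
        show ?case
        proof
          assume s: "s \<in> {0..t}"
          then have "s \<in> {0..T}" using t by auto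
          then obtain a1 a2 where a: "a1\<^sup>2 + a2\<^sup>2 \<le> 1"
            "(\<gamma> has_vector_derivative (a1, a2, a2 * fst (\<gamma> s) - a1 * fst (snd (\<gamma> s)))) (at s)"
            using elim by blast
          have "\<bar>h (a1, a2, a2 * fst (\<gamma> s) - a1 * fst (snd (\<gamma> s)))\<bar> \<le> L"
            using hL[of s a1 a2] sq[OF a(1)] s by simp
          then show "\<exists>d. norm d \<le> L \<and> ((\<lambda>t. h (\<gamma> t)) has_vector_derivative d) (at s)"
            using bounded_linear.has_vector_derivative[OF h a(2)] real_norm_def by metis
        qed
      qed
    qed
    then show ?thesis by simp
  qed
  have b1: "\<bar>fst (\<gamma> t) - fst (\<gamma> 0)\<bar> \<le> t" if "0 \<le> t" "t \<le> T" for t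
    using inc[OF that bounded_linear_fst, of 1] by simp
  have b2: "\<bar>fst (snd (\<gamma> t)) - fst (snd (\<gamma> 0))\<bar> \<le> t" if "0 \<le> t" "t \<le> T" for t
    using inc[OF that bounded_linear_compose[OF bounded_linear_fst bounded_linear_snd], of 1] by simp
  define p1 p2 where "p1 = fst (\<gamma> 0)" and "p2 = fst (snd (\<gamma> 0))"
  \<comment> \<open>Subtracting the plane at the starting point cancels the terms of the velocity
    that depend on where the curve starts; \<open>h\<close> stays linear, so \<open>inc\<close>
    applies.\<close>
  define h where "h q = snd (snd q) - (p1 * fst (snd q) - p2 * fst q)" for q :: heis
  have "bounded_linear h"
    unfolding h_def
    by (intro bounded_linear_sub bounded_linear_mult_right[THEN bounded_linear_compose]
        bounded_linear_compose[OF bounded_linear_fst bounded_linear_snd]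
        bounded_linear_compose[OF bounded_linear_snd bounded_linear_snd] bounded_linear_fst)
  have "norm (h (\<gamma> T) - h (\<gamma> 0)) \<le> (2 * T) * T"
  proof (rule inc[OF T order_refl \<open>bounded_linear h\<close>])
    fix s a1 a2 :: real assume s: "0 \<le> s" "s \<le> T" and a: "\<bar>a1\<bar> \<le> 1" "\<bar>a2\<bar> \<le> 1"
    have "\<bar>a2 * (fst (\<gamma> s) - p1)\<bar> \<le> 1 * T"
      unfolding abs_mult using a b1[OF s] s unfolding p1_def by (intro mult_mono) auto
    moreover have "\<bar>a1 * (fst (snd (\<gamma> s)) - p2)\<bar> \<le> 1 * T"
      unfolding abs_mult using a b2[OF s] s unfolding p2_def by (intro mult_mono) auto
    moreover have "h (a1, a2, a2 * fst (\<gamma> s) - a1 * fst (snd (\<gamma> s)))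
        = a2 * (fst (\<gamma> s) - p1) - a1 * (fst (snd (\<gamma> s)) - p2)"
      by (simp add: h_def algebra_simps)
    ultimately show "\<bar>h (a1, a2, a2 * fst (\<gamma> s) - a1 * fst (snd (\<gamma> s)))\<bar> \<le> 2 * T"
      by linarith
  qed (use T in simp)
  moreover have "h (\<gamma> T) - h (\<gamma> 0) = snd (snd (\<gamma> T)) - snd (snd (\<gamma> 0)) -
      (fst (\<gamma> 0) * fst (snd (\<gamma> T)) - fst (snd (\<gamma> 0)) * fst (\<gamma> T))"
    by (simp add: h_def p1_def p2_def)
  ultimately have b3: "\<bar>snd (snd (\<gamma> T)) - snd (snd (\<gamma> 0)) -
      (fst (\<gamma> 0) * fst (snd (\<gamma> T)) - fst (snd (\<gamma> 0)) * fst (\<gamma> T))\<bar> \<le> 2 * T\<^sup>2"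
    by (simp add: power2_eq_square)
  show ?thesis
    unfolding heis_box_def mem_Collect_eq using b1[OF T order_refl] b2[OF T order_refl] b3 by blast
qed

text \<open>A curve with continuous horizontal velocity may be too fast for
  \<open>horizontal_curve\<close>; stretching time by a bound \<open>K\<close> for the full velocity
  brings the coefficients into the unit disc.\<close>

lemma horizontal_curve_of_C1:
  fixes c :: "real \<Rightarrow> heis"
  assumes c: "\<And>t. (c has_vector_derivative (a t, b t, b t * fst (c t) - a t * fst (snd (c t)))) (at t)"
    and ab: "continuous_on UNIV a" "continuous_on UNIV b"
  shows "\<exists>\<gamma> T. horizontal_curve \<gamma> T \<and> \<gamma> 0 = c 0 \<and> \<gamma> T = c 1"
proof -
  define D where "D t = (a t, b t, b t * fst (c t) - a t * fst (snd (c t)))" for t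
  have cd: "(c has_vector_derivative D t) (at t)" for t
    using c[of t] by (simp only: D_def)
  have contc: "continuous_on UNIV c"
    using cd by (intro continuous_at_imp_continuous_on ballI) (blast intro: has_vector_derivative_continuous)
  have contD: "continuous_on UNIV D"
    unfolding D_def by (intro continuous_intros ab contc)
  have "compact (D ` {0..1})"
    by (rule compact_continuous_image[OF continuous_on_subset[OF contD]]) auto
  then obtain B where B: "\<And>t. t \<in> {0..1} \<Longrightarrow> norm (D t) \<le> B"
    by (meson compact_imp_bounded bounded_iff imageI)
  have ab2: "(a t)\<^sup>2 + (b t)\<^sup>2 \<le> (norm (D t))\<^sup>2" for t
    by (simp add: D_def norm_Pair)
  \<comment> \<open>The lower bound 1 keeps the division by \<open>K\<close> legitimate even when
    the velocity vanishes.\<close>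
  define K where "K = max B 1"
  have K: "K \<ge> 1" "B \<le> K" by (auto simp: K_def)
  define \<gamma> where "\<gamma> t = c (t / K)" for t
  have \<gamma>d: "(\<gamma> has_vector_derivative (1 / K) *\<^sub>R D (t / K)) (at t)" for t
  proof -
    have "((\<lambda>t. t / K) has_vector_derivative 1 / K) (at t)"
      using K by (auto intro!: derivative_eq_intros)
    from vector_diff_chain_at[OF this cd] have "((\<lambda>t. c (t / K)) has_vector_derivative (1 / K) *\<^sub>R D (t / K)) (at t)"
      by (simp add: o_def)
    moreover have "\<gamma> = (\<lambda>t. c (t / K))" by (rule ext) (simp add: \<gamma>_def)
    ultimately show ?thesis by simp
  qed
  have nD: "norm ((1 / K) *\<^sub>R D (t / K)) \<le> 1" if "t \<in> {0..K}" for t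
  proof -
    have "t / K \<in> {0..1}" using that K by (auto simp: field_simps)
    then have "norm (D (t / K)) \<le> K" using B K by force
    then show ?thesis using K by (simp add: field_simps)
  qed
  have "abs_continuous_on 0 K \<gamma>"
  proof (rule lipschitz_imp_abs_continuous_on)
    fix u v :: real assume uv: "0 \<le> u" "u \<le> v" "v \<le> K"
    have "norm (\<gamma> v - \<gamma> u) \<le> 1 * norm (v - u)"
    proof (rule differentiable_bound[of "{0..K}" \<gamma> "\<lambda>t h. h *\<^sub>R ((1 / K) *\<^sub>R D (t / K))"])
      fix t assume t: "t \<in> {0..K}"
      show "(\<gamma> has_derivative (\<lambda>h. h *\<^sub>R ((1 / K) *\<^sub>R D (t / K)))) (at t within {0..K})"
        using \<gamma>d[of t] by (auto simp: has_vector_derivative_def intro: has_derivative_at_withinI)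
      show "onorm (\<lambda>h. h *\<^sub>R ((1 / K) *\<^sub>R D (t / K))) \<le> 1"
      proof (rule onorm_le)
        fix h :: real
        have "\<bar>h\<bar> * norm ((1 / K) *\<^sub>R D (t / K)) \<le> \<bar>h\<bar> * 1"
          by (intro mult_left_mono nD[OF t]) simp
        then show "norm (h *\<^sub>R ((1 / K) *\<^sub>R D (t / K))) \<le> 1 * norm h" by simp
      qed
    qed (use uv in auto)
    then show "norm (\<gamma> v - \<gamma> u) \<le> 1 * (v - u)" using uv by simp
  qed
  moreover have "\<exists>a1 a2. a1\<^sup>2 + a2\<^sup>2 \<le> 1 \<and>
      (\<gamma> has_vector_derivative (a1 *\<^sub>R X1 (\<gamma> t) + a2 *\<^sub>R X2 (\<gamma> t))) (at t)" if t: "t \<in> {0..K}" for t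
  proof (intro exI conjI)
    have "(norm ((1 / K) *\<^sub>R D (t / K)))\<^sup>2 \<le> 1"
      using nD[OF t] by (simp only: power2_le_iff_abs_le abs_norm_cancel power_one abs_square_le_1)
    moreover have "(a (t / K) / K)\<^sup>2 + (b (t / K) / K)\<^sup>2 = ((a (t / K))\<^sup>2 + (b (t / K))\<^sup>2) / K\<^sup>2"
      by (simp add: power_divide add_divide_distrib)
    moreover have "\<dots> \<le> (norm (D (t / K)))\<^sup>2 / K\<^sup>2" by (intro divide_right_mono ab2) simp
    moreover have "\<dots> = (norm ((1 / K) *\<^sub>R D (t / K)))\<^sup>2" using K by (simp add: power_divide)
    ultimately show "(a (t / K) / K)\<^sup>2 + (b (t / K) / K)\<^sup>2 \<le> 1" by linarith
    show "(\<gamma> has_vector_derivative ((a (t / K) / K) *\<^sub>R X1 (\<gamma> t) + (b (t / K) / K) *\<^sub>R X2 (\<gamma> t))) (at t)"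
      using \<gamma>d[of t] by (simp add: horizontal_direction D_def \<gamma>_def diff_divide_distrib)
  qed
  ultimately have "horizontal_curve \<gamma> K"
    using K unfolding horizontal_curve_def by (intro conjI AE_I2 impI) auto
  moreover have "\<gamma> 0 = c 0" "\<gamma> K = c 1" using K by (auto simp: \<gamma>_def)
  ultimately show ?thesis by blast
qed

text \<open>The infimum in \<open>cc_dist\<close> would be an unspecified real if no curve joined
  the two points, and a bound on it would then carry no information. A straight planar segment is
  perturbed so as to reach the right height.\<close>

lemma horizontally_connected:
  "\<exists>\<gamma> T. horizontal_curve \<gamma> T \<and> \<gamma> 0 = p \<and> \<gamma> T = q"
proof -
  obtain p1 p2 p3 where p: "p = (p1, p2, p3)" by (cases p)
  obtain q1 q2 q3 where q: "q = (q1, q2, q3)" by (cases q)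
  \<comment> \<open>The perturbation changes the final height by \<open>m\<close> times twice the
    integral -1/70 found below, that is by \<open>- m / 35\<close>; hence the factor -35.\<close>
  define a b m where "a = q1 - p1" and "b = q2 - p2" and "m = -35 * (q3 - p3 - (p1 * b - p2 * a))"
  \<comment> \<open>The perturbations u and w vanish at both ends and have mean zero, so they change the height
    reached at time 1 only through the integral of u w', which is -1/70.\<close>
  define u w where "u t = t * (1 - t) * (1 - 2 * t)" and "w t = t * (1 - t) - 5 * (t * (1 - t))\<^sup>2" for t :: real
  \<comment> \<open>Primitives of \<open>u\<close>, \<open>w\<close> and \<open>u t * w' t\<close>,
    the only integrals left in the height of \<open>c\<close> after integration by parts. All vanish
    at 0; at 1, \<open>U\<close> and \<open>W\<close> vanish and \<open>V\<close> is -1/70.\<close>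
  define U W V where "U t = t^2/2 - t^3 + t^4/2" and "W t = t^2/2 - t^3/3 - 5 * (t^3/3 - t^4/2 + t^5/5)"
    and "V t = t^2/2 - t^3/3 - 14 * (t^3/3 - t^4/2 + t^5/5) + 40 * (t^4/4 - 3*t^5/5 + t^6/2 - t^7/7)" for t :: real
  define u' w' where "u' t = 1 - 6 * t + 6 * t^2" and "w' t = (1 - 2 * t) * (1 - 10 * (t * (1 - t)))" for t :: real
  have du: "(u has_real_derivative u' t) (at t)" for t
    unfolding u_def u'_def by (rule derivative_eq_intros refl)+ (simp add: algebra_simps power2_eq_square)
  have dw: "(w has_real_derivative w' t) (at t)" for t
    unfolding w_def w'_def by (rule derivative_eq_intros refl)+ (simp add: algebra_simps power2_eq_square)
  have dU: "(U has_real_derivative u t) (at t)" for t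
  proof -
    have "(U has_real_derivative t - 3 * t^2 + 2 * t^3) (at t)"
      unfolding U_def by (auto intro!: derivative_eq_intros simp: field_simps)
    also have "t - 3 * t^2 + 2 * t^3 = u t"
      unfolding u_def by algebra
    finally show ?thesis .
  qed
  have dW: "(W has_real_derivative w t) (at t)" for t
  proof -
    have "(W has_real_derivative t - t^2 - 5 * (t^2 - 2*t^3 + t^4)) (at t)"
      unfolding W_def by (auto intro!: derivative_eq_intros simp: field_simps)
    also have "t - t^2 - 5 * (t^2 - 2*t^3 + t^4) = w t"
      unfolding w_def by algebra
    finally show ?thesis .
  qed
  have dV: "(V has_real_derivative u t * w' t) (at t)" for t
  proof -
    have "(V has_real_derivative t - t^2 - 14 * (t^2 - 2*t^3 + t^4) + 40 * (t^3 - 3*t^4 + 3*t^5 - t^6)) (at t)"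
      unfolding V_def by (auto intro!: derivative_eq_intros simp: field_simps)
    also have "t - t^2 - 14 * (t^2 - 2*t^3 + t^4) + 40 * (t^3 - 3*t^4 + 3*t^5 - t^6) = u t * w' t"
      unfolding u_def w'_def by algebra
    finally show ?thesis .
  qed
  define c where "c t = (p1 + a * t + u t, p2 + b * t + m * w t,
     p3 + (p1 * b - p2 * a) * t + (p1 * m * w t - p2 * u t) + a * m * (t * w t - 2 * W t)
       + b * (2 * U t - t * u t) + m * (2 * V t - u t * w t))" for t
  have "\<exists>\<gamma> T. horizontal_curve \<gamma> T \<and> \<gamma> 0 = c 0 \<and> \<gamma> T = c 1"
  proof (rule horizontal_curve_of_C1[of c "\<lambda>t. a + u' t" "\<lambda>t. b + m * w' t"])
    fix t
    have "((\<lambda>t. p1 + a * t + u t) has_real_derivative a + u' t) (at t)"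
      by (rule derivative_eq_intros du refl)+ simp
    moreover have "((\<lambda>t. p2 + b * t + m * w t) has_real_derivative b + m * w' t) (at t)"
      by (rule derivative_eq_intros dw refl)+ simp
    moreover have "((\<lambda>t. p3 + (p1 * b - p2 * a) * t + (p1 * m * w t - p2 * u t) + a * m * (t * w t - 2 * W t)
       + b * (2 * U t - t * u t) + m * (2 * V t - u t * w t)) has_real_derivative
       (b + m * w' t) * (p1 + a * t + u t) - (a + u' t) * (p2 + b * t + m * w t)) (at t)"
      by (rule derivative_eq_intros du dw dU dW dV refl)+ (simp add: algebra_simps)
    ultimately show "(c has_vector_derivative (a + u' t, b + m * w' t,
        (b + m * w' t) * fst (c t) - (a + u' t) * fst (snd (c t)))) (at t)"
      unfolding c_def fst_conv snd_conv has_real_derivative_iff_has_vector_derivative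
      by (intro has_vector_derivative_Pair)
  qed (auto simp: u'_def w'_def intro!: continuous_intros)
  moreover have "c 0 = p"
    by (simp add: c_def p u_def w_def U_def V_def W_def)
  moreover have "c 1 = q"
    by (simp add: c_def q u_def w_def U_def V_def W_def a_def b_def m_def) (simp add: field_simps)
  ultimately show ?thesis by simp
qed

text \<open>The infimum is not known to be attained. Curves of duration below
  \<open>D + 1 / Suc n\<close> give slightly larger boxes, and their closed inequalities pass to the
  limit.\<close>

lemma cc_dist_le_imp_heis_box:
  assumes "cc_dist p q \<le> D"
  shows "q \<in> heis_box p D" and "0 \<le> D"
proof -
  define S where "S = {T. \<exists>\<gamma>. horizontal_curve \<gamma> T \<and> \<gamma> 0 = p \<and> \<gamma> T = q}"
  have ne: "S \<noteq> {}" using horizontally_connected[of p q] by (auto simp: S_def)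
  have S: "q \<in> heis_box p T \<and> 0 \<le> T" if "T \<in> S" for T
    using that horizontal_curve_in_heis_box by (auto simp: S_def horizontal_curve_def)
  have bdd: "bdd_below S" using S by (intro bdd_belowI[of _ 0]) auto
  have Inf: "Inf S \<le> D" using assms by (simp add: cc_dist_def S_def)
  have "0 \<le> Inf S" using S ne by (intro cInf_greatest) auto
  then show "0 \<le> D" using Inf by simp
  have ev: "\<exists>T \<in> S. T < D + e" if "e > 0" for e
    using cInf_lessD[OF ne, of "D + e"] Inf that by auto
  obtain T where T: "\<And>n::nat. T n \<in> S \<and> T n < D + 1 / Suc n"
  proof -
    have "\<forall>n::nat. \<exists>T. T \<in> S \<and> T < D + 1 / Suc n" 
    proof
      fix n :: nat
      have "0 < 1 / real (Suc n)" by simp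
      from ev[OF this] show "\<exists>T. T \<in> S \<and> T < D + 1 / real (Suc n)" by blast
    qed
    from choice[OF this] show ?thesis using that by blast
  qed
  have lim: "(\<lambda>n. D + 1 / Suc n) \<longlonglongrightarrow> D + 0"
    by (intro tendsto_intros LIMSEQ_Suc[OF lim_1_over_n])
  have box: "q \<in> heis_box p (D + 1 / Suc n)" for n
  proof -
    have t: "0 \<le> T n" "T n \<le> D + 1 / Suc n" "q \<in> heis_box p (T n)" using S[of "T n"] T[of n] less_imp_le by blast+
    then have "2 * (T n)\<^sup>2 \<le> 2 * (D + 1 / Suc n)\<^sup>2"
      by (intro mult_left_mono power_mono) simp_all
    with t show ?thesis unfolding heis_box_def mem_Collect_eq by linarith
  qed
  have lim2: "(\<lambda>n. 2 * (D + 1 / Suc n)\<^sup>2) \<longlonglongrightarrow> 2 * (D + 0)\<^sup>2"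
    by (intro tendsto_intros lim)
  show "q \<in> heis_box p D"
    unfolding heis_box_def mem_Collect_eq
    using LIMSEQ_le_const[OF lim, of "\<bar>fst q - fst p\<bar>"]
      LIMSEQ_le_const[OF lim, of "\<bar>fst (snd q) - fst (snd p)\<bar>"]
      LIMSEQ_le_const[OF lim2, of "\<bar>snd (snd q) - snd (snd p) - (fst p * fst (snd q) - fst (snd p) * fst q)\<bar>"] box
    unfolding heis_box_def mem_Collect_eq add_0_right by blast
qed

section \<open>Covers by boxes with small sums of cubes\<close>

definition cubically_null :: "heis set \<Rightarrow> bool" where
  "cubically_null E \<longleftrightarrow> (\<forall>\<epsilon>>0. \<exists>p D. (\<forall>n::nat. 0 \<le> D n) \<and> E \<subseteq> (\<Union>n. heis_box (p n) (D n)) \<and>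
     (\<Sum>n. ennreal (D n ^ 3)) \<le> ennreal \<epsilon>)"

text \<open>Writing \<open>D n ^ 3\<close> as
  \<open>D n powr (3 - \<alpha>) * D n powr \<alpha>\<close> shows that fine covers with bounded
  \<alpha>-sums have small cubic sums. From here on explicit boxes replace
  \<open>cc_dist\<close>.\<close>

lemma hausdorff_measure_finite_imp_cubically_null:
  assumes "\<alpha> < 3" "hausdorff_measure cc_dist \<alpha> E < top"
  shows "cubically_null E"
  unfolding cubically_null_def
proof (intro allI impI)
  fix \<epsilon> :: real assume \<epsilon>: "\<epsilon> > 0"
  obtain M where M: "hausdorff_measure cc_dist \<alpha> E = ennreal M" "0 \<le> M"
    using assms(2) by (cases "hausdorff_measure cc_dist \<alpha> E") auto
  \<comment> \<open>Chosen so that \<open>\<delta> powr (3 - \<alpha>) * (M + 1)\<close> equals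
    \<epsilon>; at every scale there are covers whose \<alpha>-sum is below
    \<open>M + 1\<close>.\<close>
  define \<delta> where "\<delta> = (\<epsilon> / (M + 1)) powr (1 / (3 - \<alpha>))"
  have \<delta>: "\<delta> > 0" "\<delta> powr (3 - \<alpha>) = \<epsilon> / (M + 1)"
    using \<epsilon> M assms(1) by (auto simp: \<delta>_def powr_powr)
  have "hausdorff_pre cc_dist \<alpha> \<delta> E \<le> hausdorff_measure cc_dist \<alpha> E"
    unfolding hausdorff_measure_def by (rule SUP_upper) (use \<delta> in simp)
  also have "\<dots> < ennreal (M + 1)" using M by (simp add: ennreal_less_iff)
  finally obtain C :: "nat \<Rightarrow> heis set" where C: "E \<subseteq> (\<Union>n. C n)"
    "\<And>n x y. x \<in> C n \<Longrightarrow> y \<in> C n \<Longrightarrow> cc_dist x y \<le> \<delta>"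
    "(\<Sum>n. ennreal (dist_diam cc_dist (C n) powr \<alpha>)) < ennreal (M + 1)"
    unfolding hausdorff_pre_def INF_less_iff by blast
  define D where "D n = dist_diam cc_dist (C n)" for n
  define p where "p n = (SOME x. x \<in> C n)" for n
  have key: "0 \<le> D n \<and> D n \<le> \<delta> \<and> C n \<subseteq> heis_box (p n) (D n)" for n
  proof (cases "C n = {}")
    case True
    then show ?thesis using \<delta> by (simp add: D_def dist_diam_def)
  next
    case False
    define S where "S = {cc_dist x y |x y. x \<in> C n \<and> y \<in> C n}"
    have DS: "D n = Sup S" using False by (simp add: D_def dist_diam_def S_def)
    have pn: "p n \<in> C n" unfolding p_def using False by (simp add: some_in_eq)
    have ub: "z \<le> \<delta>" if "z \<in> S" for z
      using that C(2) unfolding S_def mem_Collect_eq by (elim exE conjE) (simp only:)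
    have bdd: "bdd_above S" using ub by (rule bdd_aboveI)
    have pq: "cc_dist (p n) q \<le> D n" if "q \<in> C n" for q
    proof -
      have "cc_dist (p n) q \<in> S" unfolding S_def mem_Collect_eq
        by (intro exI[of _ "p n"] exI[of _ q] conjI refl pn that)
      then show ?thesis unfolding DS using bdd by (rule cSup_upper)
    qed
    have "cc_dist (p n) (p n) \<in> S" unfolding S_def mem_Collect_eq
      by (intro exI[of _ "p n"] conjI refl pn)
    then have "S \<noteq> {}" by blast
    have "D n \<le> \<delta>" unfolding DS by (rule cSup_least[OF \<open>S \<noteq> {}\<close> ub])
    then show ?thesis
      using cc_dist_le_imp_heis_box(2)[OF pq[OF pn]] cc_dist_le_imp_heis_box(1)[OF pq] by (intro conjI subsetI)
  qed
  have cube: "D n ^ 3 \<le> \<epsilon> / (M + 1) * D n powr \<alpha>" for n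
  \<comment> \<open>Sets of diameter zero contribute nothing on either side, since
    \<open>0 powr \<alpha>\<close> is 0.\<close>
  proof (cases "D n = 0")
    case False
    then have "D n > 0" using key[of n] by simp
    then have "D n ^ 3 = D n powr (3 - \<alpha>) * D n powr \<alpha>"
      by (simp flip: powr_add)
    also have "\<dots> \<le> \<delta> powr (3 - \<alpha>) * D n powr \<alpha>"
      using key[of n] assms(1) by (intro mult_right_mono powr_mono2) auto
    finally show ?thesis using \<delta> by simp
  qed simp
  have "(\<Sum>n. ennreal (D n ^ 3)) \<le> (\<Sum>n. ennreal (\<epsilon> / (M + 1)) * ennreal (D n powr \<alpha>))"
  proof (rule suminf_le)
    fix n
    show "ennreal (D n ^ 3) \<le> ennreal (\<epsilon> / (M + 1)) * ennreal (D n powr \<alpha>)"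
      using cube[of n] \<epsilon> M by (simp flip: ennreal_mult add: ennreal_leI)
  qed auto
  also have "\<dots> = ennreal (\<epsilon> / (M + 1)) * (\<Sum>n. ennreal (D n powr \<alpha>))" by simp
  also have "\<dots> \<le> ennreal (\<epsilon> / (M + 1)) * ennreal (M + 1)"
    using C(3) by (intro mult_left_mono) (auto simp: D_def)
  also have "\<dots> = ennreal \<epsilon>" using \<epsilon> M by (subst ennreal_mult[symmetric]) auto
  finally have "(\<Sum>n. ennreal (D n ^ 3)) \<le> ennreal \<epsilon>" .
  moreover have "E \<subseteq> (\<Union>n. heis_box (p n) (D n))"
    using C(1) UN_mono[of UNIV UNIV C "\<lambda>n. heis_box (p n) (D n)"] key by (meson order_trans subset_UNIV)
  ultimately show "\<exists>p D. (\<forall>n::nat. 0 \<le> D n) \<and> E \<subseteq> (\<Union>n. heis_box (p n) (D n)) \<and>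
     (\<Sum>n. ennreal (D n ^ 3)) \<le> ennreal \<epsilon>"
    using key by (intro exI[of _ p] exI[of _ D] conjI allI) blast+
qed

text \<open>The map exchanges \<open>X1\<close> and \<open>X2\<close> and sends boxes into boxes of
  the same size. It carries the graph of g(x1, x2) to the graph of - g(x2, x1), which transfers the
  results on rows to columns.\<close>

lemma cubically_null_swap:
  assumes "cubically_null E"
  shows "cubically_null ((\<lambda>q. (fst (snd q), fst q, - snd (snd q))) ` E)"
  unfolding cubically_null_def
proof (intro allI impI)
  fix \<epsilon> :: real assume "\<epsilon> > 0"
  then obtain p D where pD: "\<forall>n::nat. 0 \<le> D n" "E \<subseteq> (\<Union>n. heis_box (p n) (D n))"
     "(\<Sum>n. ennreal (D n ^ 3)) \<le> ennreal \<epsilon>"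
    using assms unfolding cubically_null_def by meson
  let ?s = "\<lambda>q::heis. (fst (snd q), fst q, - snd (snd q))"
  have sw: "?s q \<in> heis_box (?s p) d" if "q \<in> heis_box p d" for p q d
    using that unfolding heis_box_def mem_Collect_eq fst_conv snd_conv by linarith
  have "?s ` E \<subseteq> (\<Union>n. heis_box (?s (p n)) (D n))"
  proof (rule image_subsetI)
    fix q assume "q \<in> E"
    then obtain n where "q \<in> heis_box (p n) (D n)" using pD(2) by (meson UN_E subsetD)
    from sw[OF this] show "?s q \<in> (\<Union>n. heis_box (?s (p n)) (D n))" by (rule UN_I[OF UNIV_I])
  qed
  then show "\<exists>p D. (\<forall>n::nat. 0 \<le> D n) \<and> ?s ` E \<subseteq> (\<Union>n. heis_box (p n) (D n)) \<and>
     (\<Sum>n. ennreal (D n ^ 3)) \<le> ennreal \<epsilon>"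
    using pD(1,3) by (intro exI[of _ "\<lambda>n. ?s (p n)"] exI[of _ D] conjI)
qed

text \<open>The shear \<open>q \<mapsto> (q\<^sub>2, q\<^sub>3 + q\<^sub>1 q\<^sub>2)\<close> collapses the integral curves of \<open>X\<^sub>1\<close>, and maps a box of
  size \<open>D\<close> to a parallelogram of area \<open>O(D\<^sup>3)\<close>.\<close>

lemma cubically_null_imp_AE_slice_negligible:
  assumes "cubically_null E"
  shows "AE c in lborel. negligible {snd (snd q) + fst q * fst (snd q) |q. q \<in> E \<and> fst (snd q) = c}"
proof -
  have "\<forall>k::nat. \<exists>pD. (\<forall>n::nat. 0 \<le> snd pD n) \<and> E \<subseteq> (\<Union>n. heis_box (fst pD n) (snd pD n)) \<and>
     (\<Sum>n. ennreal (snd pD n ^ 3)) \<le> ennreal (1 / Suc k)"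
  proof
    fix k :: nat
    have "0 < 1 / real (Suc k)" by simp
    with assms obtain p D where "(\<forall>n::nat. 0 \<le> D n) \<and> E \<subseteq> (\<Union>n. heis_box (p n) (D n)) \<and>
     (\<Sum>n. ennreal (D n ^ 3)) \<le> ennreal (1 / Suc k)"
      unfolding cubically_null_def by meson
    then show "\<exists>pD. (\<forall>n::nat. 0 \<le> snd pD n) \<and> E \<subseteq> (\<Union>n. heis_box (fst pD n) (snd pD n)) \<and>
     (\<Sum>n. ennreal (snd pD n ^ 3)) \<le> ennreal (1 / Suc k)"
      by (intro exI[of _ "(p, D)"]) simp
  qed
  from choice[OF this] obtain pD where pD: "\<forall>k::nat. (\<forall>n::nat. 0 \<le> snd (pD k) n) \<and>
    E \<subseteq> (\<Union>n. heis_box (fst (pD k) n) (snd (pD k) n)) \<and>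
     (\<Sum>n. ennreal (snd (pD k) n ^ 3)) \<le> ennreal (1 / Suc k)" ..
  define p D where "p k n = fst (pD k) n" and "D k n = snd (pD k) n" for k n
  have D0: "0 \<le> D k n" and E: "E \<subseteq> (\<Union>n. heis_box (p k n) (D k n))"
    and sm: "(\<Sum>n. ennreal (D k n ^ 3)) \<le> ennreal (1 / Suc k)" for k n
    using pD by (auto simp only: p_def D_def)
  define P2 where "P2 k n = fst (snd (p k n))" for k n
  \<comment> \<open>Bounds the measure of the row \<open>c\<close> of the \<open>k\<close>-th
    projected cover: a box meets the row only if \<open>c\<close> is within \<open>D k n\<close> of
    its centre, and then inside an interval of length \<open>6 * (D k n)^2\<close>. Integrating over
    \<open>c\<close> yields \<open>12 * D k n ^ 3\<close>.\<close>
  define F where "F k c = (\<Sum>n. ennreal (6 * (D k n)\<^sup>2) * indicator {P2 k n - D k n..P2 k n + D k n} c)" for k c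
  have F_meas[measurable]: "F k \<in> borel_measurable lborel" for k
    unfolding F_def by measurable
  have intF: "(\<integral>\<^sup>+c. F k c \<partial>lborel) \<le> ennreal (12 / Suc k)" for k
  proof -
    have "(\<integral>\<^sup>+c. F k c \<partial>lborel) = (\<Sum>n. \<integral>\<^sup>+c. ennreal (6 * (D k n)\<^sup>2) * indicator {P2 k n - D k n..P2 k n + D k n} c \<partial>lborel)"
      unfolding F_def by (rule nn_integral_suminf) measurable
    also have "\<dots> = (\<Sum>n. ennreal 12 * ennreal (D k n ^ 3))"
    proof (rule suminf_cong)
      fix n
      have "(\<integral>\<^sup>+c. ennreal (6 * (D k n)\<^sup>2) * indicator {P2 k n - D k n..P2 k n + D k n} c \<partial>lborel)
        = ennreal (6 * (D k n)\<^sup>2) * ennreal (2 * D k n)"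
        using D0[of k n] by (subst nn_integral_cmult_indicator) (auto simp: emeasure_lborel_Icc)
      also have "\<dots> = ennreal (6 * (D k n)\<^sup>2 * (2 * D k n))"
        using D0[of k n] by (subst ennreal_mult) auto
      also have "6 * (D k n)\<^sup>2 * (2 * D k n) = 12 * D k n ^ 3" by algebra
      finally show "(\<integral>\<^sup>+c. ennreal (6 * (D k n)\<^sup>2) * indicator {P2 k n - D k n..P2 k n + D k n} c \<partial>lborel)
        = ennreal 12 * ennreal (D k n ^ 3)" using D0[of k n] by (subst ennreal_mult[symmetric]) auto
    qed
    also have "\<dots> = ennreal 12 * (\<Sum>n. ennreal (D k n ^ 3))" by (rule ennreal_suminf_cmult)
    also have "\<dots> \<le> ennreal 12 * ennreal (1 / Suc k)" by (intro mult_left_mono sm) simp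
    also have "\<dots> = ennreal (12 / Suc k)" by (subst ennreal_mult[symmetric]) auto
    finally show ?thesis .
  qed
  have "(\<integral>\<^sup>+c. (INF k. F k c) \<partial>lborel) \<le> 0"
  proof (rule ennreal_le_epsilon)
    fix e :: real assume "0 < e"
    then obtain k where k: "12 / e < real k" using reals_Archimedean2 by blast
    have "(\<integral>\<^sup>+c. (INF k. F k c) \<partial>lborel) \<le> (\<integral>\<^sup>+c. F k c \<partial>lborel)"
      by (intro nn_integral_mono INF_lower) simp
    also have "\<dots> \<le> ennreal (12 / Suc k)" by (rule intF)
    also have "12 / Suc k \<le> e" using k \<open>0 < e\<close> by (simp add: field_simps)
    finally show "(\<integral>\<^sup>+c. (INF k. F k c) \<partial>lborel) \<le> 0 + ennreal e" by (simp add: ennreal_leI)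
  qed
  then have "(\<integral>\<^sup>+c. (INF k. F k c) \<partial>lborel) = 0" by simp
  \<comment> \<open>Almost every row is thus covered at arbitrarily small cost by some cover, whose
    index \<open>k\<close> may depend on the row.\<close>
  then have "AE c in lborel. (INF k. F k c) = 0"
    by (subst (asm) nn_integral_0_iff_AE) measurable
  then show ?thesis
  proof eventually_elim
    case (elim c)
    show ?case
      unfolding negligible_outer_le
    proof (intro allI impI)
      fix e :: real assume "0 < e"
      then have "(INF k. F k c) < ennreal e" using elim by simp
      then obtain k where k: "F k c < ennreal e" unfolding INF_less_iff by blast
      \<comment> \<open>The value of the shear at the point of the horizontal plane over
        \<open>(fst (p k n), c)\<close>. Replacing \<open>fst q\<close> by
        \<open>fst (p k n)\<close> costs a product of two displacements, at most
        \<open>(D k n)^2\<close>; with the box bound \<open>2 * (D k n)^2\<close> this gives the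
        factor 3 below.\<close>
      define m where "m n = snd (snd (p k n)) + 2 * fst (p k n) * c - fst (p k n) * P2 k n" for n
      define T where "T n = (if c \<in> {P2 k n - D k n..P2 k n + D k n}
         then {m n - 3 * (D k n)\<^sup>2..m n + 3 * (D k n)\<^sup>2} else {})" for n
      have sub: "{snd (snd q) + fst q * fst (snd q) |q. q \<in> E \<and> fst (snd q) = c} \<subseteq> (\<Union>n. T n)"
      proof
        fix y assume "y \<in> {snd (snd q) + fst q * fst (snd q) |q. q \<in> E \<and> fst (snd q) = c}"
        then obtain q where q: "y = snd (snd q) + fst q * c" "q \<in> E" "fst (snd q) = c"
          unfolding mem_Collect_eq by (elim exE conjE) (simp only:)
        from E[of k] q(2) obtain n where n: "q \<in> heis_box (p k n) (D k n)" by (meson UN_E subsetD)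
        then have b: "\<bar>fst q - fst (p k n)\<bar> \<le> D k n" "\<bar>c - P2 k n\<bar> \<le> D k n"
          "\<bar>snd (snd q) - snd (snd (p k n)) - (fst (p k n) * c - P2 k n * fst q)\<bar> \<le> 2 * (D k n)\<^sup>2"
          unfolding heis_box_def mem_Collect_eq q(3) P2_def by blast+
        have "\<bar>(fst q - fst (p k n)) * (c - P2 k n)\<bar> \<le> D k n * D k n"
          unfolding abs_mult using b D0 by (intro mult_mono) auto
        then have "\<bar>(fst q - fst (p k n)) * (c - P2 k n)\<bar> \<le> (D k n)\<^sup>2" by (simp only: power2_eq_square)
        moreover have "y - m n = (snd (snd q) - snd (snd (p k n)) - (fst (p k n) * c - P2 k n * fst q)) +
          (fst q - fst (p k n)) * (c - P2 k n)"
          unfolding q(1) m_def by (simp add: algebra_simps)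
        ultimately have "\<bar>y - m n\<bar> \<le> 3 * (D k n)\<^sup>2" using b(3) by linarith
        then have "y \<in> T n" using b(2) unfolding T_def by auto
        then show "y \<in> (\<Union>n. T n)" by blast
      qed
      have Tm: "T n \<in> sets lborel" for n by (simp add: T_def)
      have "emeasure lborel (\<Union>n. T n) \<le> (\<Sum>n. emeasure lborel (T n))"
        by (rule emeasure_subadditive_countably) (use Tm in auto)
      also have "\<dots> = F k c"
        unfolding F_def by (rule suminf_cong) (auto simp: T_def emeasure_lborel_Icc)
      finally have em: "emeasure lborel (\<Union>n. T n) < ennreal e" using k by (rule order_le_less_trans)
      have Um: "(\<Union>n. T n) \<in> sets lborel" using Tm by blast
      then have em': "emeasure lebesgue (\<Union>n. T n) < ennreal e" using em by simp
      then have lm: "(\<Union>n. T n) \<in> lmeasurable"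
        using Um by (intro fmeasurableI) (auto intro: order_less_trans)
      then have "measure lebesgue (\<Union>n. T n) \<le> e"
        using em' \<open>0 < e\<close> by (simp add: emeasure_eq_measure2 ennreal_less_iff)
      with lm sub show "\<exists>T. {snd (snd q) + fst q * fst (snd q) |q. q \<in> E \<and> fst (snd q) = c} \<subseteq> T \<and>
          T \<in> lmeasurable \<and> measure lebesgue T \<le> e" by blast
    qed
  qed
qed

text \<open>At the point of the graph over \<open>(s, c)\<close> the shear has second component
  \<open>g (s, c) + c * s\<close>.\<close>

lemma cubically_null_graph_imp_AE_negligible:
  assumes "cubically_null {(x1, x2, g (x1, x2)) | x1 x2. 0 < x1 \<and> x1 < 1 \<and> 0 < x2 \<and> x2 < 1}"
  shows "AE c in lborel. c \<in> {0<..<1} \<longrightarrow> negligible ((\<lambda>s. g (s, c) + c * s) ` {0<..<1})"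
  using cubically_null_imp_AE_slice_negligible[OF assms]
proof eventually_elim
  case (elim c)
  show ?case
  proof
    assume c: "c \<in> {0<..<1}"
    show "negligible ((\<lambda>s. g (s, c) + c * s) ` {0<..<1})"
    proof (rule negligible_subset[OF elim], rule image_subsetI)
      fix s :: real assume "s \<in> {0<..<1}"
      then show "g (s, c) + c * s \<in> {snd (snd q) + fst q * fst (snd q) |q.
          q \<in> {(x1, x2, g (x1, x2)) | x1 x2. 0 < x1 \<and> x1 < 1 \<and> 0 < x2 \<and> x2 < 1} \<and> fst (snd q) = c}"
        using c unfolding mem_Collect_eq by (intro exI[of _ "(s, c, g (s, c))"]) (simp add: algebra_simps)
    qed
  qed
qed

section \<open>Functions of bounded variation on a subset of the line\<close>

text \<open>Meant for sorted lists, which may repeat points at no cost; chains can thus be truncated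
  by mapping \<open>min\<close> or \<open>max\<close> over them, without removing
  duplicates.\<close>

fun chain_var :: "(real \<Rightarrow> real) \<Rightarrow> real list \<Rightarrow> real" where
  "chain_var f (x # y # zs) = \<bar>f y - f x\<bar> + chain_var f (y # zs)"
| "chain_var f _ = 0"

text \<open>Partition points range over \<open>S\<close> only, because a function of bounded
  variation in the plane is controlled on a row merely off a null set.\<close>

definition bv_on_set :: "real set \<Rightarrow> (real \<Rightarrow> real) \<Rightarrow> bool" where
  "bv_on_set S f \<longleftrightarrow> (\<exists>M. \<forall>xs. sorted xs \<and> set xs \<subseteq> S \<longrightarrow> chain_var f xs \<le> M)"

text \<open>Defined for every real \<open>x\<close>, not just for points of \<open>S\<close>: under
  \<open>bv_on_set\<close> it is then a monotone function on the line, with countably many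
  discontinuities.\<close>

definition var_upto :: "real set \<Rightarrow> (real \<Rightarrow> real) \<Rightarrow> real \<Rightarrow> real" where
  "var_upto S f x = Sup {chain_var f xs |xs. sorted xs \<and> set xs \<subseteq> S \<inter> {..x}}"

lemma chain_var_nonneg: "0 \<le> chain_var f xs"
  by (induction f xs rule: chain_var.induct) auto

lemma chain_var_append_le: "chain_var f xs + chain_var f ys \<le> chain_var f (xs @ ys)"
proof (induction f xs rule: chain_var.induct)
  case ("2_2" f v)
  then show ?case by (cases ys) (auto simp: chain_var_nonneg)
qed (auto simp: chain_var_nonneg)

lemma chain_var_mono:
  assumes "\<And>x y. x \<in> set xs \<Longrightarrow> y \<in> set xs \<Longrightarrow> \<bar>F y - F x\<bar> \<le> \<bar>f y - f x\<bar>"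
  shows "chain_var F xs \<le> chain_var f xs"
  using assms by (induction f xs rule: chain_var.induct) (fastforce intro: add_mono)+

lemma chain_var_map: "chain_var f (map h xs) = chain_var (\<lambda>x. f (h x)) xs"
  by (induction f xs rule: chain_var.induct) auto

lemma chain_var_cong: "(\<And>x. x \<in> set xs \<Longrightarrow> f x = g x) \<Longrightarrow> chain_var f xs = chain_var g xs"
  by (induction f xs rule: chain_var.induct) auto

lemma sorted_map_min: "sorted xs \<Longrightarrow> sorted (map (\<lambda>x. min x (c::real)) xs)"
  by (induction xs) (auto simp: min_le_iff_disj)

lemma sorted_map_max: "sorted xs \<Longrightarrow> sorted (map (\<lambda>x. max x (c::real)) xs)"
  by (induction xs) auto

text \<open>A step that passes over \<open>x\<close> is split there by the triangle inequality
  through \<open>F x\<close>; for any other step one of the two truncated increments is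
  zero.\<close>

lemma chain_var_split:
  assumes "sorted xs"
  shows "chain_var F xs \<le> chain_var (\<lambda>z. F (min z x)) xs + chain_var (\<lambda>z. F (max z x)) xs"
  using assms
proof (induction F xs rule: chain_var.induct)
  case (1 F a b zs)
  then have "\<bar>F b - F a\<bar> \<le> \<bar>F (min b x) - F (min a x)\<bar> + \<bar>F (max b x) - F (max a x)\<bar>"
    by (auto simp: min_def max_def)
  then show ?case using 1 by simp
qed auto

context
  fixes S :: "real set" and f :: "real \<Rightarrow> real"
  assumes bv: "bv_on_set S f"
begin

lemma bdd_above_chain_var: "bdd_above {chain_var f xs |xs. sorted xs \<and> set xs \<subseteq> S \<inter> {..x}}"
proof -
  obtain M where M: "\<And>xs. sorted xs \<Longrightarrow> set xs \<subseteq> S \<Longrightarrow> chain_var f xs \<le> M"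
    using bv unfolding bv_on_set_def by blast
  show ?thesis by (rule bdd_aboveI[of _ M]) (auto intro!: M)
qed

lemma chain_var_le_var_upto:
  "sorted xs \<Longrightarrow> set xs \<subseteq> S \<Longrightarrow> (\<And>z. z \<in> set xs \<Longrightarrow> z \<le> x) \<Longrightarrow> chain_var f xs \<le> var_upto S f x"
  unfolding var_upto_def by (rule cSup_upper[OF _ bdd_above_chain_var]) blast

lemma var_upto_le:
  assumes "\<And>xs. sorted xs \<Longrightarrow> set xs \<subseteq> S \<Longrightarrow> (\<And>z. z \<in> set xs \<Longrightarrow> z \<le> x) \<Longrightarrow> chain_var f xs \<le> B"
  shows "var_upto S f x \<le> B"
  unfolding var_upto_def
proof (rule cSup_least)
  have "chain_var f [] \<in> {chain_var f xs |xs. sorted xs \<and> set xs \<subseteq> S \<inter> {..x}}"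
    unfolding mem_Collect_eq by (intro exI[of _ "[]"]) auto
  then show "{chain_var f xs |xs. sorted xs \<and> set xs \<subseteq> S \<inter> {..x}} \<noteq> {}" by blast
qed (use assms in blast)

lemma mono_var_upto: "mono (var_upto S f)"
proof (rule monoI)
  fix x y :: real assume "x \<le> y"
  show "var_upto S f x \<le> var_upto S f y"
    by (rule var_upto_le, rule chain_var_le_var_upto) (use \<open>x \<le> y\<close> in force)+
qed

lemma increment_le_var_upto:
  assumes "s \<in> S" "t \<in> S" "s \<le> t"
  shows "\<bar>f t - f s\<bar> \<le> var_upto S f t - var_upto S f s"
proof -
  have "var_upto S f s \<le> var_upto S f t - \<bar>f t - f s\<bar>"
  proof (rule var_upto_le)
    fix xs assume xs: "sorted xs" "set xs \<subseteq> S" "\<And>z. z \<in> set xs \<Longrightarrow> z \<le> s"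
    have "chain_var f xs + chain_var f [s, t] \<le> chain_var f (xs @ [s, t])" by (rule chain_var_append_le)
    also have "\<dots> \<le> var_upto S f t"
      by (rule chain_var_le_var_upto) (use xs assms in \<open>auto simp: sorted_append intro: order_trans\<close>)
    finally show "chain_var f xs \<le> var_upto S f t - \<bar>f t - f s\<bar>" by simp
  qed
  then show ?thesis by simp
qed

lemma bv_on_set_contraction:
  assumes "\<And>x y. x \<in> S \<Longrightarrow> y \<in> S \<Longrightarrow> \<bar>F y - F x\<bar> \<le> \<bar>f y - f x\<bar>"
  shows "bv_on_set S F"
proof -
  obtain M where M: "\<And>xs. sorted xs \<Longrightarrow> set xs \<subseteq> S \<Longrightarrow> chain_var f xs \<le> M"
    using bv unfolding bv_on_set_def by blast
  show ?thesis
    unfolding bv_on_set_def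
  proof (intro exI allI impI, elim conjE)
    fix xs assume "sorted xs" "set xs \<subseteq> S"
    then have "chain_var F xs \<le> chain_var f xs" using assms by (intro chain_var_mono) blast
    also have "\<dots> \<le> M" by (rule M) fact+
    finally show "chain_var F xs \<le> M" .
  qed
qed

end

text \<open>A chain for \<open>F\<close> up to \<open>y\<close> is cut at \<open>x\<close>; its
  upper half, remeasured with \<open>f\<close>, is attached to an arbitrary chain for
  \<open>f\<close> up to \<open>x\<close>. In effect \<open>F\<close> varies no more than
  \<open>f\<close> between \<open>x\<close> and \<open>y\<close>. The truncated chains stay in
  \<open>S\<close> because \<open>x\<close> belongs to it.\<close>

lemma var_upto_diff_mono:
  assumes bv: "bv_on_set S f" and contr: "\<And>x y. x \<in> S \<Longrightarrow> y \<in> S \<Longrightarrow> \<bar>F y - F x\<bar> \<le> \<bar>f y - f x\<bar>"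
    and xy: "x \<in> S" "x \<le> y"
  shows "var_upto S f x - var_upto S F x \<le> var_upto S f y - var_upto S F y"
proof -
  have bvF: "bv_on_set S F" using bv contr by (rule bv_on_set_contraction)
  have "var_upto S f x \<le> var_upto S f y + var_upto S F x - var_upto S F y"
  proof (rule var_upto_le[OF bv])
    fix xs assume xs: "sorted xs" "set xs \<subseteq> S" "\<And>z. z \<in> set xs \<Longrightarrow> z \<le> x"
    have "var_upto S F y \<le> var_upto S f y + var_upto S F x - chain_var f xs"
    proof (rule var_upto_le[OF bvF])
      fix ys assume ys: "sorted ys" "set ys \<subseteq> S" "\<And>z. z \<in> set ys \<Longrightarrow> z \<le> y"
      define lo hi where "lo = map (\<lambda>z. min z x) ys" and "hi = map (\<lambda>z. max z x) ys"
      have lo: "sorted lo" "set lo \<subseteq> S" "\<And>z. z \<in> set lo \<Longrightarrow> z \<le> x"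
        using ys xy sorted_map_min[OF ys(1), of x] by (auto simp: lo_def min_def)
      have hi: "sorted hi" "set hi \<subseteq> S" "\<And>z. z \<in> set hi \<Longrightarrow> x \<le> z \<and> z \<le> y"
        using ys xy sorted_map_max[OF ys(1), of x] by (auto simp: hi_def max_def)
      have "chain_var F ys \<le> chain_var F lo + chain_var F hi"
        using chain_var_split[OF ys(1), of F x] by (simp add: lo_def hi_def chain_var_map)
      moreover have "chain_var F lo \<le> var_upto S F x" by (rule chain_var_le_var_upto[OF bvF lo])
      moreover have "chain_var F hi \<le> chain_var f hi"
        using hi(2) contr by (intro chain_var_mono) blast
      moreover have "chain_var f xs + chain_var f hi \<le> chain_var f (xs @ hi)"
        by (rule chain_var_append_le)
      moreover have "chain_var f (xs @ hi) \<le> var_upto S f y"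
      proof (rule chain_var_le_var_upto[OF bv])
        show "sorted (xs @ hi)" using xs hi by (force simp: sorted_append)
        show "z \<le> y" if "z \<in> set (xs @ hi)" for z using that xs(3) hi(3) xy(2) by force
      qed (use xs hi in auto)
      ultimately show "chain_var F ys \<le> var_upto S f y + var_upto S F x - chain_var f xs" by linarith
    qed
    then show "chain_var f xs \<le> var_upto S f y + var_upto S F x - var_upto S F y" by linarith
  qed
  then show ?thesis by linarith
qed

text \<open>Pushing the points of a chain that lie beyond \<open>s\<close> back to \<open>s\<close>
  changes no value of \<open>F\<close>.\<close>

lemma var_upto_const:
  assumes bvF: "bv_on_set S F" and "s \<in> S" "s \<le> t"
    and const: "\<And>x. x \<in> S \<Longrightarrow> s \<le> x \<Longrightarrow> x \<le> t \<Longrightarrow> F x = F s"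
  shows "var_upto S F t \<le> var_upto S F s"
proof (rule var_upto_le[OF bvF])
  fix xs assume xs: "sorted xs" "set xs \<subseteq> S" "\<And>z. z \<in> set xs \<Longrightarrow> z \<le> t"
  have "F x = F (min x s)" if "x \<in> set xs" for x
    using const[of x] that xs by (auto simp: min_def)
  then have "chain_var F xs = chain_var F (map (\<lambda>z. min z s) xs)"
    unfolding chain_var_map by (rule chain_var_cong)
  also have "\<dots> \<le> var_upto S F s"
    by (rule chain_var_le_var_upto[OF bvF]) (use xs assms sorted_map_min[OF xs(1), of s] in \<open>auto simp: min_def\<close>)
  finally show "chain_var F xs \<le> var_upto S F s" .
qed

text \<open>Induction removes the interval with the largest right end. By disjointness all others
  end before its left end, which takes over the role of \<open>B\<close>.\<close>

lemma sum_increments_disjoint_intervals: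
  fixes u :: "real \<Rightarrow> real"
  assumes "finite J" and mono: "\<And>x y. x \<in> S \<Longrightarrow> y \<in> S \<Longrightarrow> x \<le> y \<Longrightarrow> u x \<le> u y"
    and nonneg: "\<And>x. x \<in> S \<Longrightarrow> 0 \<le> u x"
    and J: "\<And>j. j \<in> J \<Longrightarrow> fst j \<in> S \<and> snd j \<in> S \<and> fst j \<le> snd j"
    and disj: "pairwise (\<lambda>i j. disjnt {fst i..snd i} {fst j..snd j}) J"
    and B: "B \<in> S" "\<And>j. j \<in> J \<Longrightarrow> snd j \<le> B"
  shows "(\<Sum>j\<in>J. u (snd j) - u (fst j)) \<le> u B"
  using assms(1) J disj B
proof (induction J arbitrary: B rule: finite_ranking_induct[where f = snd])
  case empty
  then show ?case using nonneg by simp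
next
  case (insert x J)
  show ?case
  proof (cases "x \<in> J")
    case True
    then show ?thesis using insert by (simp add: insert_absorb)
  next
    case False
    have x: "fst x \<in> S" "snd x \<in> S" "fst x \<le> snd x" using insert.prems(1) by auto
    have lt: "snd j \<le> fst x" if j: "j \<in> J" for j
    proof -
      have "j \<noteq> x" using j False by auto
      then have "disjnt {fst j..snd j} {fst x..snd x}"
        using insert.prems(2) j by (auto simp: pairwise_def)
      moreover have "snd j \<le> snd x" "fst j \<le> snd j" using insert.hyps j insert.prems(1) by auto
      moreover have "fst x \<in> {fst j..snd j} \<inter> {fst x..snd x} \<or> fst j \<in> {fst j..snd j} \<inter> {fst x..snd x} \<or> snd j \<le> fst x"
        using calculation(2,3) x(3) by (simp; linarith)
      ultimately show ?thesis unfolding disjnt_def by blast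
    qed
    have "(\<Sum>j\<in>J. u (snd j) - u (fst j)) \<le> u (fst x)"
      by (rule insert.IH) (use insert.prems lt x in \<open>auto simp: pairwise_insert\<close>)
    moreover have "u (snd x) \<le> u B" using x insert.prems(3,4) by (intro mono) auto
    ultimately show ?thesis using False insert.hyps by simp
  qed
qed

text \<open>Composing \<open>f\<close> with this map removes the variation of \<open>f\<close> inside \<open>U\<close>, at the cost of at most the
  measure of \<open>U\<close> for each increment.\<close>

definition collapse :: "real set \<Rightarrow> real \<Rightarrow> real" where
  "collapse U y = y - measure lebesgue (U \<inter> {..y})"

lemma collapse_increment:
  assumes "U \<in> lmeasurable" "y \<le> z"
  shows "collapse U z - collapse U y = (z - y) - measure lebesgue (U \<inter> {y<..z})"
proof -
  have "U \<inter> {..z} = (U \<inter> {..y}) \<union> (U \<inter> {y<..z})" using assms(2) by auto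
  moreover have "measure lebesgue ((U \<inter> {..y}) \<union> (U \<inter> {y<..z}))
      = measure lebesgue (U \<inter> {..y}) + measure lebesgue (U \<inter> {y<..z})"
  proof -
    have "U \<inter> {..y} \<in> lmeasurable" "U \<inter> {y<..z} \<in> lmeasurable"
      using assms(1) by (auto intro: fmeasurable_Int_fmeasurable)
    moreover have "(U \<inter> {y<..z}) - (U \<inter> {..y}) = U \<inter> {y<..z}" by auto
    ultimately show ?thesis using measure_Un2 by metis
  qed
  ultimately show ?thesis by (simp add: collapse_def)
qed

lemma collapse_bounds:
  assumes U: "U \<in> lmeasurable"
  shows "\<bar>collapse U z - collapse U y\<bar> \<le> \<bar>z - y\<bar>"
    and "\<bar>z - y\<bar> - measure lebesgue U \<le> \<bar>collapse U z - collapse U y\<bar>"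
proof -
  have *: "\<bar>collapse U z - collapse U y\<bar> \<le> \<bar>z - y\<bar> \<and> \<bar>z - y\<bar> - measure lebesgue U \<le> \<bar>collapse U z - collapse U y\<bar>"
    if "y \<le> z" for y z
  proof -
    have "{y<..z} \<in> lmeasurable" using that by (intro fmeasurableI) auto
    then have "measure lebesgue (U \<inter> {y<..z}) \<le> measure lebesgue {y<..z}"
      using U by (intro measure_mono_fmeasurable) (auto simp: fmeasurableD)
    moreover have "measure lebesgue {y<..z} = z - y" using that by simp
    moreover have "measure lebesgue (U \<inter> {y<..z}) \<le> measure lebesgue U"
      using U by (intro measure_mono_fmeasurable) (auto simp: fmeasurableD)
    moreover have "0 \<le> measure lebesgue (U \<inter> {y<..z})" by simp
    ultimately show ?thesis using collapse_increment[OF U that] by linarith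
  qed
  show "\<bar>collapse U z - collapse U y\<bar> \<le> \<bar>z - y\<bar>"
    "\<bar>z - y\<bar> - measure lebesgue U \<le> \<bar>collapse U z - collapse U y\<bar>"
    using *[of y z] *[of z y] by (cases "y \<le> z"; simp add: abs_minus_commute)+
qed

lemma collapse_eq:
  assumes "U \<in> lmeasurable" "{min y z..max y z} \<subseteq> U"
  shows "collapse U z = collapse U y"
proof -
  have "collapse U z = collapse U y" if "y \<le> z" "{y..z} \<subseteq> U" for y z
  proof -
    have "U \<inter> {y<..z} = {y<..z}" using that by auto
    then show ?thesis using collapse_increment[OF assms(1) that(1)] that(1) by simp
  qed
  from this[of "min y z" "max y z"] assms(2) show ?thesis by (auto simp: min_def max_def split: if_splits)
qed

lemma chain_var_ge:
  fixes \<mu> :: real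
  assumes "\<And>x y. \<bar>f y - f x\<bar> - \<mu> \<le> \<bar>F y - F x\<bar>" "0 \<le> \<mu>"
  shows "chain_var f xs - length xs * \<mu> \<le> chain_var F xs"
proof (induction xs rule: induct_list012)
  case (3 x y zs)
  then show ?case using assms(1)[of y x] by (simp add: algebra_simps)
qed (use assms(2) in auto)

text \<open>Let \<open>U\<close> be a small neighbourhood of the null set \<open>f(E)\<close> and \<open>F = collapse U \<circ> f\<close>. The variation
  functions of \<open>f\<close> and \<open>F\<close> differ by a monotone function of small total increment, which nevertheless
  grows by at least \<open>m |I|\<close> on each Vitali interval \<open>I\<close> around a steep point, since \<open>F\<close> is constant there.\<close>

lemma bv_steep_points_negligible:
  assumes bv: "bv_on_set S f" and ES: "E \<subseteq> S" and null: "negligible (f ` E)" and m: "m > 0"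
  shows "negligible {s \<in> E. \<forall>d>0. \<exists>t\<in>S. 0 < \<bar>t - s\<bar> \<and> \<bar>t - s\<bar> < d \<and> m * \<bar>t - s\<bar> < \<bar>f t - f s\<bar>}"
    (is "negligible ?E")
proof -
  define v where "v = var_upto S f"
  have inc: "\<bar>f t - f s\<bar> \<le> \<bar>v t - v s\<bar>" if "s \<in> S" "t \<in> S" for s t
    using increment_le_var_upto[OF bv that] increment_le_var_upto[OF bv that(2,1)]
    by (cases "s \<le> t") (auto simp: v_def)
  \<comment> \<open>Off the countably many discontinuities of \<open>v\<close>, the bound
    \<open>inc\<close> makes the restriction of \<open>f\<close> to \<open>S\<close>
    continuous.\<close>
  define Z where "Z = {a. \<not> isCont v a}"
  have "countable Z" unfolding Z_def v_def by (rule mono_ctble_discont[OF mono_var_upto[OF bv]])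
  then have negZ: "negligible Z" 
    by (simp add: negligible_iff_null_sets countable_imp_null_set_lborel null_sets_completionI)
  define E' where "E' = ?E - Z"
  have "negligible E'"
    unfolding negligible_outer_le
  proof (intro allI impI)
    fix e :: real assume e: "0 < e"
    define Ch where "Ch = {chain_var f xs |xs. sorted xs \<and> set xs \<subseteq> S}"
    have bdd: "bdd_above Ch" using bv unfolding bv_on_set_def Ch_def bdd_above_def by blast
    have "chain_var f [] \<in> Ch" unfolding Ch_def by (intro CollectI exI[of _ "[]"]) auto
    then have "Ch \<noteq> {}" by blast
    moreover have "Sup Ch - m * e / 2 < Sup Ch" using e m by simp
    ultimately obtain c where "c \<in> Ch" "Sup Ch - m * e / 2 < c" by (meson less_cSupD)
    then obtain xs where xs: "sorted xs" "set xs \<subseteq> S" "Sup Ch - m * e / 2 < chain_var f xs"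
      unfolding Ch_def by blast
    have opt: "chain_var f ys \<le> chain_var f xs + m * e / 2" if "sorted ys" "set ys \<subseteq> S" for ys
    proof -
      have "chain_var f ys \<le> Sup Ch" using that unfolding Ch_def[symmetric]
        by (intro cSup_upper[OF _ bdd]) (auto simp: Ch_def)
      then show ?thesis using xs(3) by linarith
    qed
    \<comment> \<open>The nearly optimal chain \<open>xs\<close> is fixed before \<open>U\<close>,
      so that a loss of one measure of \<open>U\<close> per increment adds up to at most
      \<open>m * e / 2\<close>.\<close>
    have "0 < m * e / (2 * (length xs + 1))" using e m by (simp add: field_simps)
    then obtain U where U: "open U" "f ` E \<subseteq> U" "U \<in> lmeasurable"
      "measure lebesgue U < m * e / (2 * (length xs + 1))"
      using null_set_open_superset null by (metis negligible_iff_null_sets)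
    have lenU: "length xs * measure lebesgue U \<le> m * e / 2"
    proof -
      have "length xs * measure lebesgue U \<le> (length xs + 1) * (m * e / (2 * (length xs + 1)))"
        using U(4) by (intro mult_mono) auto
      also have "\<dots> = m * e / 2" by (simp add: field_simps)
      finally show ?thesis .
    qed
    define F where "F x = collapse U (f x)" for x
    have contr: "\<bar>F y - F x\<bar> \<le> \<bar>f y - f x\<bar>" for x y
      unfolding F_def by (rule collapse_bounds[OF U(3)])
    have bvF: "bv_on_set S F" using bv contr by (rule bv_on_set_contraction)
    define vF where "vF = var_upto S F"
    define K where "K = {j. fst j \<in> S \<and> snd j \<in> S \<and> fst j < snd j \<and>
      m * (snd j - fst j) < \<bar>f (snd j) - f (fst j)\<bar> \<and> (\<forall>x\<in>S. fst j \<le> x \<and> x \<le> snd j \<longrightarrow> F x = F (fst j))}"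
    define a r where "a j = (fst j + snd j) / 2" and "r j = (snd j - fst j) / 2" for j :: "real \<times> real"
    have cb: "cball (a j) (r j) = {fst j..snd j}" for j
      by (simp add: cball_eq_atLeastAtMost a_def r_def field_simps)
    have rpos: "0 < r j" if "j \<in> K" for j using that unfolding K_def r_def by simp
    have cover: "\<exists>j. j \<in> K \<and> s \<in> cball (a j) (r j) \<and> r j < d" if s: "s \<in> E'" and d: "0 < d" for s d
    proof -
      have sE: "s \<in> E" "s \<in> S" "isCont v s" using s ES by (auto simp: E'_def Z_def)
      then obtain \<rho> where \<rho>: "\<rho> > 0" "ball (f s) \<rho> \<subseteq> U" using U(1,2) by (metis image_subset_iff openE)
      obtain d1 where d1: "d1 > 0" "\<And>x. \<bar>x - s\<bar> < d1 \<Longrightarrow> \<bar>v x - v s\<bar> < \<rho>"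
        using sE(3) \<rho>(1) unfolding continuous_at_eps_delta dist_real_def by blast
      have "0 < min d d1" using d d1 by simp
      then obtain t where t: "t \<in> S" "0 < \<bar>t - s\<bar>" "\<bar>t - s\<bar> < min d d1" "m * \<bar>t - s\<bar> < \<bar>f t - f s\<bar>"
        using s unfolding E'_def by blast
      \<comment> \<open>All points of \<open>S\<close> between \<open>s\<close> and \<open>t\<close>
        have values in one interval inside \<open>U\<close>; hence \<open>F\<close> is constant on
        them, not merely equal at the two ends.\<close>
      have near: "f x \<in> ball (f s) \<rho>" if "x \<in> S" "\<bar>x - s\<bar> \<le> \<bar>t - s\<bar>" for x
        using inc[OF sE(2) that(1)] d1(2)[of x] that(2) t(3) by (simp add: dist_real_def abs_minus_commute)
      define j where "j = (min s t, max s t)"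
      have cF: "F x = F (fst j)" if x: "x \<in> S" "fst j \<le> x" "x \<le> snd j" for x
      proof -
        have "\<bar>x - s\<bar> \<le> \<bar>t - s\<bar>" "fst j \<in> S" "\<bar>fst j - s\<bar> \<le> \<bar>t - s\<bar>"
          using x t(1) sE(2) by (auto simp: j_def min_def max_def split: if_splits)
        then have "f x \<in> ball (f s) \<rho>" "f (fst j) \<in> ball (f s) \<rho>" using near x(1) by blast+
        then have "{min (f (fst j)) (f x)..max (f (fst j)) (f x)} \<subseteq> ball (f s) \<rho>"
          by (auto simp: ball_eq_greaterThanLessThan)
        then show ?thesis unfolding F_def using \<rho>(2) by (intro collapse_eq[OF U(3)]) blast
      qed
      have jj: "fst j \<in> S" "snd j \<in> S" "fst j < snd j" "snd j - fst j = \<bar>t - s\<bar>"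
        "\<bar>f (snd j) - f (fst j)\<bar> = \<bar>f t - f s\<bar>"
        using t sE(2) by (auto simp: j_def min_def max_def)
      have "m * (snd j - fst j) < \<bar>f (snd j) - f (fst j)\<bar>" using t(4) jj by simp
      with jj cF have "j \<in> K" unfolding K_def mem_Collect_eq by blast
      moreover have "s \<in> cball (a j) (r j)" unfolding cb by (simp add: j_def)
      moreover have "r j < d" using t(3) d \<open>snd j - fst j = \<bar>t - s\<bar>\<close> by (simp add: r_def)
      ultimately show ?thesis by blast
    qed
    obtain C where C: "countable C" "C \<subseteq> K"
      "pairwise (\<lambda>i j. disjnt (cball (a i) (r i)) (cball (a j) (r j))) C"
      "negligible (E' - (\<Union>i\<in>C. cball (a i) (r i)))"
      by (rule Vitali_covering_theorem_cballs[OF rpos cover])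
    have bound: "measure lebesgue (\<Union>i\<in>J. cball (a i) (r i)) \<le> e" if J: "J \<subseteq> C" "finite J" for J
    proof (cases "J = {}")
      case False
      \<comment> \<open>To the right of all intervals and of the whole chain \<open>xs\<close>, so
        that \<open>vF B\<close> is at least the variation of \<open>F\<close> along
        \<open>xs\<close>, which is at least \<open>v B - m * e\<close>.\<close>
      define B where "B = Max (snd ` J \<union> set xs)"
      have finB: "finite (snd ` J \<union> set xs)" "snd ` J \<union> set xs \<noteq> {}" using J False by auto
      have JK: "j \<in> K" if "j \<in> J" for j using that J C(2) by blast
      have "snd ` J \<union> set xs \<subseteq> S" using xs(2) JK unfolding K_def mem_Collect_eq by blast
      then have BS: "B \<in> S" using Max_in[OF finB] unfolding B_def by (rule subsetD)
      have Bub: "z \<le> B" if "z \<in> snd ` J \<union> set xs" for z unfolding B_def using finB(1) that by (rule Max_ge)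
      have step: "m * (snd j - fst j) \<le> (v (snd j) - vF (snd j)) - (v (fst j) - vF (fst j))" if "j \<in> J" for j
      proof -
        have j: "fst j \<in> S" "snd j \<in> S" "fst j < snd j" "m * (snd j - fst j) < \<bar>f (snd j) - f (fst j)\<bar>"
          "\<And>x. x \<in> S \<Longrightarrow> fst j \<le> x \<Longrightarrow> x \<le> snd j \<Longrightarrow> F x = F (fst j)"
          using JK[OF that] unfolding K_def mem_Collect_eq by blast+
        have "vF (snd j) \<le> vF (fst j)"
          unfolding vF_def by (rule var_upto_const[OF bvF j(1) less_imp_le[OF j(3)]]) (use j(5) in blast)
        moreover have "\<bar>f (snd j) - f (fst j)\<bar> \<le> v (snd j) - v (fst j)"
          unfolding v_def by (rule increment_le_var_upto[OF bv j(1,2) less_imp_le[OF j(3)]])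
        ultimately show ?thesis using j(4) by linarith
      qed
      have "(\<Sum>j\<in>J. (v (snd j) - vF (snd j)) - (v (fst j) - vF (fst j))) \<le> v B - vF B"
      proof (rule sum_increments_disjoint_intervals[OF J(2), of S "\<lambda>x. v x - vF x"])
        show "v x - vF x \<le> v y - vF y" if "x \<in> S" "y \<in> S" "x \<le> y" for x y
          unfolding v_def vF_def using var_upto_diff_mono[OF bv contr that(1,3)] .
        show "0 \<le> v x - vF x" if "x \<in> S" for x
        proof -
          have "vF x \<le> v x" unfolding vF_def v_def
          proof (rule var_upto_le[OF bvF])
            fix ys assume ys: "sorted ys" "set ys \<subseteq> S" "\<And>z. z \<in> set ys \<Longrightarrow> z \<le> x"
            have "chain_var F ys \<le> chain_var f ys" using contr by (intro chain_var_mono) blast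
            also have "\<dots> \<le> var_upto S f x" by (rule chain_var_le_var_upto[OF bv ys])
            finally show "chain_var F ys \<le> var_upto S f x" .
          qed
          then show ?thesis by simp
        qed
        show "fst j \<in> S \<and> snd j \<in> S \<and> fst j \<le> snd j" if "j \<in> J" for j
          using JK[OF that] unfolding K_def mem_Collect_eq by (meson less_imp_le)
        show "pairwise (\<lambda>i j. disjnt {fst i..snd i} {fst j..snd j}) J"
          using pairwise_subset[OF C(3) J(1)] by (simp add: cb)
      qed (use BS Bub in auto)
      also have "v B - vF B \<le> m * e"
      proof -
        have "v B \<le> chain_var f xs + m * e / 2"
          unfolding v_def by (rule var_upto_le[OF bv]) (rule opt)
        moreover have "chain_var F xs \<le> vF B"
          unfolding vF_def by (rule chain_var_le_var_upto[OF bvF xs(1,2)]) (use Bub in auto)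
        moreover have "chain_var f xs - length xs * measure lebesgue U \<le> chain_var F xs"
          unfolding F_def by (rule chain_var_ge) (use collapse_bounds(2)[OF U(3)] in auto)
        ultimately show ?thesis using lenU by linarith
      qed
      finally have "(\<Sum>j\<in>J. m * (snd j - fst j)) \<le> m * e"
        by (rule order_trans[rotated]) (rule sum_mono, rule step)
      then have "m * (\<Sum>j\<in>J. snd j - fst j) \<le> m * e" by (simp add: sum_distrib_left)
      then have le: "(\<Sum>j\<in>J. snd j - fst j) \<le> e" using m by simp
      have "measure lebesgue (\<Union>i\<in>J. cball (a i) (r i)) \<le> (\<Sum>j\<in>J. measure lebesgue (cball (a j) (r j)))"
        by (rule measure_UNION_le) (use J in auto)
      also have "\<dots> = (\<Sum>j\<in>J. snd j - fst j)"
        unfolding cb using JK unfolding K_def mem_Collect_eq by (intro sum.cong) (simp_all add: less_imp_le)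
      finally show ?thesis using le by linarith
    qed (use e in simp)
    show "\<exists>T. E' \<subseteq> T \<and> T \<in> lmeasurable \<and> measure lebesgue T \<le> e"
      by (rule lmeasurable_superset_of_almost_cover[OF C(4) fmeasurable_UN_bound[OF C(1) _ bound]
          measure_UN_bound[OF C(1) _ bound]]) simp_all
  qed
  with negZ have "negligible (E' \<union> Z)" by (rule negligible_Un[rotated])
  then show ?thesis by (rule negligible_subset) (auto simp: E'_def)
qed

text \<open>Vitali balls in which the complement of \<open>B\<close> takes a share above
  \<open>m\<close> are chosen disjoint inside an open \<open>U\<close> that exceeds \<open>B\<close>
  by measure at most \<open>m * e\<close>; their total measure is then at most
  \<open>e\<close>.\<close>

lemma lebesgue_density:
  fixes B :: "'a::euclidean_space set"
  assumes B: "B \<in> sets lebesgue" and m: "m > 0"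
  shows "negligible {x \<in> B. \<forall>d>0. \<exists>r. 0 < r \<and> r < d \<and>
     m * measure lebesgue (cball x r) < measure lebesgue (cball x r - B)}" (is "negligible ?E")
  unfolding negligible_outer_le
proof (intro allI impI)
  fix e :: real assume e: "0 < e"
  obtain U where U: "open U" "B \<subseteq> U" "U - B \<in> lmeasurable" "emeasure lebesgue (U - B) < ennreal (m * e)"
    using sets_lebesgue_outer_open[OF B, of "m * e"] m e by auto
  have mU: "measure lebesgue (U - B) \<le> m * e"
    using U(3,4) m e by (simp add: emeasure_eq_measure2 ennreal_less_iff)
  define K where "K = {j. 0 < snd j \<and> cball (fst j) (snd j) \<subseteq> U \<and>
    m * measure lebesgue (cball (fst j) (snd j)) < measure lebesgue (cball (fst j) (snd j) - B)}"
  have cover: "\<exists>j. j \<in> K \<and> x \<in> cball (fst j) (snd j) \<and> snd j < d" if x: "x \<in> ?E" and d: "0 < d" for x d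
  proof -
    obtain d1 where d1: "0 < d1" "cball x d1 \<subseteq> U" 
    proof -
      have "x \<in> U" using x U(2) by blast
      then show ?thesis using that U(1) unfolding open_contains_cball by blast
    qed
    have "0 < min d d1" using d d1 by simp
    then obtain r where r: "0 < r" "r < min d d1"
      "m * measure lebesgue (cball x r) < measure lebesgue (cball x r - B)" using x by blast
    have "cball x r \<subseteq> cball x d1" using r by (intro subset_cball) simp
    then show ?thesis using r d1 by (intro exI[of _ "(x, r)"]) (auto simp: K_def)
  qed
  obtain C where C: "countable C" "C \<subseteq> K"
    "pairwise (\<lambda>i j. disjnt (cball (fst i) (snd i)) (cball (fst j) (snd j))) C"
    "negligible (?E - (\<Union>i\<in>C. cball (fst i) (snd i)))"
    by (rule Vitali_covering_theorem_cballs[OF _ cover]) (simp add: K_def)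
  have bound: "measure lebesgue (\<Union>i\<in>J. cball (fst i) (snd i)) \<le> e" if J: "J \<subseteq> C" "finite J" for J
  proof -
    have JK: "j \<in> K" if "j \<in> J" for j using that J C(2) by blast
    have fm: "cball (fst j) (snd j) - B \<in> lmeasurable" for j
      using B by (intro fmeasurable_Diff) auto
    have "m * measure lebesgue (\<Union>i\<in>J. cball (fst i) (snd i)) \<le> m * (\<Sum>j\<in>J. measure lebesgue (cball (fst j) (snd j)))"
      using m by (intro mult_left_mono measure_UNION_le) (use J in auto)
    also have "\<dots> \<le> (\<Sum>j\<in>J. measure lebesgue (cball (fst j) (snd j) - B))"
      unfolding sum_distrib_left using JK by (intro sum_mono) (auto simp: K_def less_imp_le)
    also have "\<dots> = measure lebesgue (\<Union>j\<in>J. cball (fst j) (snd j) - B)"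
    proof (rule measure_finite_Union[symmetric])
      show "disjoint_family_on (\<lambda>j. cball (fst j) (snd j) - B) J"
        using C(3) J(1) unfolding disjoint_family_on_def pairwise_def disjnt_def by blast
      show "emeasure lebesgue (cball (fst j) (snd j) - B) \<noteq> \<infinity>" if "j \<in> J" for j
        using fm[of j] by (auto simp: fmeasurable_def)
    qed (use J fm in auto)
    also have "\<dots> \<le> measure lebesgue (U - B)"
      using JK U(3) B by (intro measure_mono_fmeasurable) (auto simp: K_def intro!: sets.finite_UN J(2))
    also note mU
    finally show ?thesis using m by simp
  qed
  show "\<exists>T. ?E \<subseteq> T \<and> T \<in> lmeasurable \<and> measure lebesgue T \<le> e"
    by (rule lmeasurable_superset_of_almost_cover[OF C(4) fmeasurable_UN_bound[OF C(1) _ bound]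
        measure_UN_bound[OF C(1) _ bound]]) simp_all
qed

section \<open>Grid averages of functions of bounded variation\<close>

abbreviation (input) unit_sq :: "(real \<times> real) set" where
  "unit_sq \<equiv> {0<..<1} \<times> {0<..<1}"

lemma unit_sq_borel[measurable]: "unit_sq \<in> sets borel"
  by (simp add: borel_open open_Times)

section \<open>C1 bumps and ramps made from clamped polynomials\<close>

definition clamp01 :: "real \<Rightarrow> real" where
  "clamp01 t = max 0 (min 1 t)"

definition bump :: "real \<Rightarrow> real" where
  "bump t = (clamp01 t * (1 - clamp01 t))\<^sup>2"

definition bump' :: "real \<Rightarrow> real" where
  "bump' t = 2 * clamp01 t * (1 - clamp01 t) * (1 - 2 * clamp01 t)"

text \<open>The primitive of \<open>30 * bump\<close> that starts at 0; 30 is the reciprocal of the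
  integral of t^2 (1 - t)^2 over the unit interval, so the ramp rises to 1.\<close>

definition ramp :: "real \<Rightarrow> real" where
  "ramp t = 10 * clamp01 t ^ 3 - 15 * clamp01 t ^ 4 + 6 * clamp01 t ^ 5"

lemma clamp01_simps: "t \<le> 0 \<Longrightarrow> clamp01 t = 0" "1 \<le> t \<Longrightarrow> clamp01 t = 1"
    "0 \<le> t \<Longrightarrow> t \<le> 1 \<Longrightarrow> clamp01 t = t"
  and clamp01_bounds: "0 \<le> clamp01 t" "clamp01 t \<le> 1"
  by (auto simp: clamp01_def)

lemma clamp01_lipschitz: "\<bar>clamp01 y - clamp01 t\<bar> \<le> \<bar>y - t\<bar>"
  by (auto simp: clamp01_def)

lemma continuous_on_clamp01: "continuous_on S clamp01"
  unfolding clamp01_def by (intro continuous_intros)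

text \<open>Inside the interval the clamp is the identity. Elsewhere \<open>p'\<close> vanishes at
  the clamped point, and composing with a 1-Lipschitz map keeps the derivative zero; this includes
  the two endpoints, where the clamp itself is not differentiable.\<close>

lemma has_real_derivative_clamp01:
  assumes p: "\<And>t. (p has_real_derivative p' t) (at t)" and "p' 0 = 0" "p' 1 = 0"
  shows "((\<lambda>t. p (clamp01 t)) has_real_derivative p' (clamp01 t)) (at t)"
proof (cases "0 < t \<and> t < 1")
  case True
  then have "clamp01 t = t" by (simp add: clamp01_simps)
  moreover have "((\<lambda>t. p (clamp01 t)) has_real_derivative p' t) (at t)"
    by (rule has_field_derivative_transform_within_open[OF p[of t], of "{0<..<1}"])
      (use True in \<open>auto simp: clamp01_simps\<close>)
  ultimately show ?thesis by simp
next
  case False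
  then have "clamp01 t = 0 \<or> clamp01 t = 1" using clamp01_simps by (meson not_le)
  then have 0: "p' (clamp01 t) = 0" using assms by auto
  have "((\<lambda>t. p (clamp01 t)) has_derivative (\<lambda>h. 0)) (at t)"
    unfolding has_derivative_at_alt
  proof (intro conjI allI impI)
    fix e :: real assume "0 < e"
    have "(p has_derivative (\<lambda>h. 0)) (at (clamp01 t))"
      using p[of "clamp01 t"] 0 by (simp add: has_field_derivative_def lambda_zero)
    with \<open>0 < e\<close> obtain d where d: "0 < d" "\<And>y. norm (y - clamp01 t) < d \<Longrightarrow>
        norm (p y - p (clamp01 t) - 0) \<le> e * norm (y - clamp01 t)"
      unfolding has_derivative_at_alt by blast
    have "norm (p (clamp01 y) - p (clamp01 t) - 0) \<le> e * norm (y - t)" if "norm (y - t) < d" for y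
    proof -
      have "norm (clamp01 y - clamp01 t) \<le> norm (y - t)" using clamp01_lipschitz by simp
      with d(2)[of "clamp01 y"] that \<open>0 < e\<close> show ?thesis
        by (meson le_less_trans mult_left_mono order_less_imp_le order_trans)
    qed
    with d(1) show "\<exists>d>0. \<forall>y. norm (y - t) < d \<longrightarrow> norm (p (clamp01 y) - p (clamp01 t) - 0) \<le> e * norm (y - t)"
      by blast
  qed simp
  then show ?thesis using 0 by (simp add: has_field_derivative_def lambda_zero)
qed

lemma bump_deriv: "(bump has_real_derivative bump' t) (at t)"
proof -
  have "((\<lambda>t. (t * (1 - t))\<^sup>2) has_real_derivative 2 * t * (1 - t) * (1 - 2 * t)) (at t)" for t :: real
    by (auto intro!: derivative_eq_intros simp: algebra_simps)
  from has_real_derivative_clamp01[of "\<lambda>t. (t * (1 - t))\<^sup>2", OF this] show ?thesis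
    by (simp add: bump_def[abs_def] bump'_def)
qed

lemma ramp_deriv: "(ramp has_real_derivative 30 * bump t) (at t)"
proof -
  have "((\<lambda>t. 10 * t^3 - 15 * t^4 + 6 * t^5) has_real_derivative 30 * (t * (1 - t))\<^sup>2) (at t)" for t :: real
  proof -
    have "((\<lambda>t. 10 * t^3 - 15 * t^4 + 6 * t^5) has_real_derivative 30 * t^2 - 60 * t^3 + 30 * t^4) (at t)"
      by (auto intro!: derivative_eq_intros)
    also have "30 * t^2 - 60 * t^3 + 30 * t^4 = 30 * (t * (1 - t))\<^sup>2" by algebra
    finally show ?thesis .
  qed
  from has_real_derivative_clamp01[of "\<lambda>t. 10 * t^3 - 15 * t^4 + 6 * t^5", OF this] show ?thesis
    by (simp add: bump_def ramp_def[abs_def])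
qed

lemma continuous_on_bump: "continuous_on S bump" and continuous_on_bump': "continuous_on S bump'"
  and continuous_on_ramp: "continuous_on S ramp"
  unfolding bump_def[abs_def] bump'_def[abs_def] ramp_def[abs_def]
  by (intro continuous_intros continuous_on_clamp01)+

lemma bump_measurable[measurable]: "bump \<in> borel_measurable borel"
  by (rule borel_measurable_continuous_onI) (rule continuous_on_bump)

lemma bump_bounds: "0 \<le> bump t" "bump t \<le> 1"
proof -
  have "0 \<le> clamp01 t * (1 - clamp01 t)" "clamp01 t * (1 - clamp01 t) \<le> 1 * 1"
    by (rule mult_nonneg_nonneg mult_mono; use clamp01_bounds[of t] in simp)+
  then show "0 \<le> bump t" "bump t \<le> 1" by (auto simp: bump_def abs_square_le_1)
qed

lemma bump_eq_0: "t \<le> 0 \<or> 1 \<le> t \<Longrightarrow> bump t = 0"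
  by (auto simp: bump_def clamp01_simps)

lemma ramp_simps: "t \<le> 0 \<Longrightarrow> ramp t = 0" "1 \<le> t \<Longrightarrow> ramp t = 1"
  by (auto simp: ramp_def clamp01_simps)

lemma ramp_mono: "s \<le> t \<Longrightarrow> ramp s \<le> ramp t"
  using ramp_deriv bump_bounds by (intro DERIV_nonneg_imp_nondecreasing[of s t ramp]) (auto intro!: exI)

lemma ramp_bounds: "0 \<le> ramp t" "ramp t \<le> 1"
  using ramp_mono[of "min t 0" t] ramp_simps(1)[of "min t 0"] ramp_mono[of t "max t 1"] ramp_simps(2)[of "max t 1"]
  by auto

lemma sum_bump_le_1:
  assumes "finite J"
  shows "(\<Sum>j\<in>J. bump (y - real j)) \<le> 1"
proof -
  have "(\<Sum>j\<in>J. bump (y - real j)) \<le> (\<Sum>j\<in>J. if j = nat \<lfloor>y\<rfloor> then 1 else 0)"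
  proof (rule sum_mono)
    fix j assume "j \<in> J"
    show "bump (y - real j) \<le> (if j = nat \<lfloor>y\<rfloor> then 1 else 0)"
    proof (cases "0 < y - real j \<and> y - real j < 1")
      case True
      then have "\<lfloor>y\<rfloor> = int j" by (intro floor_unique) auto
      then show ?thesis using bump_bounds by simp
    next
      case False
      then have "bump (y - real j) = 0" by (intro bump_eq_0) linarith
      then show ?thesis by simp
    qed
  qed
  also have "\<dots> \<le> 1" using assms by (simp add: sum.delta)
  finally show ?thesis .
qed

lemma C1c_onI:
  assumes der: "\<And>x. (\<phi> has_derivative (\<lambda>h. d1 x * fst h + d2 x * snd h)) (at x)"
    and cont: "continuous_on UNIV d1" "continuous_on UNIV d2"
    and supp: "compact K" "K \<subseteq> \<Omega>" "\<And>x. \<phi> x \<noteq> 0 \<Longrightarrow> x \<in> K"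
  shows "C1c_on \<Omega> \<phi>"
  unfolding C1c_on_def
proof (intro conjI exI allI)
  define \<phi>' :: "real \<times> real \<Rightarrow> (real \<times> real) \<Rightarrow>\<^sub>L real"
    where "\<phi>' x = d1 x *\<^sub>R Blinfun fst + d2 x *\<^sub>R Blinfun snd" for x
  have ap: "blinfun_apply (\<phi>' x) = (\<lambda>h. d1 x * fst h + d2 x * snd h)" for x
    by (rule ext) (simp add: \<phi>'_def plus_blinfun.rep_eq scaleR_blinfun.rep_eq
        bounded_linear_Blinfun_apply bounded_linear_fst bounded_linear_snd)
  show "(\<phi> has_derivative blinfun_apply (\<phi>' x)) (at x)" for x
    unfolding ap by (rule der)
  show "continuous_on UNIV \<phi>'"
    unfolding \<phi>'_def by (intro continuous_intros cont)
  have sub: "closure {x. \<phi> x \<noteq> 0} \<subseteq> K"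
    using supp(1,3) by (intro closure_minimal) (auto intro: compact_imp_closed)
  then show "closure {x. \<phi> x \<noteq> 0} \<subseteq> \<Omega>" using supp(2) by blast
  show "compact (closure {x. \<phi> x \<noteq> 0})"
    using compact_Int_closed[OF supp(1) closed_closure[of "{x. \<phi> x \<noteq> 0}"]] sub by (simp add: Int_absorb1)
qed

text \<open>Bounds the mass on the square of the distributional derivative of \<open>f\<close> in
  the first coordinate. The integral may run over the plane because the test functions are supported
  in the square.\<close>

definition h_variation_le :: "(real \<times> real \<Rightarrow> real) \<Rightarrow> real \<Rightarrow> bool" where
  "h_variation_le f M \<longleftrightarrow> (\<forall>\<phi>. C1c_on unit_sq \<phi> \<and> (\<forall>x. \<bar>\<phi> x\<bar> \<le> 1) \<longrightarrow>
     \<bar>LBINT x. f x * frechet_derivative \<phi> (at x) (1, 0)\<bar> \<le> M)"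

text \<open>A C1 weight replaces the indicator of the cell, so that differences of neighbouring
  values can be paired with derivatives of admissible test functions. The weight is not normalised:
  for positive \<open>N\<close> its integral is \<open>1 / (900 * N^2)\<close>.\<close>

definition cell_avg :: "nat \<Rightarrow> (real \<times> real \<Rightarrow> real) \<Rightarrow> nat \<Rightarrow> nat \<Rightarrow> real" where
  "cell_avg N f i j = (LBINT x. f x * (bump (N * fst x - i) * bump (N * snd x - j)))"

lemma measurable_bump_prod:
  "(\<lambda>x::real \<times> real. bump (a * fst x - b) * bump (c * snd x - d)) \<in> borel_measurable borel"
  by (intro borel_measurable_continuous_onI continuous_intros continuous_on_compose2[OF continuous_on_bump[of UNIV]]) auto

lemma integrable_mult_bump:
  assumes "integrable lborel f"
  shows "integrable lborel (\<lambda>x. f x * (bump (a * fst x - b) * bump (c * snd x - d)))"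
proof (rule Bochner_Integration.integrable_bound[OF assms])
  show "(\<lambda>x. f x * (bump (a * fst x - b) * bump (c * snd x - d))) \<in> borel_measurable lborel"
    using borel_measurable_integrable[OF assms] measurable_bump_prod[of a b c d] by simp
  have "\<bar>bump s * bump t\<bar> \<le> 1" for s t
    using mult_mono[of "bump s" 1 "bump t" 1] bump_bounds by simp
  then show "AE x in lborel. norm (f x * (bump (a * fst x - b) * bump (c * snd x - d))) \<le> norm (f x)"
    by (auto simp: abs_mult intro!: mult_left_le)
qed

text \<open>The test function is a combination, with the signs of the differences, of products of a tent
  in \<open>x\<^sub>1\<close> and a bump in \<open>x\<^sub>2\<close>; the tents add up to at most 1, so its sup norm is at most 1.\<close>

lemma sum_cell_avg_differences_le:
  assumes f: "integrable lborel f" and M: "h_variation_le f M"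
  shows "30 * N * (\<Sum>j\<in>{1..N-2}. \<Sum>i\<in>{1..N-3}. \<bar>cell_avg N f (Suc i) j - cell_avg N f i j\<bar>) \<le> M"
proof (cases "N = 0")
  case True
  have "\<bar>LBINT x. f x * frechet_derivative (\<lambda>x. 0) (at x) (1, 0)\<bar> \<le> M"
    using M unfolding h_variation_le_def
    by (rule allE[of _ "\<lambda>x. 0"], elim mp) (auto intro!: C1c_onI[of _ "\<lambda>x. 0" "\<lambda>x. 0" "{}"])
  then have "0 \<le> M" by (meson abs_ge_zero order_trans)
  then show ?thesis using True by simp
next
  case False
  then have N: "real N > 0" by simp
  \<comment> \<open>Oriented like \<open>tent'\<close>, in which the bump of cell \<open>i\<close>
    carries the plus sign.\<close>
  define \<epsilon> where "\<epsilon> i j = sgn (cell_avg N f i j - cell_avg N f (Suc i) j)" for i j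
  define tent where "tent i s = ramp (N * s - real i) - ramp (N * s - real (Suc i))" for i :: nat and s :: real
  define tent' where "tent' i s = 30 * N * (bump (N * s - real i) - bump (N * s - real (Suc i)))" for i :: nat and s :: real
  \<comment> \<open>\<open>tent i\<close> lives on \<open>i < N * s < i + 2\<close> and the bump in
    the other variable on \<open>j < N * t < j + 1\<close>; these ranges keep the support at
    distance at least \<open>1 / N\<close> from the boundary. For small \<open>N\<close> they are
    empty.\<close>
  define I J where "I = {1..N-3}" and "J = {1..N-2}"
  define \<phi> where "\<phi> x = (\<Sum>j\<in>J. \<Sum>i\<in>I. \<epsilon> i j * (tent i (fst x) * bump (N * snd x - j)))" for x :: "real \<times> real"
  define d1 where "d1 x = (\<Sum>j\<in>J. \<Sum>i\<in>I. \<epsilon> i j * (tent' i (fst x) * bump (N * snd x - j)))" for x :: "real \<times> real"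
  define d2 where "d2 x = (\<Sum>j\<in>J. \<Sum>i\<in>I. \<epsilon> i j * (tent i (fst x) * (N * bump' (N * snd x - j))))" for x :: "real \<times> real"
  have tent_d: "(tent i has_real_derivative tent' i s) (at s)" for i s
    unfolding tent_def[abs_def] tent'_def
    by (auto intro!: derivative_eq_intros DERIV_chain2[OF ramp_deriv] simp: algebra_simps)
  have bump_d: "((\<lambda>t. bump (N * t - real j)) has_real_derivative N * bump' (N * t - real j)) (at t)" for t :: real and j
  proof -
    have "((\<lambda>t. N * t - real j) has_real_derivative N) (at t)" by (auto intro!: derivative_eq_intros)
    from DERIV_chain2[OF bump_deriv this] show ?thesis by (simp add: mult.commute)
  qed
  have der: "(\<phi> has_derivative (\<lambda>h. d1 x * fst h + d2 x * snd h)) (at x)" for x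
  proof -
    have "((\<lambda>y. tent i (fst y)) has_derivative (\<lambda>h. fst h * tent' i (fst x))) (at x)" for i
      by (rule DERIV_compose_FDERIV[OF tent_d]) (intro derivative_intros)
    moreover have "((\<lambda>y. bump (N * snd y - real j)) has_derivative (\<lambda>h. snd h * (N * bump' (N * snd x - j)))) (at x)" for j
      by (rule DERIV_compose_FDERIV[OF bump_d]) (intro derivative_intros)
    ultimately have "((\<lambda>y. \<Sum>j\<in>J. \<Sum>i\<in>I. \<epsilon> i j * (tent i (fst y) * bump (N * snd y - real j))) has_derivative
      (\<lambda>h. \<Sum>j\<in>J. \<Sum>i\<in>I. \<epsilon> i j * (tent i (fst x) * (snd h * (N * bump' (N * snd x - j))) +
         fst h * tent' i (fst x) * bump (N * snd x - j)))) (at x)"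
      by (intro has_derivative_sum has_derivative_mult_right has_derivative_mult)
    moreover have "(\<lambda>h. \<Sum>j\<in>J. \<Sum>i\<in>I. \<epsilon> i j * (tent i (fst x) * (snd h * (N * bump' (N * snd x - j))) +
         fst h * tent' i (fst x) * bump (N * snd x - j))) = (\<lambda>h. d1 x * fst h + d2 x * snd h)"
      unfolding d1_def d2_def sum_distrib_right sum.distrib[symmetric]
      by (intro ext sum.cong refl) (simp add: algebra_simps)
    ultimately show ?thesis by (simp add: \<phi>_def[abs_def])
  qed
  have tent_supp: "real i < N * s \<and> N * s < real i + 2" if "tent i s \<noteq> 0" for i :: nat and s :: real
  proof (rule ccontr)
    assume "\<not> ?thesis"
    then have "N * s \<le> real i \<or> real i + 2 \<le> N * s" by linarith
    then have "tent i s = 0" unfolding tent_def by (auto simp: ramp_simps)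
    then show False using that by simp
  qed
  have tent_nonneg: "0 \<le> tent i s" for i s
    unfolding tent_def using ramp_mono[of "N * s - real (Suc i)" "N * s - real i"] by simp
  have sum_tent: "(\<Sum>i\<in>I. tent i s) \<le> 1" for s
  proof -
    have "(\<Sum>i\<in>{1..n}. tent i s) = ramp (N * s - 1) - ramp (N * s - real (Suc n))" for n
      by (induction n) (auto simp: tent_def)
    from this[of "N - 3"] show ?thesis
      unfolding I_def using ramp_bounds(2)[of "N * s - 1"] ramp_bounds(1)[of "N * s - real (Suc (N - 3))"]
      by linarith
  qed
  have \<phi>_le: "\<bar>\<phi> x\<bar> \<le> 1" for x
  proof -
    have "\<bar>\<phi> x\<bar> \<le> (\<Sum>j\<in>J. \<Sum>i\<in>I. \<bar>\<epsilon> i j * (tent i (fst x) * bump (N * snd x - j))\<bar>)"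
      unfolding \<phi>_def by (rule order_trans[OF sum_abs]) (intro sum_mono sum_abs)
    also have "\<dots> \<le> (\<Sum>j\<in>J. \<Sum>i\<in>I. tent i (fst x) * bump (N * snd x - j))"
    proof (intro sum_mono)
      fix i j
      have "\<bar>\<epsilon> i j\<bar> \<le> 1" by (auto simp: \<epsilon>_def sgn_if)
      moreover have "0 \<le> tent i (fst x) * bump (N * snd x - j)"
        by (intro mult_nonneg_nonneg tent_nonneg bump_bounds)
      ultimately show "\<bar>\<epsilon> i j * (tent i (fst x) * bump (N * snd x - j))\<bar> \<le> tent i (fst x) * bump (N * snd x - j)"
        unfolding abs_mult[of "\<epsilon> i j"] by (simp add: mult_left_le_one_le)
    qed
    also have "\<dots> = (\<Sum>i\<in>I. tent i (fst x)) * (\<Sum>j\<in>J. bump (N * snd x - j))"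
      by (simp add: sum_product sum.swap[of _ I])
    also have "\<dots> \<le> 1 * 1"
      by (intro mult_mono sum_tent sum_bump_le_1 sum_nonneg bump_bounds) (auto simp: J_def)
    finally show ?thesis by simp
  qed
  have supp: "x \<in> {1/N..(real N - 1)/N} \<times> {1/N..(real N - 1)/N}" if "\<phi> x \<noteq> 0" for x
  proof -
    from that obtain j where j: "j \<in> J" "(\<Sum>i\<in>I. \<epsilon> i j * (tent i (fst x) * bump (N * snd x - j))) \<noteq> 0"
      unfolding \<phi>_def by (rule sum.not_neutral_contains_not_neutral)
    from j(2) obtain i where i: "i \<in> I" "\<epsilon> i j * (tent i (fst x) * bump (N * snd x - j)) \<noteq> 0"
      by (rule sum.not_neutral_contains_not_neutral)
    then have "tent i (fst x) \<noteq> 0" "bump (N * snd x - j) \<noteq> 0" by auto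
    then have a: "real i < N * fst x" "N * fst x < real i + 2" "real j < N * snd x" "N * snd x < real j + 1"
      using tent_supp[of i "fst x"] bump_eq_0[of "N * snd x - j"] by force+
    have "1 \<le> i" "i + 3 \<le> N" "1 \<le> j" "j + 2 \<le> N" using i(1) j(1) by (auto simp: I_def J_def)
    then have b: "1 \<le> real i" "real i + 3 \<le> real N" "1 \<le> real j" "real j + 2 \<le> real N" by linarith+
    have "1 \<le> N * fst x" "N * fst x \<le> real N - 1" "1 \<le> N * snd x" "N * snd x \<le> real N - 1"
      using a b by linarith+
    then show ?thesis using N by (auto simp: mem_Times_iff field_simps)
  qed
  have C1: "C1c_on unit_sq \<phi>"
  proof (rule C1c_onI[OF der])
    show "continuous_on UNIV d1" "continuous_on UNIV d2"
      unfolding d1_def d2_def tent_def tent'_def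
      by (intro continuous_intros continuous_on_compose2[OF continuous_on_bump[of UNIV]]
          continuous_on_compose2[OF continuous_on_bump'[of UNIV]] continuous_on_compose2[OF continuous_on_ramp[of UNIV]]; simp)+
    show "compact ({1/N..(real N - 1)/N} \<times> {1/N..(real N - 1)/N} :: (real \<times> real) set)"
      by (intro compact_Times compact_Icc)
    show "{1/N..(real N - 1)/N} \<times> {1/N..(real N - 1)/N} \<subseteq> unit_sq"
    proof -
      have "0 < 1 / real N" "(real N - 1) / real N < 1" using N by (auto simp: field_simps)
      then have "{1/N..(real N - 1)/N} \<subseteq> {0<..<1::real}"
        by (intro subsetI) (unfold greaterThanLessThan_iff atLeastAtMost_iff, linarith)
      then show ?thesis by (intro Sigma_mono)
    qed
  qed (use supp in blast)
  have fd: "frechet_derivative \<phi> (at x) (1, 0) = d1 x" for x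
    using frechet_derivative_at[OF der[of x]] by (metis fst_conv snd_conv mult_1_right mult_zero_right add_0_right)
  have "\<bar>LBINT x. f x * d1 x\<bar> \<le> M"
    using M C1 \<phi>_le unfolding h_variation_le_def fd[symmetric] by blast
  moreover have "(LBINT x. f x * d1 x) = (\<Sum>j\<in>J. \<Sum>i\<in>I. \<epsilon> i j * (30 * N) * (cell_avg N f i j - cell_avg N f (Suc i) j))"
  proof -
    have "(\<lambda>x. f x * d1 x) = (\<lambda>x::real \<times> real. \<Sum>j\<in>J. \<Sum>i\<in>I. \<epsilon> i j * (30 * N) *
       (f x * (bump (N * fst x - real i) * bump (N * snd x - j)) - f x * (bump (N * fst x - real (Suc i)) * bump (N * snd x - j))))"
      by (rule ext) (simp add: d1_def tent'_def sum_distrib_left algebra_simps)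
    then show ?thesis
      unfolding cell_avg_def using integrable_mult_bump[OF f]
      by (simp del: of_nat_Suc)
  qed
  moreover have "\<dots> = (\<Sum>j\<in>J. \<Sum>i\<in>I. 30 * N * \<bar>cell_avg N f (Suc i) j - cell_avg N f i j\<bar>)"
    by (intro sum.cong refl) (auto simp: \<epsilon>_def sgn_if abs_if)
  moreover have "\<dots> = 30 * N * (\<Sum>j\<in>J. \<Sum>i\<in>I. \<bar>cell_avg N f (Suc i) j - cell_avg N f i j\<bar>)"
    unfolding sum_distrib_left ..
  ultimately show ?thesis
    unfolding I_def[symmetric] J_def[symmetric] by linarith
qed

lemma nn_integral_bump:
  fixes N i :: real
  assumes "N > 0"
  shows "(\<integral>\<^sup>+t. ennreal (bump (N * t - i)) \<partial>lborel) = ennreal (1 / (30 * N))"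
proof -
  have "(\<integral>\<^sup>+t. ennreal (bump (N * t - i)) \<partial>lborel)
      = (\<integral>\<^sup>+t. ennreal (bump (N * t - i)) * indicator {i / N..(i + 1) / N} t \<partial>lborel)"
  proof (rule nn_integral_cong)
    fix t
    have "bump (N * t - i) = 0" if "t \<notin> {i / N..(i + 1) / N}"
      using that assms by (intro bump_eq_0) (auto simp: field_simps)
    then show "ennreal (bump (N * t - i)) = ennreal (bump (N * t - i)) * indicator {i / N..(i + 1) / N} t"
      by (cases "t \<in> {i / N..(i + 1) / N}") auto
  qed
  also have "\<dots> = ennreal (ramp (N * ((i + 1) / N) - i) / (30 * N) - ramp (N * (i / N) - i) / (30 * N))"
  proof (rule nn_integral_FTC_Icc)
    show "(\<lambda>t. bump (N * t - i)) \<in> borel_measurable borel" by measurable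
    fix t
    have "((\<lambda>t. N * t - i) has_real_derivative N) (at t)" by (auto intro!: derivative_eq_intros)
    from DERIV_cdivide[OF DERIV_chain2[OF ramp_deriv this], of "30 * N"]
    show "((\<lambda>t. ramp (N * t - i) / (30 * N)) has_real_derivative bump (N * t - i)) (at t)"
      using assms by simp
    show "0 \<le> bump (N * t - i)" by (rule bump_bounds)
    show "i / N \<le> (i + 1) / N" using assms by (simp add: divide_right_mono)
  qed
  also have "\<dots> = ennreal (1 / (30 * N))" using assms by (simp add: ramp_simps)
  finally show ?thesis .
qed

lemma has_bochner_integral_bump_prod:
  fixes N i j :: real
  assumes "N > 0"
  shows "has_bochner_integral lborel (\<lambda>x. bump (N * fst x - i) * bump (N * snd x - j)) (1 / (900 * N\<^sup>2))"
proof (rule has_bochner_integral_nn_integral)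
  show "(\<lambda>x. bump (N * fst x - i) * bump (N * snd x - j)) \<in> borel_measurable lborel"
    using measurable_bump_prod by simp
  have "(\<integral>\<^sup>+x. ennreal (bump (N * fst x - i) * bump (N * snd x - j)) \<partial>lborel)
      = (\<integral>\<^sup>+x. ennreal (bump (N * fst x - i) * bump (N * snd x - j)) \<partial>(lborel \<Otimes>\<^sub>M lborel))"
    by (simp only: lborel_prod)
  also have "\<dots> = (\<integral>\<^sup>+s. \<integral>\<^sup>+t. ennreal (bump (N * s - i) * bump (N * t - j)) \<partial>lborel \<partial>lborel)"
    by (subst lborel.nn_integral_fst[symmetric]) (auto simp: lborel_prod intro!: measurable_compose[OF measurable_bump_prod measurable_ennreal])
  also have "\<dots> = (\<integral>\<^sup>+s. ennreal (bump (N * s - i)) * ennreal (1 / (30 * N)) \<partial>lborel)"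
    by (simp add: ennreal_mult' bump_bounds nn_integral_cmult nn_integral_bump assms)
  also have "\<dots> = ennreal (1 / (30 * N)) * ennreal (1 / (30 * N))"
    by (simp add: nn_integral_multc nn_integral_bump assms)
  also have "\<dots> = ennreal (1 / (900 * N\<^sup>2))"
    using assms by (subst ennreal_mult[symmetric]) (auto simp: power2_eq_square)
  finally show "(\<integral>\<^sup>+x. ennreal (bump (N * fst x - i) * bump (N * snd x - j)) \<partial>lborel) = ennreal (1 / (900 * N\<^sup>2))" .
qed (auto simp: bump_bounds)

section \<open>Step approximations by grid averages and their convergence\<close>

definition grid_cell :: "nat \<Rightarrow> nat \<Rightarrow> nat \<Rightarrow> (real \<times> real) set" where
  "grid_cell N i j = {real i / N..<(real i + 1) / N} \<times> {real j / N..<(real j + 1) / N}"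

text \<open>The factor turns the weights of \<open>cell_avg\<close> into probability densities. The
  cells are half-open, so the value at a point depends on a single cell.\<close>

definition grid_approx :: "nat \<Rightarrow> (real \<times> real \<Rightarrow> real) \<Rightarrow> real \<times> real \<Rightarrow> real" where
  "grid_approx N f x = (\<Sum>i<N. \<Sum>j<N. 900 * (real N)\<^sup>2 * cell_avg N f i j * indicator (grid_cell N i j) x)"

lemma mem_grid_cell:
  assumes "N > 0"
  shows "(s, t) \<in> grid_cell N i j \<longleftrightarrow> real i \<le> N * s \<and> N * s < real i + 1 \<and> real j \<le> N * t \<and> N * t < real j + 1"
  using assms by (auto simp: grid_cell_def field_simps)

lemma grid_cell_unique:
  assumes "x \<in> grid_cell N i j" "x \<in> grid_cell N k l" "N > 0"
  shows "k = i" "l = j"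
  using assms mem_grid_cell[OF assms(3), of "fst x" "snd x"] by (auto; linarith)+

lemma grid_approx_eq:
  assumes "x \<in> grid_cell N i j" "i < N" "j < N"
  shows "grid_approx N f x = 900 * (real N)\<^sup>2 * cell_avg N f i j"
proof -
  have "grid_approx N f x = (\<Sum>k<N. \<Sum>l<N. if k = i \<and> l = j then 900 * (real N)\<^sup>2 * cell_avg N f i j else 0)"
    unfolding grid_approx_def
  proof (intro sum.cong refl)
    fix k l
    show "900 * (real N)\<^sup>2 * cell_avg N f k l * indicator (grid_cell N k l) x =
      (if k = i \<and> l = j then 900 * (real N)\<^sup>2 * cell_avg N f i j else 0)"
      using assms grid_cell_unique[OF assms(1), of k l] by (cases "x \<in> grid_cell N k l") auto
  qed
  also have "\<dots> = (\<Sum>k<N. if k = i then 900 * (real N)\<^sup>2 * cell_avg N f i j else 0)"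
    using assms(3) by (intro sum.cong refl) (auto simp: sum.delta)
  also have "\<dots> = 900 * (real N)\<^sup>2 * cell_avg N f i j" using assms(2) by (simp add: sum.delta)
  finally show ?thesis .
qed

lemma grid_cell_measurable[measurable]: "grid_cell N i j \<in> sets borel"
  unfolding grid_cell_def by (intro borel_Times) auto

lemma grid_approx_measurable[measurable]: "grid_approx N f \<in> borel_measurable borel"
  unfolding grid_approx_def[abs_def] by measurable

lemma emeasure_grid_cell: "N > 0 \<Longrightarrow> emeasure lborel (grid_cell N i j) = ennreal (1 / (real N)\<^sup>2)"
proof -
  assume N: "N > 0"
  have len: "emeasure lborel {real i / N..<(real i + 1) / N} = ennreal (1 / N)" for i
    using N by (subst emeasure_lborel_Ico) (auto simp: field_simps divide_right_mono)
  have "emeasure lborel (grid_cell N i j) = emeasure (lborel \<Otimes>\<^sub>M lborel) (grid_cell N i j)"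
    by (simp only: lborel_prod)
  also have "\<dots> = emeasure lborel {real i / N..<(real i + 1) / N} * emeasure lborel {real j / N..<(real j + 1) / N}"
    unfolding grid_cell_def by (intro lborel.emeasure_pair_measure_Times) auto
  also have "\<dots> = ennreal (1 / (real N)\<^sup>2)"
    unfolding len using N by (subst ennreal_mult[symmetric]) (auto simp: power2_eq_square)
  finally show ?thesis .
qed

lemma integrable_indicator_grid_cell: "integrable lborel (indicator (grid_cell N i j) :: real \<times> real \<Rightarrow> real)"
proof (cases "N = 0")
  case False
  then show ?thesis by (intro integrable_real_indicator) (auto simp: emeasure_grid_cell)
qed (simp add: grid_cell_def)

lemma integrable_grid_approx: "integrable lborel (grid_approx N f)"
  unfolding grid_approx_def[abs_def]
  by (intro Bochner_Integration.integrable_sum integrable_mult_right integrable_indicator_grid_cell)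

text \<open>What matters is independence of \<open>N\<close>, for the density argument. The cell
  area cancels \<open>N^2\<close> and the bumps sum to at most one, which leaves the normalising
  factor 900.\<close>

lemma grid_approx_L1_bound:
  assumes f: "integrable lborel f"
  shows "(LBINT x. \<bar>grid_approx N f x\<bar>) \<le> 900 * (LBINT x. \<bar>f x\<bar>)"
proof (cases "N = 0")
  case False
  then have N: "N > 0" by simp
  have meas: "measure lborel (grid_cell N i j) = 1 / (real N)\<^sup>2" for i j
    using emeasure_grid_cell[OF N, of i j] by (simp add: measure_def)
  have fa: "integrable lborel (\<lambda>x. \<bar>f x\<bar>)" using f by simp
  have "(LBINT x. \<bar>grid_approx N f x\<bar>)
      \<le> (LBINT x. (\<Sum>i<N. \<Sum>j<N. 900 * (real N)\<^sup>2 * \<bar>cell_avg N f i j\<bar> * indicator (grid_cell N i j) x))"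
  proof (rule integral_mono)
    show "integrable lborel (\<lambda>x. \<bar>grid_approx N f x\<bar>)" using integrable_grid_approx by simp
    show "integrable lborel (\<lambda>x. \<Sum>i<N. \<Sum>j<N. 900 * (real N)\<^sup>2 * \<bar>cell_avg N f i j\<bar> * indicator (grid_cell N i j) x)"
      by (intro Bochner_Integration.integrable_sum integrable_mult_right integrable_indicator_grid_cell)
    show "\<bar>grid_approx N f x\<bar> \<le> (\<Sum>i<N. \<Sum>j<N. 900 * (real N)\<^sup>2 * \<bar>cell_avg N f i j\<bar> * indicator (grid_cell N i j) x)" for x
      unfolding grid_approx_def
      by (rule order_trans[OF sum_abs], intro sum_mono, rule order_trans[OF sum_abs], intro sum_mono)
        (simp add: abs_mult)
  qed
  also have "\<dots> = (\<Sum>i<N. \<Sum>j<N. 900 * \<bar>cell_avg N f i j\<bar>)"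
    using integrable_indicator_grid_cell N
    by (simp add: meas Bochner_Integration.integral_sum Bochner_Integration.integrable_sum del: sum_mult_indicator)
  also have "\<dots> \<le> (\<Sum>i<N. \<Sum>j<N. 900 * (LBINT x. \<bar>f x\<bar> * (bump (N * fst x - i) * bump (N * snd x - j))))"
  proof (intro sum_mono mult_left_mono)
    fix i j
    have "\<bar>cell_avg N f i j\<bar> \<le> (LBINT x. \<bar>f x * (bump (N * fst x - i) * bump (N * snd x - j))\<bar>)"
      unfolding cell_avg_def by (rule integral_abs_bound)
    then show "\<bar>cell_avg N f i j\<bar> \<le> (LBINT x. \<bar>f x\<bar> * (bump (N * fst x - i) * bump (N * snd x - j)))"
      by (simp add: abs_mult bump_bounds)
  qed simp
  also have "\<dots> = 900 * (LBINT x. (\<Sum>i<N. \<Sum>j<N. \<bar>f x\<bar> * (bump (N * fst x - i) * bump (N * snd x - j))))"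
    using integrable_mult_bump[OF fa] by (simp add: sum_distrib_left)
  also have "\<dots> \<le> 900 * (LBINT x. \<bar>f x\<bar>)"
  proof (intro mult_left_mono integral_mono)
    fix x :: "real \<times> real"
    have "(\<Sum>i<N. \<Sum>j<N. \<bar>f x\<bar> * (bump (N * fst x - i) * bump (N * snd x - j)))
      = \<bar>f x\<bar> * ((\<Sum>i<N. bump (N * fst x - i)) * (\<Sum>j<N. bump (N * snd x - j)))"
      by (subst sum_product) (simp only: sum_distrib_left)
    also have "\<dots> \<le> \<bar>f x\<bar> * (1 * 1)"
      by (intro mult_left_mono mult_mono sum_bump_le_1 sum_nonneg bump_bounds) auto
    finally show "(\<Sum>i<N. \<Sum>j<N. \<bar>f x\<bar> * (bump (N * fst x - i) * bump (N * snd x - j))) \<le> \<bar>f x\<bar>" by simp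
  qed (use integrable_mult_bump[OF fa] fa in auto)
  finally show ?thesis .
qed (simp add: grid_approx_def)

lemma grid_approx_diff:
  assumes "integrable lborel f" "integrable lborel g"
  shows "grid_approx N (\<lambda>x. f x - g x) x = grid_approx N f x - grid_approx N g x"
proof -
  have "cell_avg N (\<lambda>x. f x - g x) i j = cell_avg N f i j - cell_avg N g i j" for i j
    unfolding cell_avg_def using integrable_mult_bump[OF assms(1)] integrable_mult_bump[OF assms(2)]
    by (simp add: left_diff_distrib)
  then show ?thesis
    by (simp add: grid_approx_def left_diff_distrib right_diff_distrib sum_subtractf)
qed

lemma unit_sq_grid_cell:
  assumes "x \<in> unit_sq" "N > 0"
  obtains i j where "x \<in> grid_cell N i j" "i < N" "j < N"
proof -
  have *: "\<exists>i<N. real i \<le> N * s \<and> N * s < real i + 1" if "0 < s" "s < 1" for s :: real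
  proof -
    have "0 \<le> N * s" using that assms(2) by simp
    moreover have "N * s < N" using that assms(2) by simp
    ultimately show ?thesis
      by (intro exI[of _ "nat \<lfloor>N * s\<rfloor>"]) (auto simp: nat_less_iff floor_less_iff)
  qed
  obtain s t where st: "x = (s, t)" by (cases x)
  then have "0 < s" "s < 1" "0 < t" "t < 1" using assms(1) by auto
  with *[of s] *[of t] st show ?thesis using that mem_grid_cell[OF assms(2), of s t] by metis
qed

lemma cell_avg_const:
  assumes "N > 0"
  shows "(LBINT x. c * (bump (N * fst x - real i) * bump (N * snd x - real j))) = c / (900 * (real N)\<^sup>2)"
  using has_bochner_integral_bump_prod[of "real N" "real i" "real j"] assms
  by (simp add: has_bochner_integral_iff)

text \<open>The weight is nonnegative and vanishes off the closed cell, so closeness of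
  \<open>u\<close> to \<open>c\<close> there survives normalised averaging.\<close>

lemma cell_avg_near:
  assumes u: "integrable lborel u" and N: "N > 0"
    and near: "\<And>s t. real i \<le> N * s \<Longrightarrow> N * s \<le> real i + 1 \<Longrightarrow> real j \<le> N * t \<Longrightarrow> N * t \<le> real j + 1 \<Longrightarrow> \<bar>u (s, t) - c\<bar> \<le> e"
  shows "\<bar>900 * (real N)\<^sup>2 * cell_avg N u i j - c\<bar> \<le> e"
proof -
  let ?b = "\<lambda>x::real \<times> real. bump (N * fst x - real i) * bump (N * snd x - real j)"
  have bi: "integrable lborel ?b"
    using has_bochner_integral_bump_prod[of "real N" "real i" "real j"] N by (simp add: has_bochner_integral_iff)
  have ui: "integrable lborel (\<lambda>x. u x * ?b x)" by (rule integrable_mult_bump[OF u])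
  have "\<bar>cell_avg N u i j - c / (900 * (real N)\<^sup>2)\<bar> = \<bar>LBINT x. u x * ?b x - c * ?b x\<bar>"
    unfolding cell_avg_const[OF N, of c i j, symmetric] cell_avg_def using ui bi by simp
  also have "\<dots> \<le> (LBINT x. \<bar>u x * ?b x - c * ?b x\<bar>)" by (rule integral_abs_bound)
  also have "\<dots> \<le> (LBINT x. e * ?b x)"
  proof (rule integral_mono)
    show "integrable lborel (\<lambda>x. \<bar>u x * ?b x - c * ?b x\<bar>)" using ui bi by simp
    show "integrable lborel (\<lambda>x. e * ?b x)" using bi by simp
    fix x :: "real \<times> real"
    obtain s t where x: "x = (s, t)" by (cases x)
    show "\<bar>u x * ?b x - c * ?b x\<bar> \<le> e * ?b x"
    proof (cases "?b x = 0")
      case False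
      then have "bump (N * s - real i) \<noteq> 0" "bump (N * t - real j) \<noteq> 0" by (auto simp: x)
      then have "real i \<le> N * s" "N * s \<le> real i + 1" "real j \<le> N * t" "N * t \<le> real j + 1"
        using bump_eq_0[of "N * s - real i"] bump_eq_0[of "N * t - real j"] by linarith+
      then have "\<bar>u x - c\<bar> \<le> e" unfolding x by (rule near)
      moreover have "0 \<le> ?b x" by (intro mult_nonneg_nonneg bump_bounds)
      moreover have "\<bar>u x * ?b x - c * ?b x\<bar> = \<bar>u x - c\<bar> * \<bar>?b x\<bar>"
        by (simp only: left_diff_distrib[symmetric] abs_mult)
      ultimately show ?thesis by (simp add: mult_right_mono)
    next
      case True
      show ?thesis unfolding True by simp
    qed
  qed
  also have "\<dots> = e / (900 * (real N)\<^sup>2)" by (rule cell_avg_const[OF N])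
  finally have "900 * (real N)\<^sup>2 * \<bar>cell_avg N u i j - c / (900 * (real N)\<^sup>2)\<bar> \<le> 900 * (real N)\<^sup>2 * (e / (900 * (real N)\<^sup>2))"
    by (intro mult_left_mono) auto
  moreover have "900 * (real N)\<^sup>2 * (e / (900 * (real N)\<^sup>2)) = e" using N by simp
  moreover have "900 * (real N)\<^sup>2 * \<bar>cell_avg N u i j - c / (900 * (real N)\<^sup>2)\<bar> = \<bar>900 * (real N)\<^sup>2 * (cell_avg N u i j - c / (900 * (real N)\<^sup>2))\<bar>"
    by (simp add: abs_mult)
  moreover have "900 * (real N)\<^sup>2 * (cell_avg N u i j - c / (900 * (real N)\<^sup>2)) = 900 * (real N)\<^sup>2 * cell_avg N u i j - c"
    using N by (simp add: right_diff_distrib)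
  ultimately show ?thesis by simp
qed

lemma grid_approx_tendsto:
  assumes u: "integrable lborel u" and x: "x \<in> unit_sq" and cont: "isCont u x"
  shows "(\<lambda>N. grid_approx N u x) \<longlonglongrightarrow> u x"
proof (rule LIMSEQ_I)
  fix e :: real assume "0 < e"
  then have "0 < e / 2" by simp
  then obtain d where d: "0 < d" "\<And>y. dist y x < d \<Longrightarrow> dist (u y) (u x) < e / 2"
    using cont unfolding continuous_at_eps_delta by blast
  obtain N0 :: nat where N0: "2 / d < real N0" using reals_Archimedean2 by blast
  have "norm (grid_approx N u x - u x) < e" if "N \<ge> Suc N0" for N
  proof -
    have N: "N > 0" "2 / d < real N" using that N0 by auto
    then have Nd: "2 / N < d" using d(1) by (simp add: field_simps)
    obtain i j where ij: "x \<in> grid_cell N i j" "i < N" "j < N" using unit_sq_grid_cell[OF x N(1)] .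
    obtain x1 x2 where xx: "x = (x1, x2)" by (cases x)
    have xc: "real i \<le> N * x1" "N * x1 < real i + 1" "real j \<le> N * x2" "N * x2 < real j + 1"
      using ij(1) mem_grid_cell[OF N(1)] xx by auto
    have "\<bar>900 * (real N)\<^sup>2 * cell_avg N u i j - u x\<bar> \<le> e / 2"
    proof (rule cell_avg_near[OF u N(1)])
      fix s t :: real assume st: "real i \<le> N * s" "N * s \<le> real i + 1" "real j \<le> N * t" "N * t \<le> real j + 1"
      have "N * \<bar>s - x1\<bar> \<le> 1" "N * \<bar>t - x2\<bar> \<le> 1"
        using st xc by (auto simp: abs_if algebra_simps)
      then have "\<bar>s - x1\<bar> \<le> 1 / N" "\<bar>t - x2\<bar> \<le> 1 / N" using N(1) by (auto simp: field_simps)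
      moreover have "dist (s, t) x \<le> \<bar>s - x1\<bar> + \<bar>t - x2\<bar>"
        unfolding xx dist_Pair_Pair dist_real_def using sqrt_sum_squares_le_sum_abs[of "\<bar>s - x1\<bar>" "\<bar>t - x2\<bar>"] by simp
      ultimately have "dist (s, t) x < d" using Nd by linarith
      then show "\<bar>u (s, t) - u x\<bar> \<le> e / 2" using d(2)[of "(s, t)"] by (simp add: dist_real_def)
    qed
    then show ?thesis using grid_approx_eq[OF ij] \<open>0 < e\<close> by simp
  qed
  then show "\<exists>no. \<forall>n\<ge>no. norm (grid_approx n u x - u x) < e" by blast
qed

lemma grid_approx_bounded:
  assumes u: "integrable lborel u" and b: "\<And>x. \<bar>u x\<bar> \<le> b"
  shows "\<bar>grid_approx N u x\<bar> \<le> b"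
proof (cases "\<exists>i<N. \<exists>j<N. x \<in> grid_cell N i j")
  case True
  then obtain i j where ij: "x \<in> grid_cell N i j" "i < N" "j < N" by blast
  then have "N > 0" by simp
  from cell_avg_near[OF u this, of i j 0 b] b show ?thesis by (simp add: grid_approx_eq[OF ij])
next
  case False
  then have "grid_approx N u x = 0"
    unfolding grid_approx_def by (intro sum.neutral ballI) auto
  then show ?thesis using b[of x] by simp
qed

lemma integrable_indicator_unit_sq: "integrable lborel (indicator unit_sq :: real \<times> real \<Rightarrow> real)"
proof (rule integrable_real_indicator)
  show "unit_sq \<in> sets lborel" by (simp add: borel_open open_Times)
  show "emeasure lborel unit_sq < \<infinity>"
    by (rule emeasure_bounded_finite) (simp add: bounded_Times)
qed

lemma integrable_bounded_on_unit_sq: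
  fixes h :: "real \<times> real \<Rightarrow> real"
  assumes "h \<in> borel_measurable borel" "\<And>x. \<bar>h x\<bar> \<le> b"
  shows "integrable lborel (\<lambda>x. indicator unit_sq x * h x)"
proof (rule Bochner_Integration.integrable_bound)
  show "integrable lborel (\<lambda>x. b * indicator unit_sq x :: real)"
    by (intro integrable_mult_right integrable_indicator_unit_sq)
  show "(\<lambda>x. indicator unit_sq x * h x) \<in> borel_measurable lborel" using assms(1) by measurable
  show "AE x in lborel. norm (indicator unit_sq x * h x) \<le> norm (b * indicator unit_sq x :: real)"
  proof (rule AE_I2)
    fix x
    have "0 \<le> b" using assms(2)[of x] by linarith
    then show "norm (indicator unit_sq x * h x) \<le> norm (b * indicator unit_sq x :: real)"
      using assms(2)[of x] by (auto simp: indicator_def)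
  qed
qed

lemma grid_approx_L1_tendsto_continuous:
  fixes h :: "real \<times> real \<Rightarrow> real"
  assumes h: "continuous_on UNIV h" and b: "\<And>x. \<bar>h x\<bar> \<le> b"
  defines "u \<equiv> \<lambda>x. indicator unit_sq x * h x"
  shows "(\<lambda>N. LBINT x. \<bar>indicator unit_sq x * (grid_approx N u x - u x)\<bar>) \<longlonglongrightarrow> 0"
proof -
  have hm[measurable]: "h \<in> borel_measurable borel" using h by (rule borel_measurable_continuous_onI)
  have u: "integrable lborel u" unfolding u_def using hm b by (rule integrable_bounded_on_unit_sq)
  have b0: "0 \<le> b" using b[of 0] by linarith
  have ub: "\<bar>u x\<bar> \<le> b" for x unfolding u_def using b[of x] b0 by (auto simp: indicator_def)
  have cont: "isCont u x" if "x \<in> unit_sq" for x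
  proof -
    have "continuous_on unit_sq u"
      using continuous_on_subset[OF h, of unit_sq] by (rule continuous_on_eq) (auto simp: u_def)
    moreover have "open unit_sq" by (simp add: open_Times)
    ultimately show ?thesis using that continuous_on_eq_continuous_at by blast
  qed
  have "(\<lambda>N. LBINT x. \<bar>indicator unit_sq x * (grid_approx N u x - u x)\<bar>) \<longlonglongrightarrow> (\<integral>x. 0 \<partial>(lborel :: (real \<times> real) measure))"
  proof (rule integral_dominated_convergence)
    show "integrable lborel (\<lambda>x. (2 * b) * indicator unit_sq x :: real)"
      by (intro integrable_mult_right integrable_indicator_unit_sq)
    show "(\<lambda>x. \<bar>indicator unit_sq x * (grid_approx N u x - u x)\<bar>) \<in> borel_measurable lborel" for N
      using u by measurable
    show "AE x in lborel. (\<lambda>N. \<bar>indicator unit_sq x * (grid_approx N u x - u x)\<bar>) \<longlonglongrightarrow> 0"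
    proof (rule AE_I2)
      fix x
      show "(\<lambda>N. \<bar>indicator unit_sq x * (grid_approx N u x - u x)\<bar>) \<longlonglongrightarrow> 0"
      proof (cases "x \<in> unit_sq")
        case True
        have "(\<lambda>N. \<bar>indicator unit_sq x * (grid_approx N u x - u x)\<bar>) \<longlonglongrightarrow> \<bar>indicator unit_sq x * (u x - u x)\<bar>"
          by (intro tendsto_intros grid_approx_tendsto[OF u True cont[OF True]])
        then show ?thesis by simp
      qed simp
    qed
    show "AE x in lborel. norm \<bar>indicator unit_sq x * (grid_approx N u x - u x)\<bar> \<le> (2 * b) * indicator unit_sq x" for N
    proof (rule AE_I2)
      fix x
      show "norm \<bar>indicator unit_sq x * (grid_approx N u x - u x)\<bar> \<le> (2 * b) * indicator unit_sq x"
        using grid_approx_bounded[OF u ub, of N x] ub[of x] by (cases "x \<in> unit_sq") auto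
    qed
  qed simp
  then show ?thesis by simp
qed

text \<open>Two truncations at height \<open>k\<close>: the first replaces \<open>f\<close> by a
  bounded function; the second bounds the continuous approximants, for which
  \<open>measurable_on\<close> gives only pointwise convergence off a negligible set, so that
  dominated convergence applies.\<close>

lemma L1_approx_continuous:
  assumes f: "integrable lborel f" and f0: "\<And>x. x \<notin> unit_sq \<Longrightarrow> f x = 0" and e: "0 < e"
  obtains h :: "real \<times> real \<Rightarrow> real" and b where "continuous_on UNIV h" "\<And>x. \<bar>h x\<bar> \<le> b"
    "(LBINT x. \<bar>f x - indicator unit_sq x * h x\<bar>) < e"
proof -
  have fm[measurable]: "f \<in> borel_measurable borel" using borel_measurable_integrable[OF f] by simp
  define T where "T k y = max (- real k) (min (real k) y)" for k :: nat and y :: real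
  have Tb: "\<bar>T k y\<bar> \<le> real k" for k y by (auto simp: T_def)
  have Tc: "continuous_on S (T k)" for S k unfolding T_def[abs_def] by (intro continuous_intros)
  have [measurable]: "T k \<in> borel_measurable borel" for k by (rule borel_measurable_continuous_onI[OF Tc])
  have "(\<lambda>k. LBINT x. \<bar>f x - T k (f x)\<bar>) \<longlonglongrightarrow> (\<integral>x. 0 \<partial>(lborel :: (real \<times> real) measure))"
  proof (rule integral_dominated_convergence)
    show "integrable lborel (\<lambda>x. \<bar>f x\<bar>)" using f by simp
    show "AE x in lborel. (\<lambda>k. \<bar>f x - T k (f x)\<bar>) \<longlonglongrightarrow> 0"
    proof (rule AE_I2, rule tendsto_eventually)
      fix x
      obtain k0 where "\<bar>f x\<bar> \<le> real k0" using real_arch_simple by blast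
      then have "\<bar>f x - T k (f x)\<bar> = 0" if "k0 \<le> k" for k using that by (auto simp: T_def)
      then show "\<forall>\<^sub>F k in sequentially. \<bar>f x - T k (f x)\<bar> = 0" unfolding eventually_sequentially by blast
    qed
    show "AE x in lborel. norm \<bar>f x - T k (f x)\<bar> \<le> \<bar>f x\<bar>" for k
      by (rule AE_I2) (auto simp: T_def)
  qed measurable
  then have "(\<lambda>k. LBINT x. \<bar>f x - T k (f x)\<bar>) \<longlonglongrightarrow> 0" by simp
  then have "\<forall>\<^sub>F k in sequentially. (LBINT x. \<bar>f x - T k (f x)\<bar>) < e / 2"
    by (rule order_tendstoD) (use e in simp)
  then obtain k where k: "(LBINT x. \<bar>f x - T k (f x)\<bar>) < e / 2"
    unfolding eventually_sequentially by blast
  have "(\<lambda>x. T k (f x)) \<in> borel_measurable lebesgue"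
    by (rule measurable_completion) measurable
  then have "(\<lambda>x. T k (f x)) measurable_on UNIV"
    by (rule lebesgue_measurable_imp_measurable_on_real) simp
  then obtain Z h where Z: "negligible Z" and hc: "\<And>n. continuous_on UNIV (h n)"
    and hl: "\<And>x. x \<notin> Z \<Longrightarrow> (\<lambda>n. h n x) \<longlonglongrightarrow> T k (f x)"
    unfolding measurable_on_def by auto
  define H where "H n x = T k (h n x)" for n x
  have Hc: "continuous_on UNIV (H n)" for n
    unfolding H_def[abs_def] by (rule continuous_on_compose2[OF Tc[of UNIV] hc]) simp
  then have [measurable]: "H n \<in> borel_measurable borel" for n by (rule borel_measurable_continuous_onI)
  have Tf0: "indicator unit_sq x * T k (f x) = T k (f x)" for x
    using f0[of x] by (cases "x \<in> unit_sq") (auto simp: T_def)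
  have AEZ: "AE x in lborel. x \<notin> Z"
  proof -
    have "AE x in lebesgue. x \<notin> Z" using Z by (intro AE_not_in) (simp add: negligible_iff_null_sets)
    then show ?thesis by (simp add: AE_completion_iff)
  qed
  have "(\<lambda>n. LBINT x. \<bar>T k (f x) - indicator unit_sq x * H n x\<bar>) \<longlonglongrightarrow> (\<integral>x. 0 \<partial>(lborel :: (real \<times> real) measure))"
  proof (rule integral_dominated_convergence)
    show "integrable lborel (\<lambda>x. (2 * real k) * indicator unit_sq x :: real)"
      by (intro integrable_mult_right integrable_indicator_unit_sq)
    show "AE x in lborel. (\<lambda>n. \<bar>T k (f x) - indicator unit_sq x * H n x\<bar>) \<longlonglongrightarrow> 0"
      using AEZ
    proof eventually_elim
      case (elim x)
      have "isCont (T k) (T k (f x))" using Tc[of UNIV k] by (simp add: continuous_on_eq_continuous_at)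
      then have "(\<lambda>n. H n x) \<longlonglongrightarrow> T k (T k (f x))"
        unfolding H_def by (rule isCont_tendsto_compose[OF _ hl[OF elim]])
      moreover have "T k (T k (f x)) = T k (f x)" by (auto simp: T_def)
      ultimately have "(\<lambda>n. H n x) \<longlonglongrightarrow> T k (f x)" by simp
      then have "(\<lambda>n. \<bar>T k (f x) - indicator unit_sq x * H n x\<bar>) \<longlonglongrightarrow> \<bar>T k (f x) - indicator unit_sq x * T k (f x)\<bar>"
        by (intro tendsto_intros)
      then show ?case by (simp only: Tf0 diff_self abs_zero)
    qed
    show "AE x in lborel. norm \<bar>T k (f x) - indicator unit_sq x * H n x\<bar> \<le> (2 * real k) * indicator unit_sq x" for n
    proof (rule AE_I2)
      fix x
      show "norm \<bar>T k (f x) - indicator unit_sq x * H n x\<bar> \<le> (2 * real k) * indicator unit_sq x"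
      proof (cases "x \<in> unit_sq")
        case True
        have "\<bar>T k (f x) - T k (h n x)\<bar> \<le> 2 * real k" using Tb[of k "f x"] Tb[of k "h n x"] by linarith
        then show ?thesis using True by (simp add: H_def del: mem_Sigma_iff)
      next
        case False
        then show ?thesis using f0[OF False] by (simp add: T_def del: mem_Sigma_iff)
      qed
    qed
  qed measurable
  then have "(\<lambda>n. LBINT x. \<bar>T k (f x) - indicator unit_sq x * H n x\<bar>) \<longlonglongrightarrow> 0" by simp
  then have "\<forall>\<^sub>F n in sequentially. (LBINT x. \<bar>T k (f x) - indicator unit_sq x * H n x\<bar>) < e / 2"
    by (rule order_tendstoD) (use e in simp)
  then obtain n where n: "(LBINT x. \<bar>T k (f x) - indicator unit_sq x * H n x\<bar>) < e / 2"
    unfolding eventually_sequentially by blast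
  have Hb: "\<bar>H n x\<bar> \<le> real k" for x unfolding H_def by (rule Tb)
  have i1: "integrable lborel (\<lambda>x. T k (f x))"
    using integrable_bounded_on_unit_sq[of "\<lambda>x. T k (f x)" "real k"] Tb by (simp only: Tf0) measurable
  have i2: "integrable lborel (\<lambda>x. indicator unit_sq x * H n x)"
    by (rule integrable_bounded_on_unit_sq[OF _ Hb]) measurable
  have "(LBINT x. \<bar>f x - indicator unit_sq x * H n x\<bar>)
      \<le> (LBINT x. \<bar>f x - T k (f x)\<bar> + \<bar>T k (f x) - indicator unit_sq x * H n x\<bar>)"
    using f i1 i2 by (intro integral_mono) auto
  also have "\<dots> = (LBINT x. \<bar>f x - T k (f x)\<bar>) + (LBINT x. \<bar>T k (f x) - indicator unit_sq x * H n x\<bar>)"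
    using f i1 i2 by (intro Bochner_Integration.integral_add) auto
  also have "\<dots> < e" using k n by linarith
  finally show ?thesis using that[OF Hc Hb] by blast
qed

text \<open>The approximations converge in mean, first for continuous functions and then in general
  by the uniform mean bound; almost everywhere convergence is extracted along a subsequence.\<close>

lemma grid_approx_AE_subseq:
  assumes f: "integrable lborel f" and f0: "\<And>x. x \<notin> unit_sq \<Longrightarrow> f x = 0"
  shows "\<exists>r::nat \<Rightarrow> nat. strict_mono r \<and> (AE x in lborel. x \<in> unit_sq \<longrightarrow> (\<lambda>k. grid_approx (r k) f x) \<longlonglongrightarrow> f x)"
proof -
  define U where "U N x = indicator unit_sq x * (grid_approx N f x - f x)" for N x
  have restr: "integrable lborel (\<lambda>x. indicator unit_sq x * v x)" if "integrable lborel v" for v :: "real \<times> real \<Rightarrow> real"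
    using integrable_mult_indicator[OF _ that, of unit_sq] by simp
  have Ui: "integrable lborel (U N)" for N
    unfolding U_def[abs_def] by (intro restr Bochner_Integration.integrable_diff integrable_grid_approx f)
  have "(\<lambda>N. LBINT x. norm (U N x)) \<longlonglongrightarrow> 0"
  proof (rule LIMSEQ_I)
    fix e :: real assume e: "0 < e"
    \<comment> \<open>The error of the continuous approximant enters with factor 900 through
      \<open>grid_approx_L1_bound\<close> and once directly; with the grid error itself this spends
      902 parts of 1000.\<close>
    then have "0 < e / 1000" by simp
    then obtain h b where h: "continuous_on UNIV h" "\<And>x. \<bar>h x\<bar> \<le> b"
      "(LBINT x. \<bar>f x - indicator unit_sq x * h x\<bar>) < e / 1000"
      using L1_approx_continuous[OF f f0] by blast
    define u where "u x = indicator unit_sq x * h x" for x :: "real \<times> real"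
    have ui: "integrable lborel u"
      unfolding u_def[abs_def] using borel_measurable_continuous_onI[OF h(1)] h(2) by (rule integrable_bounded_on_unit_sq)
    have "(\<lambda>N. LBINT x. \<bar>indicator unit_sq x * (grid_approx N u x - u x)\<bar>) \<longlonglongrightarrow> 0"
      using grid_approx_L1_tendsto_continuous[OF h(1,2)] unfolding u_def[abs_def] .
    then have "\<forall>\<^sub>F N in sequentially. (LBINT x. \<bar>indicator unit_sq x * (grid_approx N u x - u x)\<bar>) < e / 1000"
      by (rule order_tendstoD) (use e in simp)
    then obtain N0 where N0: "\<And>N. N \<ge> N0 \<Longrightarrow> (LBINT x. \<bar>indicator unit_sq x * (grid_approx N u x - u x)\<bar>) < e / 1000"
      unfolding eventually_sequentially by blast
    have "norm ((LBINT x. norm (U N x)) - 0) < e" if "N \<ge> N0" for N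
    proof -
      have fu: "integrable lborel (\<lambda>x. f x - u x)" using f ui by simp
      have Iu: "integrable lborel (\<lambda>x. \<bar>indicator unit_sq x * (grid_approx N u x - u x)\<bar>)"
        by (intro integrable_abs restr Bochner_Integration.integrable_diff integrable_grid_approx ui)
      have Ig: "integrable lborel (\<lambda>x. \<bar>grid_approx N (\<lambda>x. f x - u x) x\<bar>)"
        by (intro integrable_abs integrable_grid_approx)
      have If: "integrable lborel (\<lambda>x. \<bar>f x - u x\<bar>)" using fu by simp
      have "(LBINT x. norm (U N x)) \<le> (LBINT x. \<bar>grid_approx N (\<lambda>x. f x - u x) x\<bar> +
          \<bar>indicator unit_sq x * (grid_approx N u x - u x)\<bar> + \<bar>f x - u x\<bar>)"
      proof (rule integral_mono)
        show "integrable lborel (\<lambda>x. norm (U N x))" using Ui by simp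
        show "integrable lborel (\<lambda>x. \<bar>grid_approx N (\<lambda>x. f x - u x) x\<bar> +
          \<bar>indicator unit_sq x * (grid_approx N u x - u x)\<bar> + \<bar>f x - u x\<bar>)"
          by (intro Bochner_Integration.integrable_add Iu Ig If)
        show "norm (U N x) \<le> \<bar>grid_approx N (\<lambda>x. f x - u x) x\<bar> +
          \<bar>indicator unit_sq x * (grid_approx N u x - u x)\<bar> + \<bar>f x - u x\<bar>" for x
          unfolding U_def grid_approx_diff[OF f ui] by (cases "x \<in> unit_sq") auto
      qed
      also have "\<dots> = (LBINT x. \<bar>grid_approx N (\<lambda>x. f x - u x) x\<bar>) +
          (LBINT x. \<bar>indicator unit_sq x * (grid_approx N u x - u x)\<bar>) + (LBINT x. \<bar>f x - u x\<bar>)"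
        by (simp only: Bochner_Integration.integral_add Bochner_Integration.integrable_add Iu Ig If)
      also have "\<dots> \<le> 900 * (LBINT x. \<bar>f x - u x\<bar>) + e / 1000 + (LBINT x. \<bar>f x - u x\<bar>)"
        using grid_approx_L1_bound[OF fu, of N] N0[OF that] by linarith
      also have "\<dots> < e" using h(3) e unfolding u_def by linarith
      finally show ?thesis by simp
    qed
    then show "\<exists>no. \<forall>n\<ge>no. norm ((LBINT x. norm (U n x)) - 0) < e" by blast
  qed
  from tendsto_L1_AE_subseq[OF Ui this] obtain r where r: "strict_mono r" "AE x in lborel. (\<lambda>n. U (r n) x) \<longlonglongrightarrow> 0"
    by blast
  from r(2) have "AE x in lborel. x \<in> unit_sq \<longrightarrow> (\<lambda>k. grid_approx (r k) f x) \<longlonglongrightarrow> f x"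
  proof eventually_elim
    case (elim x)
    show ?case
    proof
      assume "x \<in> unit_sq"
      then have "(\<lambda>n. grid_approx (r n) f x - f x) \<longlonglongrightarrow> 0" using elim by (simp add: U_def)
      then show "(\<lambda>k. grid_approx (r k) f x) \<longlonglongrightarrow> f x" by (rule LIM_zero_cancel)
    qed
  qed
  with r(1) show ?thesis by blast
qed

section \<open>Null sets, exchange of coordinates and slices\<close>

lemma AE_lborel_iff_negligible: "(AE x in lborel. P x) \<longleftrightarrow> negligible {x. \<not> P x}"
proof
  assume "AE x in lborel. P x"
  then have "AE x in lebesgue. P x" by (simp add: AE_completion_iff)
  then obtain N where "N \<in> null_sets lebesgue" "{x \<in> space lebesgue. \<not> P x} \<subseteq> N"
    unfolding eventually_ae_filter by blast
  then show "negligible {x. \<not> P x}"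
    using negligible_subset[of N] by (simp add: negligible_iff_null_sets)
next
  assume "negligible {x. \<not> P x}"
  then have "AE x in lebesgue. x \<notin> {x. \<not> P x}" by (intro AE_not_in) (simp add: negligible_iff_null_sets)
  then show "AE x in lborel. P x" by (simp add: AE_completion_iff)
qed

lemma lborel_swap:
  shows distr_lborel_swap: "distr lborel lborel (\<lambda>(x, y). (y, x)) = (lborel :: (real \<times> real) measure)"
    and measurable_lborel_swap: "(\<lambda>(x, y). (y, x)) \<in> (lborel :: (real \<times> real) measure) \<rightarrow>\<^sub>M (lborel :: (real \<times> real) measure)"
  using lborel_pair.distr_pair_swap[where ?'a = real and ?'b = real]
    measurable_pair_swap'[of "lborel :: real measure" "lborel :: real measure"]
  unfolding lborel_prod by simp_all

lemma AE_lborel_swap: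
  assumes "AE x in (lborel :: (real \<times> real) measure). P x"
  shows "AE x in (lborel :: (real \<times> real) measure). P (snd x, fst x)"
proof -
  from AE_distrD[OF measurable_lborel_swap, of P] assms show ?thesis
    unfolding distr_lborel_swap by (simp add: case_prod_unfold)
qed

lemma AE_lborel_slices:
  assumes "AE x in (lborel :: (real \<times> real) measure). P x"
  shows "AE s in lborel. AE t in lborel. P (s, t)" and "AE t in lborel. AE s in lborel. P (s, t)"
proof -
  show "AE s in lborel. AE t in lborel. P (s, t)"
    by (rule lborel_pair.AE_pair[of P, unfolded lborel_prod, OF assms])
  show "AE t in lborel. AE s in lborel. P (s, t)"
    using lborel_pair.AE_pair[of "\<lambda>x. P (snd x, fst x)", unfolded lborel_prod, OF AE_lborel_swap[OF assms]] by simp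
qed

lemma chain_var_tendsto:
  assumes "\<And>x. x \<in> set xs \<Longrightarrow> (\<lambda>k. F k x) \<longlonglongrightarrow> f x"
  shows "(\<lambda>k::nat. chain_var (F k) xs) \<longlonglongrightarrow> chain_var f xs"
  using assms
proof (induction xs rule: induct_list012)
  case (3 x y zs)
  then have "(\<lambda>k. \<bar>F k y - F k x\<bar> + chain_var (F k) (y # zs)) \<longlonglongrightarrow> \<bar>f y - f x\<bar> + chain_var f (y # zs)"
    by (intro tendsto_intros) auto
  then show ?case by simp
qed auto

lemma abs_diff_le_sum_increments:
  fixes a :: "nat \<Rightarrow> real"
  assumes "k \<le> m"
  shows "\<bar>a m - a k\<bar> \<le> (\<Sum>i=k..<m. \<bar>a (Suc i) - a i\<bar>)"
  using assms by (induction m rule: dec_induct) auto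

lemma chain_var_le_sum_increments:
  fixes a :: "nat \<Rightarrow> real" and n :: "real \<Rightarrow> nat"
  assumes "sorted xs" "\<And>x y. x \<le> y \<Longrightarrow> n x \<le> n y" "\<And>x. x \<in> set xs \<Longrightarrow> k \<le> n x \<and> n x \<le> m"
  shows "chain_var (\<lambda>x. a (n x)) xs \<le> (\<Sum>i=k..<m. \<bar>a (Suc i) - a i\<bar>)"
  using assms(1,3)
proof (induction xs arbitrary: k rule: induct_list012)
  case (3 x y zs)
  have xy: "n x \<le> n y" "k \<le> n x" "n y \<le> m" using 3(3,4) assms(2) by auto
  have "chain_var (\<lambda>x. a (n x)) (y # zs) \<le> (\<Sum>i=n y..<m. \<bar>a (Suc i) - a i\<bar>)"
  proof (rule 3(2))
    show "sorted (y # zs)" using 3(3) by simp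
    show "n y \<le> n z \<and> n z \<le> m" if "z \<in> set (y # zs)" for z
      using that 3(3,4) assms(2)[of y z] by auto
  qed
  moreover have "\<bar>a (n y) - a (n x)\<bar> \<le> (\<Sum>i=n x..<n y. \<bar>a (Suc i) - a i\<bar>)"
    by (rule abs_diff_le_sum_increments[OF xy(1)])
  moreover have "(\<Sum>i=n x..<n y. \<bar>a (Suc i) - a i\<bar>) \<le> (\<Sum>i=k..<n y. \<bar>a (Suc i) - a i\<bar>)"
    using xy by (intro sum_mono2) auto
  moreover have "(\<Sum>i=k..<n y. \<bar>a (Suc i) - a i\<bar>) + (\<Sum>i=n y..<m. \<bar>a (Suc i) - a i\<bar>) = (\<Sum>i=k..<m. \<bar>a (Suc i) - a i\<bar>)"
    using xy by (intro sum.atLeastLessThan_concat) auto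
  ultimately show ?case by simp
qed (auto intro: sum_nonneg)

section \<open>Variation of the grid approximations along rows\<close>

definition row_var :: "nat \<Rightarrow> (real \<times> real \<Rightarrow> real) \<Rightarrow> nat \<Rightarrow> real" where
  "row_var N f j = (\<Sum>i\<in>{1..N-3}. 900 * (real N)\<^sup>2 * \<bar>cell_avg N f (Suc i) j - cell_avg N f i j\<bar>)"

text \<open>Dominates the variation of \<open>grid_approx N f\<close> along the row
  \<open>c\<close>. Cells at the border of the square are left out, since the test functions do not
  reach them.\<close>

definition grid_var :: "nat \<Rightarrow> (real \<times> real \<Rightarrow> real) \<Rightarrow> real \<Rightarrow> ennreal" where
  "grid_var N f c = (\<Sum>j\<in>{1..N-2}. ennreal (row_var N f j) * indicator {real j / N..<(real j + 1) / N} c)"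

lemma grid_var_measurable[measurable]: "grid_var N f \<in> borel_measurable borel"
  unfolding grid_var_def[abs_def] by measurable

lemma row_var_nonneg: "0 \<le> row_var N f j"
  unfolding row_var_def by (intro sum_nonneg) auto

text \<open>Rows of cells have height \<open>1 / N\<close>, so one factor \<open>N\<close> of
  \<open>900 * N^2\<close> disappears, and the rest is 30 times the sum bounded in
  \<open>sum_cell_avg_differences_le\<close>.\<close>

lemma nn_integral_grid_var_le:
  assumes f: "integrable lborel f" and M: "h_variation_le f M"
  shows "(\<integral>\<^sup>+c. grid_var N f c \<partial>lborel) \<le> ennreal (30 * M)"
proof (cases "N = 0")
  case True
  then have "(\<integral>\<^sup>+c. grid_var N f c \<partial>lborel) = 0" by (simp add: grid_var_def)
  then show ?thesis by simp
next
  case False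
  then have N: "real N > 0" by simp
  have "(\<integral>\<^sup>+c. grid_var N f c \<partial>lborel) = (\<Sum>j\<in>{1..N-2}. ennreal (row_var N f j) * emeasure lborel {real j / N..<(real j + 1) / N})"
    unfolding grid_var_def by (subst nn_integral_sum) (auto simp: nn_integral_cmult_indicator)
  also have "\<dots> = (\<Sum>j\<in>{1..N-2}. ennreal (row_var N f j / N))"
  proof (rule sum.cong)
    fix j
    have "emeasure lborel {real j / N..<(real j + 1) / N} = ennreal (1 / N)"
      using N by (subst emeasure_lborel_Ico) (auto simp: field_simps divide_right_mono)
    then show "ennreal (row_var N f j) * emeasure lborel {real j / N..<(real j + 1) / N} = ennreal (row_var N f j / N)"
      using row_var_nonneg[of N f j] by (simp add: ennreal_mult[symmetric])
  qed simp
  also have "\<dots> = ennreal (\<Sum>j\<in>{1..N-2}. row_var N f j / N)"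
    using row_var_nonneg by (intro sum_ennreal) (auto intro: divide_nonneg_nonneg)
  also have "\<dots> \<le> ennreal (30 * M)"
  proof (rule ennreal_leI)
    have "(\<Sum>j\<in>{1..N-2}. row_var N f j / N) =
      30 * (30 * N * (\<Sum>j\<in>{1..N-2}. \<Sum>i\<in>{1..N-3}. \<bar>cell_avg N f (Suc i) j - cell_avg N f i j\<bar>))"
      unfolding row_var_def sum_distrib_left sum_divide_distrib
      using N by (intro sum.cong refl) (simp add: power2_eq_square)
    also have "\<dots> \<le> 30 * M" using sum_cell_avg_differences_le[OF f M, of N] by (intro mult_left_mono) auto
    finally show "(\<Sum>j\<in>{1..N-2}. row_var N f j / N) \<le> 30 * M" .
  qed
  finally show ?thesis .
qed

text \<open>The index of the cell grows with \<open>s\<close>, so a chain of points reads off a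
  monotone selection from one row of averages, bounded by the sum of all neighbouring differences.
  The bounds on \<open>N * s\<close> and \<open>N * c\<close> avoid the border cells.\<close>

lemma chain_var_grid_approx_le:
  fixes N :: nat and c :: real
  assumes xs: "sorted xs" "\<And>s::real. s \<in> set xs \<Longrightarrow> 1 \<le> N * s \<and> N * s < real N - 1"
    and c: "1 \<le> N * c" "N * c < real N - 1"
  shows "ennreal (chain_var (\<lambda>s. grid_approx N f (s, c)) xs) \<le> grid_var N f c"
proof -
  have N: "N > 0" using c by (cases N) auto
  define j where "j = nat \<lfloor>N * c\<rfloor>"
  define n where "n s = nat \<lfloor>N * s\<rfloor>" for s :: real
  have n: "real (n s) \<le> N * s" "N * s < real (n s) + 1" "1 \<le> n s" "n s \<le> N - 2"
    if "1 \<le> N * s" "N * s < real N - 1" for s :: real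
  proof -
    show a: "real (n s) \<le> N * s" "N * s < real (n s) + 1" using that by (auto simp: n_def)
    then have "0 < real (n s)" "real (n s) + 1 < real N" using that by linarith+
    then show "1 \<le> n s" "n s \<le> N - 2" by linarith+
  qed
  have jn: "j = n c" by (simp add: j_def n_def)
  have j: "real j \<le> N * c" "N * c < real j + 1" "1 \<le> j" "j \<le> N - 2" unfolding jn using n[OF c] by auto
  have eq: "grid_approx N f (s, c) = 900 * (real N)\<^sup>2 * cell_avg N f (n s) j" if s: "s \<in> set xs" for s
  proof (rule grid_approx_eq)
    have ns: "1 \<le> N * s" "N * s < real N - 1" using xs(2)[OF s] by auto
    show "(s, c) \<in> grid_cell N (n s) j" using n[OF ns] j by (simp add: mem_grid_cell[OF N])
    show "n s < N" "j < N" using n[OF ns] j N by linarith+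
  qed
  have "chain_var (\<lambda>s. grid_approx N f (s, c)) xs = chain_var (\<lambda>s. 900 * (real N)\<^sup>2 * cell_avg N f (n s) j) xs"
    by (rule chain_var_cong) (rule eq)
  also have "\<dots> \<le> (\<Sum>i=1..<N-2. \<bar>900 * (real N)\<^sup>2 * cell_avg N f (Suc i) j - 900 * (real N)\<^sup>2 * cell_avg N f i j\<bar>)"
  proof (rule chain_var_le_sum_increments[OF xs(1), of n 1 "N - 2" "\<lambda>i. 900 * (real N)\<^sup>2 * cell_avg N f i j"])
    show "n x \<le> n y" if "x \<le> y" for x y
      unfolding n_def using that by (intro nat_mono floor_mono mult_left_mono) auto
    show "1 \<le> n x \<and> n x \<le> N - 2" if "x \<in> set xs" for x using n[of x] xs(2)[OF that] by blast
  qed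
  also have "\<dots> = row_var N f j"
    unfolding row_var_def
  proof (rule sum.cong)
    show "{1..<N - 2} = {1..N - 3}" by auto
    show "\<bar>900 * (real N)\<^sup>2 * cell_avg N f (Suc i) j - 900 * (real N)\<^sup>2 * cell_avg N f i j\<bar> =
      900 * (real N)\<^sup>2 * \<bar>cell_avg N f (Suc i) j - cell_avg N f i j\<bar>" for i
      by (simp only: right_diff_distrib[symmetric] abs_mult) simp
  qed
  finally have "ennreal (chain_var (\<lambda>s. grid_approx N f (s, c)) xs) \<le> ennreal (row_var N f j)" by (rule ennreal_leI)
  also have "\<dots> = ennreal (row_var N f j) * indicator {real j / N..<(real j + 1) / N} c"
    using j N by (simp add: field_simps)
  also have "\<dots> \<le> grid_var N f c"
    unfolding grid_var_def using j by (intro member_le_sum) auto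
  finally show ?thesis .
qed

text \<open>By Fatou's lemma the lower limit of \<open>grid_var\<close> is finite on almost every
  row. There \<open>S\<close> collects the points of convergence: the variation along a finite chain
  in \<open>S\<close> is the limit of the variations of the approximations, hence bounded
  independently of the chain.\<close>

lemma h_variation_le_imp_AE_slice_bv:
  assumes f: "integrable lborel f" and f0: "\<And>x. x \<notin> unit_sq \<Longrightarrow> f x = 0" and M: "h_variation_le f M"
  shows "AE c in lborel. c \<in> {0<..<1} \<longrightarrow>
    (\<exists>S. S \<subseteq> {0<..<1} \<and> negligible ({0<..<1} - S) \<and> bv_on_set S (\<lambda>s. f (s, c)))"
proof -
  obtain r :: "nat \<Rightarrow> nat" where r: "strict_mono r"
    "AE x in lborel. x \<in> unit_sq \<longrightarrow> (\<lambda>k. grid_approx (r k) f x) \<longlonglongrightarrow> f x"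
    using grid_approx_AE_subseq[OF f f0] by blast
  have "(\<integral>\<^sup>+c. liminf (\<lambda>k. grid_var (r k) f c) \<partial>lborel) \<le> liminf (\<lambda>k. \<integral>\<^sup>+c. grid_var (r k) f c \<partial>lborel)"
    by (rule nn_integral_liminf) measurable
  also have "\<dots> \<le> liminf (\<lambda>k::nat. ennreal (30 * M))"
    by (intro Liminf_mono always_eventually allI nn_integral_grid_var_le[OF f M])
  also have "\<dots> = ennreal (30 * M)" by (simp add: Liminf_const)
  finally have "(\<integral>\<^sup>+c. liminf (\<lambda>k. grid_var (r k) f c) \<partial>lborel) \<noteq> \<infinity>" by (auto simp: top_unique)
  then have "AE c in lborel. liminf (\<lambda>k. grid_var (r k) f c) \<noteq> \<infinity>"
    by (intro nn_integral_noteq_infinite) measurable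
  then show ?thesis using AE_lborel_slices(2)[OF r(2)]
  proof eventually_elim
    case (elim c)
    show ?case
    proof
      assume c: "c \<in> {0<..<1}"
      define S where "S = {s \<in> {0<..<1}. (\<lambda>k. grid_approx (r k) f (s, c)) \<longlonglongrightarrow> f (s, c)}"
      have "{0<..<1} - S \<subseteq> {s. \<not> ((s, c) \<in> unit_sq \<longrightarrow> (\<lambda>k. grid_approx (r k) f (s, c)) \<longlonglongrightarrow> f (s, c))}"
        using c by (auto simp: S_def)
      then have "negligible ({0<..<1} - S)"
        using elim(2) unfolding AE_lborel_iff_negligible by (rule negligible_subset[rotated])
      moreover have "bv_on_set S (\<lambda>s. f (s, c))"
      proof -
        obtain L where L: "liminf (\<lambda>k. grid_var (r k) f c) = ennreal L" "0 \<le> L"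
          using elim(1) by (cases "liminf (\<lambda>k. grid_var (r k) f c)") auto
        have "\<not> ennreal (L + 1) \<le> liminf (\<lambda>k. grid_var (r k) f c)" using L by (simp add: not_le ennreal_less_iff)
        \<comment> \<open>A finite lower limit yields the bound only for infinitely many
          \<open>k\<close>. This suffices, because the facts about a fixed chain hold for all large
          \<open>k\<close>.\<close>
        then have freq: "\<exists>\<^sub>F k in sequentially. grid_var (r k) f c \<le> ennreal (L + 1)"
          unfolding le_Liminf_iff frequently_def not_le by (blast intro: eventually_mono less_trans)
        have "chain_var (\<lambda>s. f (s, c)) xs \<le> L + 1" if xs: "sorted xs" "set xs \<subseteq> S" for xs
        proof (rule ccontr)
          assume "\<not> ?thesis"
          then have gt: "L + 1 < chain_var (\<lambda>s. f (s, c)) xs" by simp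
          have "(\<lambda>k. chain_var (\<lambda>s. grid_approx (r k) f (s, c)) xs) \<longlonglongrightarrow> chain_var (\<lambda>s. f (s, c)) xs"
            by (rule chain_var_tendsto) (use xs(2) in \<open>auto simp: S_def\<close>)
          then have ev1: "\<forall>\<^sub>F k in sequentially. L + 1 < chain_var (\<lambda>s. grid_approx (r k) f (s, c)) xs"
            using gt by (rule order_tendstoD)
          \<comment> \<open>A fixed interior point leaves the border cells once the grid is fine; a
            chain does so as a whole because it is finite.\<close>
          have inner: "\<forall>\<^sub>F k in sequentially. 1 \<le> real (r k) * s \<and> real (r k) * s < real (r k) - 1"
            if "s \<in> {0<..<1}" for s :: real
          proof -
            have s: "0 < s" "s < 1" using that by auto
            obtain K :: nat where K: "1 / s + 1 / (1 - s) < real K" using reals_Archimedean2 by blast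
            have "1 \<le> real (r k) * s \<and> real (r k) * s < real (r k) - 1" if "K \<le> k" for k
            proof -
              have "K \<le> r k" using seq_suble[OF r(1), of k] that by simp
              then have Kr: "1 / s + 1 / (1 - s) < real (r k)" using K by linarith
              have "0 < 1 / s" "0 < 1 / (1 - s)" using s by auto
              then have "1 / s < real (r k)" "1 / (1 - s) < real (r k)" using Kr by linarith+
              then show ?thesis using s by (simp add: field_simps)
            qed
            then show ?thesis unfolding eventually_sequentially by blast
          qed
          have ev2: "\<forall>\<^sub>F k in sequentially. \<forall>s\<in>set xs. 1 \<le> real (r k) * s \<and> real (r k) * s < real (r k) - 1"
            using xs(2) by (intro eventually_ball_finite ballI inner) (auto simp: S_def)
          have "\<forall>\<^sub>F k in sequentially. \<not> grid_var (r k) f c \<le> ennreal (L + 1)"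
            using ev1 ev2 inner[OF c]
          proof eventually_elim
            case (elim k)
            have "ennreal (L + 1) < ennreal (chain_var (\<lambda>s. grid_approx (r k) f (s, c)) xs)"
              using elim(1) L(2) by (subst ennreal_less_iff) auto
            also have "\<dots> \<le> grid_var (r k) f c"
              by (rule chain_var_grid_approx_le[OF xs(1)]) (use elim(2,3) in auto)
            finally show ?case by (simp add: not_le)
          qed
          then show False using freq unfolding frequently_def by blast
        qed
        then show ?thesis unfolding bv_on_set_def by blast
      qed
      ultimately show "\<exists>S. S \<subseteq> {0<..<1} \<and> negligible ({0<..<1} - S) \<and> bv_on_set S (\<lambda>s. f (s, c))"
        by (intro exI[of _ S]) (auto simp: S_def)
    qed
  qed
qed

section \<open>Flatness along rows and the approximate gradient\<close>

lemma chain_var_add_le: "chain_var (\<lambda>x. f x + g x) xs \<le> chain_var f xs + chain_var g xs"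
  by (induction xs rule: induct_list012) auto

lemma chain_var_linear_le:
  assumes "sorted xs" "set xs \<subseteq> {0..1}" "0 \<le> c"
  shows "chain_var (\<lambda>x. c * x) xs \<le> c"
proof -
  have "chain_var (\<lambda>x. c * x) xs \<le> c * (1 - y)" if "sorted xs" "set xs \<subseteq> {y..1}" "y \<le> 1" for y
    using that
  proof (induction xs arbitrary: y rule: induct_list012)
    case (3 a b zs)
    have ab: "y \<le> a" "a \<le> b" "b \<le> 1" using 3 by auto
    have "chain_var (\<lambda>x. c * x) (b # zs) \<le> c * (1 - b)" using 3 ab by (intro 3) auto
    moreover have "\<bar>c * b - c * a\<bar> = c * (b - a)"
      using ab assms(3) by (simp add: right_diff_distrib[symmetric])
    moreover have "c * (1 - a) \<le> c * (1 - y)" using ab assms(3) by (intro mult_left_mono) auto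
    ultimately show ?case by (simp add: algebra_simps)
  qed (use assms(3) in auto)
  from this[of 0] assms show ?thesis by simp
qed

text \<open>Relative flatness of \<open>f\<close> along the horizontal line through \<open>x\<close>, stated with a null set of
  exceptions so that it defines a Borel set of points \<open>x\<close>.\<close>

definition h_flat :: "(real \<times> real \<Rightarrow> real) \<Rightarrow> real \<Rightarrow> real \<Rightarrow> real \<times> real \<Rightarrow> bool" where
  "h_flat f m d x \<longleftrightarrow> (AE s in lborel. s \<in> {0<..<1} \<and> \<bar>s - fst x\<bar> < d \<longrightarrow>
     \<bar>(f (s, snd x) + snd x * s) - (f x + snd x * fst x)\<bar> \<le> m * \<bar>s - fst x\<bar>)"

lemma AE_slice_h_flat:
  assumes f: "integrable lborel f" and f0: "\<And>x. x \<notin> unit_sq \<Longrightarrow> f x = 0" and M: "h_variation_le f M"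
    and gf: "AE x in lborel. x \<in> unit_sq \<longrightarrow> g x = f x"
    and null: "AE c in lborel. c \<in> {0<..<1} \<longrightarrow> negligible ((\<lambda>s. g (s, c) + c * s) ` {0<..<1})"
  shows "AE c in lborel. AE s in lborel. (s, c) \<in> unit_sq \<longrightarrow> (\<forall>n::nat. \<exists>k::nat. h_flat f (1 / Suc n) (1 / Suc k) (s, c))"
proof -
  have "AE c in lborel. c \<in> {0<..<1} \<longrightarrow>
      (\<exists>S. S \<subseteq> {0<..<1} \<and> negligible ({0<..<1} - S) \<and> bv_on_set S (\<lambda>s. f (s, c)))"
    by (rule h_variation_le_imp_AE_slice_bv[OF f _ M]) (rule f0)
  then show ?thesis using null AE_lborel_slices(2)[OF gf]
  proof eventually_elim
    case (elim c)
    show ?case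
    proof (cases "c \<in> {0<..<1}")
      case False
      then show ?thesis by auto
    next
      case c: True
      then obtain S where S: "S \<subseteq> {0<..<1}" "negligible ({0<..<1} - S)" "bv_on_set S (\<lambda>s. f (s, c))"
        using elim(1) by blast
      \<comment> \<open>Bounded variation is known for \<open>f\<close> and the null range for
        \<open>g\<close>; both hold for the same function on the points of \<open>S\<close> where
        they agree.\<close>
      define S1 where "S1 = {s \<in> S. g (s, c) = f (s, c)}"
      define F where "F s = f (s, c) + c * s" for s
      have "negligible (({0<..<1} - S) \<union> {s. \<not> ((s, c) \<in> unit_sq \<longrightarrow> g (s, c) = f (s, c))})"
        using S(2) elim(3) unfolding AE_lborel_iff_negligible by (rule negligible_Un)
      then have negS1: "negligible ({0<..<1} - S1)"
        by (rule negligible_subset) (use c in \<open>auto simp: S1_def\<close>)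
      have bv: "bv_on_set S1 F"
      proof -
        obtain B where B: "\<And>xs. sorted xs \<Longrightarrow> set xs \<subseteq> S \<Longrightarrow> chain_var (\<lambda>s. f (s, c)) xs \<le> B"
          using S(3) unfolding bv_on_set_def by blast
        have "chain_var F xs \<le> B + c" if "sorted xs" "set xs \<subseteq> S1" for xs
        proof -
          have "set xs \<subseteq> S" "set xs \<subseteq> {0..1}" using that S(1) by (force simp: S1_def)+
          then have "chain_var (\<lambda>s. f (s, c)) xs \<le> B" "chain_var (\<lambda>s. c * s) xs \<le> c"
            using B chain_var_linear_le that(1) c by auto
          then show ?thesis
            unfolding F_def using chain_var_add_le[of "\<lambda>s. f (s, c)" "\<lambda>s. c * s" xs] by linarith
        qed
        then show ?thesis unfolding bv_on_set_def by blast
      qed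
      have img: "negligible (F ` S1)"
      proof (rule negligible_subset)
        show "negligible ((\<lambda>s. g (s, c) + c * s) ` {0<..<1})" using elim(2) c by blast
        show "F ` S1 \<subseteq> (\<lambda>s. g (s, c) + c * s) ` {0<..<1}" 
        proof (rule image_subsetI)
          fix s assume "s \<in> S1"
          then have "F s = g (s, c) + c * s" "s \<in> {0<..<1}" using S(1) by (auto simp: S1_def F_def)
          then show "F s \<in> (\<lambda>s. g (s, c) + c * s) ` {0<..<1}" by (rule image_eqI)
        qed
      qed
      define St where "St n = {s \<in> S1. \<forall>d>0. \<exists>t\<in>S1. 0 < \<bar>t - s\<bar> \<and> \<bar>t - s\<bar> < d \<and> (1 / Suc n) * \<bar>t - s\<bar> < \<bar>F t - F s\<bar>}" for n :: nat
      have "negligible (St n)" for n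
        unfolding St_def by (rule bv_steep_points_negligible[OF bv order_refl img]) simp
      then have "negligible (({0<..<1} - S1) \<union> (\<Union>n. St n))"
        using negS1 by (intro negligible_Un negligible_countable_Union) auto
      moreover have "{s. \<not> ((s, c) \<in> unit_sq \<longrightarrow> (\<forall>n::nat. \<exists>k::nat. h_flat f (1 / Suc n) (1 / Suc k) (s, c)))}
        \<subseteq> ({0<..<1} - S1) \<union> (\<Union>n. St n)"
      proof (rule subsetI, rule ccontr)
        fix s assume s: "s \<in> {s. \<not> ((s, c) \<in> unit_sq \<longrightarrow> (\<forall>n::nat. \<exists>k::nat. h_flat f (1 / Suc n) (1 / Suc k) (s, c)))}"
          and ns: "s \<notin> ({0<..<1} - S1) \<union> (\<Union>n. St n)"
        then have sS: "s \<in> S1" by auto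
        have "\<exists>k::nat. h_flat f (1 / Suc n) (1 / Suc k) (s, c)" for n :: nat
        proof -
          have "s \<notin> St n" using ns by blast
          then obtain d where d: "d > 0" "\<And>t. t \<in> S1 \<Longrightarrow> 0 < \<bar>t - s\<bar> \<Longrightarrow> \<bar>t - s\<bar> < d \<Longrightarrow> \<bar>F t - F s\<bar> \<le> (1 / Suc n) * \<bar>t - s\<bar>"
            using sS unfolding St_def mem_Collect_eq by (meson not_le)
          obtain k :: nat where k: "1 / Suc k < d" using reals_Archimedean[OF d(1)] by (auto simp: inverse_eq_divide)
          have "AE t in lborel. t \<in> {0<..<1} \<longrightarrow> t \<in> S1"
            unfolding AE_lborel_iff_negligible using negS1 by (rule negligible_subset) auto
          then have "h_flat f (1 / Suc n) (1 / Suc k) (s, c)"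
            unfolding h_flat_def
          proof eventually_elim
            case (elim t)
            have "\<bar>F t - F s\<bar> \<le> (1 / Suc n) * \<bar>t - s\<bar>" if "t \<in> S1" "\<bar>t - s\<bar> < 1 / Suc k"
              using d(2)[OF that(1)] that(2) k by (cases "t = s") auto
            then show ?case using elim by (auto simp: F_def)
          qed
          then show ?thesis by blast
        qed
        then show False using s by blast
      qed
      ultimately show ?thesis unfolding AE_lborel_iff_negligible by (rule negligible_subset)
    qed
  qed
qed

text \<open>Null rows do not make a non-measurable set null. This direction of Fubini is the reason
  for arranging the flat points and the density points in Borel sets.\<close>

lemma AE_lborel_of_slices:
  fixes P :: "real \<times> real \<Rightarrow> bool"
  assumes m: "{x. P x} \<in> sets borel" and ae: "AE t in lborel. AE s in lborel. P (s, t)"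
  shows "AE x in lborel. P x"
proof -
  have sw: "(\<lambda>x::real \<times> real. (snd x, fst x)) \<in> borel_measurable borel"
    by (intro borel_measurable_continuous_onI continuous_intros)
  have "(\<lambda>x. (snd x, fst x)) -` {x. P x} \<inter> space borel \<in> sets borel" using sw m by (rule measurable_sets)
  then have "{x. P (snd x, fst x)} \<in> sets (lborel \<Otimes>\<^sub>M lborel)"
    unfolding lborel_prod by (simp add: vimage_def)
  then have "AE x in lborel \<Otimes>\<^sub>M lborel. P (snd x, fst x)"
    using ae by (intro lborel_pair.AE_pair_measure) (simp_all add: space_pair_measure)
  then have "AE x in lborel. P (snd x, fst x)" unfolding lborel_prod .
  from AE_lborel_swap[OF this] show ?thesis by simp
qed

lemma emeasure_slice_measurable:
  fixes P :: "real \<times> real \<Rightarrow> real \<Rightarrow> bool"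
  assumes "Measurable.pred (borel \<Otimes>\<^sub>M borel) (\<lambda>p. P (fst p) (snd p))"
  shows "(\<lambda>x. emeasure lborel {s. P x s}) \<in> borel_measurable borel" and "{s. P x s} \<in> sets borel"
proof -
  have B: "{p. P (fst p) (snd p)} \<in> sets (borel \<Otimes>\<^sub>M borel)"
    using assms by (simp add: pred_def space_pair_measure)
  then have B': "{p. P (fst p) (snd p)} \<in> sets (borel \<Otimes>\<^sub>M lborel)"
    by (simp cong: sets_pair_measure_cong)
  have eq: "Pair x -` {p. P (fst p) (snd p)} = {s. P x s}" for x by auto
  show "(\<lambda>x. emeasure lborel {s. P x s}) \<in> borel_measurable borel"
    using lborel.measurable_emeasure_Pair[OF B'] by (simp add: eq)
  show "{s. P x s} \<in> sets borel" using sets_Pair1[OF B, of x] by (simp add: eq)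
qed

text \<open>Flatness says that the row slice of bad points \<open>s\<close> has measure zero, and
  that measure is a Borel function of the base point. Quantifying over all \<open>s\<close> would
  instead describe the complement of a projection.\<close>

lemma h_flat_measurable:
  assumes "f \<in> borel_measurable borel"
  shows "{x. h_flat f m d x} \<in> sets borel"
proof -
  define P where "P x s \<longleftrightarrow> s \<in> {0<..<1} \<and> \<bar>s - fst x\<bar> < d \<and>
     \<not> \<bar>(f (s, snd x) + snd x * s) - (f x + snd x * fst x)\<bar> \<le> m * \<bar>s - fst x\<bar>" for x s
  have c1: "(\<lambda>p::(real \<times> real) \<times> real. f (snd p, snd (fst p))) \<in> borel_measurable borel"
    by (rule measurable_compose[OF _ assms]) (intro borel_measurable_continuous_onI continuous_intros)
  have c2: "(\<lambda>p::(real \<times> real) \<times> real. f (fst p)) \<in> borel_measurable borel"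
    by (rule measurable_compose[OF _ assms]) (intro borel_measurable_continuous_onI continuous_intros)
  have c3: "(\<lambda>p::(real \<times> real) \<times> real. snd p) \<in> borel_measurable borel"
    "(\<lambda>p::(real \<times> real) \<times> real. fst (fst p)) \<in> borel_measurable borel"
    "(\<lambda>p::(real \<times> real) \<times> real. snd (fst p)) \<in> borel_measurable borel"
    by (intro borel_measurable_continuous_onI continuous_intros)+
  note [measurable] = c1 c2 c3
  have pr: "Measurable.pred (borel \<Otimes>\<^sub>M borel) (\<lambda>p. P (fst p) (snd p))"
    unfolding P_def borel_prod surjective_pairing[symmetric] greaterThanLessThan_iff by measurable
  have "h_flat f m d x \<longleftrightarrow> emeasure lborel {s. P x s} = 0" for x
  proof -
    have m: "{s. P x s} \<in> sets lborel" using emeasure_slice_measurable(2)[OF pr, of x] by simp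
    have "h_flat f m d x \<longleftrightarrow> (AE s in lborel. \<not> P x s)"
      unfolding h_flat_def P_def by (rule arg_cong[where f = "\<lambda>Q. almost_everywhere lborel Q"]) blast
    also have "\<dots> \<longleftrightarrow> emeasure lborel {s. P x s} = 0"
      by (rule AE_iff_measurable[OF m]) simp
    finally show ?thesis .
  qed
  then have "{x. h_flat f m d x} = (\<lambda>x. emeasure lborel {s. P x s}) -` {0} \<inter> space borel" by auto
  also have "\<dots> \<in> sets borel" by (rule measurable_sets[OF emeasure_slice_measurable(1)[OF pr]]) simp
  finally show ?thesis .
qed

lemma AE_h_flat:
  assumes f: "integrable lborel f" and f0: "\<And>x. x \<notin> unit_sq \<Longrightarrow> f x = 0" and M: "h_variation_le f M"
    and gf: "AE x in lborel. x \<in> unit_sq \<longrightarrow> g x = f x"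
    and null: "AE c in lborel. c \<in> {0<..<1} \<longrightarrow> negligible ((\<lambda>s. g (s, c) + c * s) ` {0<..<1})"
  shows "AE x in lborel. x \<in> unit_sq \<longrightarrow> (\<forall>n::nat. \<exists>k::nat. h_flat f (1 / Suc n) (1 / Suc k) x)"
proof (rule AE_lborel_of_slices)
  have fm: "f \<in> borel_measurable borel" using borel_measurable_integrable[OF f] by simp
  have [measurable]: "{x. h_flat f m d x} \<in> sets borel" for m d by (rule h_flat_measurable[OF fm])
  have "{x. x \<in> unit_sq \<longrightarrow> (\<forall>n::nat. \<exists>k::nat. h_flat f (1 / Suc n) (1 / Suc k) x)}
      = (- unit_sq) \<union> (\<Inter>n. \<Union>k. {x. h_flat f (1 / Suc n) (1 / Suc k) x})" by blast
  also have "\<dots> \<in> sets borel" by measurable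
  finally show "{x. x \<in> unit_sq \<longrightarrow> (\<forall>n::nat. \<exists>k::nat. h_flat f (1 / Suc n) (1 / Suc k) x)} \<in> sets borel" .
  show "AE t in lborel. AE s in lborel. (s, t) \<in> unit_sq \<longrightarrow> (\<forall>n::nat. \<exists>k::nat. h_flat f (1 / Suc n) (1 / Suc k) (s, t))"
    by (rule AE_slice_h_flat[OF f _ M gf null]) (rule f0)
qed

section \<open>From the BV hypothesis to bounds on the two partial derivatives\<close>

lemma C1c_onE:
  assumes "C1c_on \<Omega> \<phi>"
  obtains d1 d2 K where "\<And>x. (\<phi> has_derivative (\<lambda>h. d1 x * fst h + d2 x * snd h)) (at x)"
    "continuous_on UNIV d1" "continuous_on UNIV d2" "compact K" "K \<subseteq> \<Omega>" "\<And>x. \<phi> x \<noteq> 0 \<Longrightarrow> x \<in> K"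
proof -
  obtain \<phi>' where d: "\<And>x. (\<phi> has_derivative blinfun_apply (\<phi>' x)) (at x)" and c: "continuous_on UNIV \<phi>'"
    and K: "compact (closure {x. \<phi> x \<noteq> 0})" "closure {x. \<phi> x \<noteq> 0} \<subseteq> \<Omega>"
    using assms unfolding C1c_on_def by blast
  have lin: "blinfun_apply (\<phi>' x) = (\<lambda>h. \<phi>' x (1, 0) * fst h + \<phi>' x (0, 1) * snd h)" for x
  proof
    fix h :: "real \<times> real"
    have "h = fst h *\<^sub>R (1, 0) + snd h *\<^sub>R (0, 1)" by (cases h) simp
    then have "\<phi>' x h = \<phi>' x (fst h *\<^sub>R (1, 0) + snd h *\<^sub>R (0, 1))" by simp
    also have "\<dots> = \<phi>' x (1, 0) * fst h + \<phi>' x (0, 1) * snd h"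
      by (simp only: blinfun.add_right blinfun.scaleR_right) simp
    finally show "\<phi>' x h = \<phi>' x (1, 0) * fst h + \<phi>' x (0, 1) * snd h" .
  qed
  show ?thesis
  proof
    show "(\<phi> has_derivative (\<lambda>h. \<phi>' x (1, 0) * fst h + \<phi>' x (0, 1) * snd h)) (at x)" for x
      by (rule has_derivative_eq_rhs[OF d lin])
    show "continuous_on UNIV (\<lambda>x. \<phi>' x (1, 0))" "continuous_on UNIV (\<lambda>x. \<phi>' x (0, 1))"
      by (intro continuous_intros c)+
    show "x \<in> closure {x. \<phi> x \<noteq> 0}" if "\<phi> x \<noteq> 0" for x
      by (rule subsetD[OF closure_subset]) (use that in simp)
  qed (rule K)+
qed

lemma frechet_derivative_partials:
  assumes "(\<phi> has_derivative (\<lambda>h. d1 * fst h + d2 * snd h)) (at (x :: real \<times> real))"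
  shows "frechet_derivative \<phi> (at x) (1, 0) = d1" "frechet_derivative \<phi> (at x) (0, 1) = (d2::real)"
  by (simp_all flip: frechet_derivative_at[OF assms])

lemma C1c_on_zero: "C1c_on \<Omega> (\<lambda>x. 0)"
  by (rule C1c_onI[of _ "\<lambda>x. 0" "\<lambda>x. 0" "{}"]) auto

lemma integral_lborel_swap:
  fixes F :: "real \<times> real \<Rightarrow> real"
  assumes "F \<in> borel_measurable borel"
  shows "(LBINT x. F (snd x, fst x)) = (LBINT x. F x)"
proof -
  have "(\<integral>x. F x \<partial>distr lborel lborel (\<lambda>(x, y). (y, x))) = (LBINT x. F (case x of (x, y) \<Rightarrow> (y, x)))"
    by (rule integral_distr[OF measurable_lborel_swap]) (use assms in simp)
  then show ?thesis unfolding distr_lborel_swap by (simp add: case_prod_unfold)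
qed

text \<open>Vector fields with one zero component test the two partial derivatives separately. Since
  \<open>g\<close> is only Lebesgue measurable, a Borel function vanishing off the square is
  substituted; the second bound is stated for the reflected function - f(x2, x1), to which the row
  results apply again.\<close>

lemma BV_on_unit_sq_Borel_version:
  assumes "BV_on unit_sq g"
  obtains f M where "integrable lborel f" "\<And>x. x \<notin> unit_sq \<Longrightarrow> f x = 0"
    "AE x in lborel. x \<in> unit_sq \<longrightarrow> g x = f x"
    "h_variation_le f M" "h_variation_le (\<lambda>x. - f (snd x, fst x)) M"
proof -
  have gi: "integrable lebesgue (\<lambda>x. indicator unit_sq x * g x)"
    using assms by (simp add: BV_on_def set_integrable_def)
  obtain M where M: "\<And>\<phi>1 \<phi>2. C1c_on unit_sq \<phi>1 \<Longrightarrow> C1c_on unit_sq \<phi>2 \<Longrightarrow> (\<And>x. (\<phi>1 x)\<^sup>2 + (\<phi>2 x)\<^sup>2 \<le> 1) \<Longrightarrow>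
        \<bar>LINT x:unit_sq|lebesgue. g x * divergence \<phi>1 \<phi>2 x\<bar> \<le> M"
    using assms unfolding BV_on_def by blast
  obtain f0 where f0[measurable]: "f0 \<in> borel_measurable lborel"
    and f0g: "AE x in lborel. indicator unit_sq x * g x = f0 x"
    using completion_ex_borel_measurable_real[OF borel_measurable_integrable[OF gi]] by blast
  define f where "f x = indicator unit_sq x * f0 x" for x
  have fm[measurable]: "f \<in> borel_measurable borel" unfolding f_def[abs_def] using f0 by measurable
  have gf: "AE x in lborel. indicator unit_sq x * g x = f x"
    using f0g
  proof eventually_elim
    case (elim x)
    then show ?case by (cases "x \<in> unit_sq") (simp_all add: f_def del: mem_Sigma_iff)
  qed
  then have gf': "AE x in lebesgue. indicator unit_sq x * g x = f x" by (simp add: AE_completion_iff)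
  have fml: "f \<in> borel_measurable lebesgue" by (rule measurable_completion) simp
  have "integrable lebesgue f"
    using gi by (rule integrable_cong_AE_imp[OF _ fml]) (use gf' in \<open>auto elim: eventually_mono\<close>)
  then have fi: "integrable lborel f" by (simp add: integrable_completion)
  have int: "(LINT x:unit_sq|lebesgue. g x * D x) = (LBINT x. f x * D x)"
    if D: "D \<in> borel_measurable borel" for D
  proof -
    have Dl: "D \<in> borel_measurable lebesgue" by (rule measurable_completion) (use D in simp)
    have "(LINT x:unit_sq|lebesgue. g x * D x) = (\<integral>x. (indicator unit_sq x * g x) * D x \<partial>lebesgue)"
      by (simp add: set_lebesgue_integral_def mult.assoc)
    also have "\<dots> = (\<integral>x. f x * D x \<partial>lebesgue)"
    proof (rule integral_cong_AE)
      show "(\<lambda>x. indicator unit_sq x * g x * D x) \<in> borel_measurable lebesgue"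
        using borel_measurable_integrable[OF gi] Dl by (rule borel_measurable_times)
      show "(\<lambda>x. f x * D x) \<in> borel_measurable lebesgue" using fml Dl by (rule borel_measurable_times)
    qed (use gf' in \<open>auto elim: eventually_mono\<close>)
    also have "\<dots> = (LBINT x. f x * D x)"
      by (rule integral_completion) (use fm D in measurable)
    finally show ?thesis .
  qed
  have fd0: "frechet_derivative (\<lambda>x::real \<times> real. 0::real) (at x) = (\<lambda>h. 0)" for x
    using frechet_derivative_at[of "\<lambda>x::real \<times> real. 0::real" "\<lambda>h. 0"] by simp
  have h1: "h_variation_le f M"
    unfolding h_variation_le_def
  proof (intro allI impI, elim conjE)
    fix \<phi> assume \<phi>: "C1c_on unit_sq \<phi>" "\<forall>x. \<bar>\<phi> x\<bar> \<le> 1"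
    obtain d1 d2 where d: "\<And>x. (\<phi> has_derivative (\<lambda>h. d1 x * fst h + d2 x * snd h)) (at x)" "continuous_on UNIV d1"
      using C1c_onE[OF \<phi>(1)] by metis
    have "\<bar>LINT x:unit_sq|lebesgue. g x * divergence \<phi> (\<lambda>x. 0) x\<bar> \<le> M"
      by (rule M[OF \<phi>(1) C1c_on_zero]) (use \<phi>(2) in \<open>simp add: abs_square_le_1 del: split_paired_All\<close>)
    then have "\<bar>LINT x:unit_sq|lebesgue. g x * d1 x\<bar> \<le> M"
      by (simp add: divergence_def fd0 frechet_derivative_partials[OF d(1)])
    then show "\<bar>LBINT x. f x * frechet_derivative \<phi> (at x) (1, 0)\<bar> \<le> M"
      using int[OF borel_measurable_continuous_onI[OF d(2)]] by (simp add: frechet_derivative_partials[OF d(1)])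
  qed
  have h2: "h_variation_le (\<lambda>x. - f (snd x, fst x)) M"
    unfolding h_variation_le_def
  proof (intro allI impI, elim conjE)
    fix \<phi> assume \<phi>: "C1c_on unit_sq \<phi>" "\<forall>x. \<bar>\<phi> x\<bar> \<le> 1"
    obtain d1 d2 K where d: "\<And>x. (\<phi> has_derivative (\<lambda>h. d1 x * fst h + d2 x * snd h)) (at x)"
      "continuous_on UNIV d1" "continuous_on UNIV d2" "compact K" "K \<subseteq> unit_sq" "\<And>x. \<phi> x \<noteq> 0 \<Longrightarrow> x \<in> K"
      by (rule C1c_onE[OF \<phi>(1)]) (rule that)
    define \<psi> where "\<psi> x = \<phi> (snd x, fst x)" for x
    have d\<psi>: "(\<psi> has_derivative (\<lambda>h. d2 (snd x, fst x) * fst h + d1 (snd x, fst x) * snd h)) (at x)" for x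
    proof -
      have "((\<lambda>x::real \<times> real. (snd x, fst x)) has_derivative (\<lambda>h. (snd h, fst h))) (at x)"
        by (intro derivative_intros)
      from has_derivative_compose[OF this d(1)[of "(snd x, fst x)"]] show ?thesis
        by (simp add: \<psi>_def[abs_def] add.commute)
    qed
    have cs: "continuous_on UNIV (\<lambda>x::real \<times> real. (snd x, fst x))" by (intro continuous_intros)
    have c\<psi>: "C1c_on unit_sq \<psi>"
    proof (rule C1c_onI[OF d\<psi>])
      show "continuous_on UNIV (\<lambda>x. d2 (snd x, fst x))" "continuous_on UNIV (\<lambda>x. d1 (snd x, fst x))"
        by (rule continuous_on_compose2[OF d(3) cs] continuous_on_compose2[OF d(2) cs]; simp)+
      show "compact ((\<lambda>x. (snd x, fst x)) ` K)"
        by (rule compact_continuous_image[OF continuous_on_subset[OF cs] d(4)]) simp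
      show "(\<lambda>x. (snd x, fst x)) ` K \<subseteq> unit_sq" using d(5) by (auto simp: subset_iff mem_Times_iff)
      show "x \<in> (\<lambda>x. (snd x, fst x)) ` K" if "\<psi> x \<noteq> 0" for x
        using d(6)[of "(snd x, fst x)"] that by (intro image_eqI[of _ _ "(snd x, fst x)"]) (auto simp: \<psi>_def)
    qed
    have "\<bar>LINT x:unit_sq|lebesgue. g x * divergence (\<lambda>x. 0) \<psi> x\<bar> \<le> M"
      by (rule M[OF C1c_on_zero c\<psi>]) (use \<phi>(2) in \<open>simp add: \<psi>_def abs_square_le_1 del: split_paired_All\<close>)
    then have "\<bar>LINT x:unit_sq|lebesgue. g x * d1 (snd x, fst x)\<bar> \<le> M"
      by (simp add: divergence_def fd0 frechet_derivative_partials[OF d\<psi>])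
    moreover have d1m: "d1 \<in> borel_measurable borel" by (rule borel_measurable_continuous_onI[OF d(2)])
    moreover have sm: "(\<lambda>x::real \<times> real. (snd x, fst x)) \<in> borel_measurable borel" by (rule borel_measurable_continuous_onI[OF cs])
    ultimately have "\<bar>LBINT x. f x * d1 (snd x, fst x)\<bar> \<le> M"
      using int[OF measurable_compose[OF sm d1m]] by simp
    also have "(LBINT x. f x * d1 (snd x, fst x)) = (LBINT x. f (snd x, fst x) * d1 x)"
      using integral_lborel_swap[OF borel_measurable_times[OF measurable_compose[OF sm fm] d1m]] by simp
    finally have "\<bar>LBINT x. f (snd x, fst x) * d1 x\<bar> \<le> M" .
    then show "\<bar>LBINT x. - f (snd x, fst x) * frechet_derivative \<phi> (at x) (1, 0)\<bar> \<le> M"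
      by (simp add: frechet_derivative_partials[OF d(1)])
  qed
  show ?thesis
  proof (rule that[OF fi _ _ h1 h2])
    show "f x = 0" if "x \<notin> unit_sq" for x using that by (simp add: f_def)
    show "AE x in lborel. x \<in> unit_sq \<longrightarrow> g x = f x" using gf by eventually_elim auto
  qed
qed

section \<open>Uniform column flatness and its density along rows\<close>

lemma swap_measurable: "(\<lambda>x::real \<times> real. (snd x, fst x)) \<in> borel_measurable borel"
  by (intro borel_measurable_continuous_onI continuous_intros)

text \<open>\<open>h_flat\<close> for the reflected function at the reflected point is flatness of t
  -> f(y1, t) - y1 * t along the column through y = (y1, y2). The constants \<open>m\<close> and
  \<open>d\<close> are shared by all points of the set.\<close>

definition v_flat_set :: "(real \<times> real \<Rightarrow> real) \<Rightarrow> real \<Rightarrow> real \<Rightarrow> (real \<times> real) set" where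
  "v_flat_set f m d = {y \<in> unit_sq. h_flat (\<lambda>y. - f (snd y, fst y)) m d (snd y, fst y)}"

lemma v_flat_set_measurable:
  assumes "f \<in> borel_measurable borel"
  shows "v_flat_set f m d \<in> sets borel"
proof -
  have "(\<lambda>y. - f (snd y, fst y)) \<in> borel_measurable borel" using measurable_compose[OF swap_measurable assms] by simp
  from measurable_sets[OF swap_measurable h_flat_measurable[OF this]]
  have "unit_sq \<inter> {y. h_flat (\<lambda>y. - f (snd y, fst y)) m d (snd y, fst y)} \<in> sets borel"
    by (intro sets.Int unit_sq_borel) (simp add: vimage_def)
  then show ?thesis by (simp only: v_flat_set_def Collect_conj_eq Collect_mem_eq)
qed

text \<open>\<open>x\<close> is a one-dimensional density point of the row of \<open>V\<close>
  through it. Radii \<open>1 / Suc j\<close> and fractions \<open>1 / Suc l\<close> make this a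
  countable condition, so that the points satisfying it form a Borel set when \<open>V\<close> is
  Borel.\<close>

definition row_dense :: "(real \<times> real) set \<Rightarrow> real \<times> real \<Rightarrow> bool" where
  "row_dense V x \<longleftrightarrow> (\<forall>l::nat. \<exists>J::nat. \<forall>j\<ge>J.
     emeasure lborel {s. \<bar>s - fst x\<bar> \<le> 1 / Suc j \<and> (s, snd x) \<notin> V} \<le> ennreal (1 / (real (Suc l) * real (Suc j))))"

lemma row_complement_pred:
  fixes V :: "(real \<times> real) set" and r :: real
  assumes V: "V \<in> sets borel"
  shows "Measurable.pred (borel \<Otimes>\<^sub>M borel) (\<lambda>p. \<bar>snd p - fst (fst p)\<bar> \<le> r \<and> (snd p, snd (fst p)) \<notin> V)"
proof -
  have c: "(\<lambda>p::(real \<times> real) \<times> real. (snd p, snd (fst p))) \<in> borel_measurable borel"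
    by (intro borel_measurable_continuous_onI continuous_intros)
  have "{p::(real \<times> real) \<times> real. \<bar>snd p - fst (fst p)\<bar> \<le> r} \<in> sets borel"
    by (intro borel_closed closed_Collect_le continuous_intros)
  moreover have "{p::(real \<times> real) \<times> real. (snd p, snd (fst p)) \<in> V} \<in> sets borel"
    using measurable_sets[OF c V] by (simp add: vimage_def)
  ultimately have "{p. \<bar>snd p - fst (fst p)\<bar> \<le> r} - {p. (snd p, snd (fst p)) \<in> V} \<in> sets borel"
    by (rule sets.Diff)
  also have "{p. \<bar>snd p - fst (fst p)\<bar> \<le> r} - {p. (snd p, snd (fst p)) \<in> V}
      = {p. \<bar>snd p - fst (fst p)\<bar> \<le> r \<and> (snd p, snd (fst p)) \<notin> V}" by blast
  finally show ?thesis unfolding borel_prod pred_def space_borel by simp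
qed

text \<open>The density theorem is applied on each row and the rows are joined by Fubini. Planar
  density would not control the single row through \<open>x\<close>.\<close>

lemma AE_row_dense:
  assumes V: "V \<in> sets borel"
  shows "AE x in lborel. x \<in> V \<longrightarrow> row_dense V x"
proof (rule AE_lborel_of_slices)
  define e where "e j x = emeasure lborel {s. \<bar>s - fst x\<bar> \<le> 1 / Suc j \<and> (s, snd x) \<notin> V}" for j :: nat and x
  have [measurable]: "e j \<in> borel_measurable borel" for j
    unfolding e_def[abs_def] by (rule emeasure_slice_measurable(1)[OF row_complement_pred[OF V]])
  note V[measurable]
  have "{x. x \<in> V \<longrightarrow> row_dense V x} = - V \<union> {x. row_dense V x}" by blast
  moreover have "{x. row_dense V x} = {x \<in> space borel. \<forall>l. \<exists>J. \<forall>j. J \<le> j \<longrightarrow> e j x \<le> ennreal (1 / (real (Suc l) * real (Suc j)))}"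
    unfolding row_dense_def e_def by simp
  moreover have "\<dots> \<in> sets borel" by measurable
  ultimately show "{x. x \<in> V \<longrightarrow> row_dense V x} \<in> sets borel" using V by simp
  show "AE c in lborel. AE s in lborel. (s, c) \<in> V \<longrightarrow> row_dense V (s, c)"
  proof (rule AE_I2)
    fix c :: real
    define B where "B = {s. (s, c) \<in> V}"
    have "(\<lambda>s. (s, c)) \<in> borel_measurable borel" by (intro borel_measurable_continuous_onI continuous_intros)
    from measurable_sets[OF this V] have Bb: "B \<in> sets borel" by (simp add: B_def vimage_def)
    then have B: "B \<in> sets lebesgue" by simp
    \<comment> \<open>The 2 offsets the length \<open>2 * r\<close> of the interval, so that outside
      these sets the complement takes at most \<open>r / Suc l\<close>.\<close>
    define Z where "Z l = {s \<in> B. \<forall>d>0. \<exists>r. 0 < r \<and> r < d \<and>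
       (1 / (2 * Suc l)) * measure lebesgue (cball s r) < measure lebesgue (cball s r - B)}" for l :: nat
    have "negligible (Z l)" for l
      unfolding Z_def by (rule lebesgue_density[OF B]) simp
    then have "negligible (\<Union>l. Z l)" by (intro negligible_countable_Union) auto
    moreover have "{s. \<not> ((s, c) \<in> V \<longrightarrow> row_dense V (s, c))} \<subseteq> (\<Union>l. Z l)"
    proof (rule subsetI, rule ccontr)
      fix s assume s: "s \<in> {s. \<not> ((s, c) \<in> V \<longrightarrow> row_dense V (s, c))}" and n: "s \<notin> (\<Union>l. Z l)"
      then have sB: "s \<in> B" by (simp add: B_def)
      have "row_dense V (s, c)"
        unfolding row_dense_def fst_conv snd_conv
      proof
        fix l :: nat
        have "s \<notin> Z l" using n by blast
        then obtain d where d: "0 < d" "\<And>r. 0 < r \<Longrightarrow> r < d \<Longrightarrow>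
            measure lebesgue (cball s r - B) \<le> (1 / (2 * Suc l)) * measure lebesgue (cball s r)"
          using sB unfolding Z_def mem_Collect_eq by (meson not_le)
        obtain J :: nat where J: "1 / Suc J < d" using reals_Archimedean[OF d(1)] by (auto simp: inverse_eq_divide)
        have "emeasure lborel {t. \<bar>t - s\<bar> \<le> 1 / Suc j \<and> (t, c) \<notin> V} \<le> ennreal (1 / (real (Suc l) * real (Suc j)))"
          if j: "J \<le> j" for j :: nat
        proof -
          define r where "r = 1 / real (Suc j)"
          have r: "0 < r" "r < d"
          proof -
            have "1 / real (Suc j) \<le> 1 / real (Suc J)" using j by (intro divide_left_mono) auto
            then show "r < d" using J by (simp add: r_def)
          qed (simp add: r_def)
          have eq: "{t. \<bar>t - s\<bar> \<le> 1 / Suc j \<and> (t, c) \<notin> V} = cball s r - B"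
            by (auto simp: r_def B_def dist_real_def abs_minus_commute)
          have fm: "cball s r - B \<in> lmeasurable" using B by (intro fmeasurable_Diff) auto
          have "measure lebesgue (cball s r) = 2 * r" using r by (simp add: cball_eq_atLeastAtMost)
          then have "measure lebesgue (cball s r - B) \<le> 1 / (2 * real (Suc l)) * (2 * r)"
            using d(2)[OF r] by simp
          also have "\<dots> = r / Suc l" by (simp add: field_simps del: of_nat_Suc)
          finally have "measure lebesgue (cball s r - B) \<le> r / Suc l" .
          then have "emeasure lebesgue (cball s r - B) \<le> ennreal (r / Suc l)"
            using fm by (simp add: emeasure_eq_measure2 ennreal_leI)
          moreover have "emeasure lebesgue (cball s r - B) = emeasure lborel (cball s r - B)" using Bb by simp
          ultimately show ?thesis unfolding eq by (simp add: r_def mult.commute)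
        qed
        then show "\<exists>J::nat. \<forall>j\<ge>J. emeasure lborel {t. \<bar>t - s\<bar> \<le> 1 / Suc j \<and> (t, c) \<notin> V} \<le> ennreal (1 / (real (Suc l) * real (Suc j)))"
          by blast
      qed
      then show False using s by simp
    qed
    ultimately show "AE s in lborel. (s, c) \<in> V \<longrightarrow> row_dense V (s, c)"
      unfolding AE_lborel_iff_negligible by (rule negligible_subset)
  qed
qed

text \<open>A radius lies below one of the form \<open>1 / Suc j\<close> that exceeds it by at most
  a factor 2; the bound grows by that factor.\<close>

lemma row_dense_all_radii:
  assumes "row_dense V x" and V: "V \<in> sets borel"
  shows "\<exists>R>0. \<forall>r. 0 < r \<and> r < R \<longrightarrow>
    emeasure lborel {s. \<bar>s - fst x\<bar> \<le> r \<and> (s, snd x) \<notin> V} \<le> ennreal (2 * r / Suc l)"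
proof -
  obtain J where J: "\<And>j. j \<ge> J \<Longrightarrow> emeasure lborel {s. \<bar>s - fst x\<bar> \<le> 1 / Suc j \<and> (s, snd x) \<notin> V}
      \<le> ennreal (1 / (real (Suc l) * real (Suc j)))"
    using assms(1) unfolding row_dense_def by blast
  have "emeasure lborel {s. \<bar>s - fst x\<bar> \<le> r \<and> (s, snd x) \<notin> V} \<le> ennreal (2 * r / Suc l)"
    if r: "0 < r" "r < 1 / Suc J" for r
  proof -
    have J1: "real (Suc J) < 1 / r" using r by (simp add: field_simps)
    \<comment> \<open>Makes \<open>Suc j\<close> the integer part of \<open>1 / r\<close>, whence
      \<open>r \<le> 1 / Suc j\<close> and \<open>1 / Suc j \<le> 2 * r\<close>.\<close>
    define j where "j = nat \<lfloor>1 / r\<rfloor> - 1"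
    have "Suc J \<le> nat \<lfloor>1 / r\<rfloor>" using J1 by (simp add: le_nat_floor)
    then have jj: "Suc j = nat \<lfloor>1 / r\<rfloor>" "J \<le> j" by (auto simp: j_def)
    have "0 \<le> 1 / r" using r by simp
    then have "real (Suc j) \<le> 1 / r" "1 / r < real (Suc j) + 1"
      unfolding jj(1) by (simp_all add: of_nat_floor)
    then have a: "r \<le> 1 / Suc j" "1 < (real (Suc j) + 1) * r" using r by (auto simp: field_simps)
    have "1 / Suc j \<le> 2 * r"
    proof -
      have "(real (Suc j) + 1) * r \<le> 2 * real (Suc j) * r" using r by (intro mult_right_mono) auto
      then have "1 \<le> 2 * real (Suc j) * r" using a(2) by linarith
      then show ?thesis by (simp add: field_simps)
    qed
    have "emeasure lborel {s. \<bar>s - fst x\<bar> \<le> r \<and> (s, snd x) \<notin> V}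
        \<le> emeasure lborel {s. \<bar>s - fst x\<bar> \<le> 1 / Suc j \<and> (s, snd x) \<notin> V}"
    proof (rule emeasure_mono)
      show "{s. \<bar>s - fst x\<bar> \<le> 1 / Suc j \<and> (s, snd x) \<notin> V} \<in> sets lborel"
        using emeasure_slice_measurable(2)[OF row_complement_pred[OF V]] by simp
    qed (use a(1) in auto)
    also have "\<dots> \<le> ennreal (1 / (real (Suc l) * real (Suc j)))" by (rule J[OF jj(2)])
    also have "\<dots> \<le> ennreal (2 * r / Suc l)"
    proof (rule ennreal_leI)
      have "1 / (real (Suc l) * real (Suc j)) = (1 / Suc j) / Suc l" by simp
      also have "\<dots> \<le> 2 * r / Suc l" by (intro divide_right_mono \<open>1 / Suc j \<le> 2 * r\<close>) simp
      finally show "1 / (real (Suc l) * real (Suc j)) \<le> 2 * r / Suc l" .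
    qed
    finally show ?thesis .
  qed
  then show ?thesis by (intro exI[of _ "1 / real (Suc J)"]) auto
qed

text \<open>The path turns at the corner \<open>(s, x2)\<close>. The column estimate has slope
  \<open>s\<close> where the claimed gradient has \<open>x1\<close>; the discrepancy is
  \<open>(s - x1) * (t - x2)\<close>, and \<open>near\<close> turns this quadratic term into a third
  contribution of the same order as the two flatness errors.\<close>

lemma two_step_estimate:
  fixes f :: "real \<times> real \<Rightarrow> real"
  assumes h: "\<bar>(f (s, x2) + x2 * s) - (f (x1, x2) + x2 * x1)\<bar> \<le> m * \<bar>s - x1\<bar>"
    and v: "\<bar>(- f (s, t) + s * t) - (- f (s, x2) + s * x2)\<bar> \<le> m * \<bar>t - x2\<bar>"
    and near: "norm ((s, t) - (x1, x2)) \<le> m"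
  shows "\<bar>f (s, t) - f (x1, x2) - (- x2, x1) \<bullet> ((s, t) - (x1, x2))\<bar> \<le> 3 * m * norm ((s, t) - (x1, x2))"
proof -
  define N where "N = norm ((s, t) - (x1, x2))"
  have N: "\<bar>s - x1\<bar> \<le> N" "\<bar>t - x2\<bar> \<le> N"
    using norm_fst_le[of "s - x1" "t - x2"] norm_snd_le[of "t - x2" "s - x1"] by (simp_all add: N_def)
  have m: "0 \<le> m" "N \<le> m" using near N by (auto simp: N_def)
  have "m * \<bar>s - x1\<bar> \<le> m * N" "m * \<bar>t - x2\<bar> \<le> m * N" using N m by (auto intro: mult_left_mono)
  moreover have "\<bar>(s - x1) * (t - x2)\<bar> \<le> m * N"
    unfolding abs_mult using N m by (intro mult_mono) auto
  moreover have "f (s, t) - f (x1, x2) - (- x2, x1) \<bullet> ((s, t) - (x1, x2)) =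
      ((f (s, x2) + x2 * s) - (f (x1, x2) + x2 * x1)) - ((- f (s, t) + s * t) - (- f (s, x2) + s * x2)) + (s - x1) * (t - x2)"
    by (simp add: algebra_simps)
  ultimately have "\<bar>f (s, t) - f (x1, x2) - (- x2, x1) \<bullet> ((s, t) - (x1, x2))\<bar> \<le> m * N + m * N + m * N"
    using h v by linarith
  then show ?thesis by (simp add: N_def)
qed

text \<open>The bad set is sliced by columns. For almost every \<open>s\<close> the row estimate
  holds; if moreover \<open>(s, snd x)\<close> lies in \<open>V\<close>, the column estimate makes
  the slice null. Otherwise the slice has length at most \<open>2 * r\<close>, and such
  \<open>s\<close> within reach of \<open>x\<close> form the set measured on the right.\<close>

lemma emeasure_bad_set_le:
  fixes f :: "real \<times> real \<Rightarrow> real"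
  assumes fm: "f \<in> borel_measurable borel" and h: "h_flat f m d x"
    and V: "V \<in> sets borel" "\<And>y. y \<in> V \<Longrightarrow> h_flat (\<lambda>y. - f (snd y, fst y)) m d' (snd y, fst y)"
    and r: "0 < r" "r \<le> d" "r \<le> d'" "r \<le> m" and \<epsilon>: "3 * m \<le> \<epsilon>"
  defines "A \<equiv> {y. y \<in> unit_sq \<and> norm (y - x) < r \<and> \<epsilon> * norm (y - x) < \<bar>f y - f x - (- snd x, fst x) \<bullet> (y - x)\<bar>}"
  shows "A \<in> sets borel"
    and "emeasure lborel A \<le> ennreal (2 * r) * emeasure lborel {s. \<bar>s - fst x\<bar> \<le> r \<and> (s, snd x) \<notin> V}"
proof -
  define Dr where "Dr = {s. \<bar>s - fst x\<bar> \<le> r \<and> (s, snd x) \<notin> V}"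
  have Dr[measurable]: "Dr \<in> sets borel"
    unfolding Dr_def by (rule emeasure_slice_measurable(2)[OF row_complement_pred[OF V(1)]])
  note fm[measurable]
  have [measurable]: "(\<lambda>y. norm (y - x)) \<in> borel_measurable borel" "(\<lambda>y. (- snd x, fst x) \<bullet> (y - x)) \<in> borel_measurable borel"
    by (intro borel_measurable_continuous_onI continuous_intros)+
  have "{y \<in> space borel. y \<in> unit_sq \<and> norm (y - x) < r \<and> \<epsilon> * norm (y - x) < \<bar>f y - f x - (- snd x, fst x) \<bullet> (y - x)\<bar>} \<in> sets borel"
    by measurable
  then show A: "A \<in> sets borel" unfolding A_def by simp
  obtain x1 x2 where x: "x = (x1, x2)" by (cases x)
  have slice: "AE s in lborel. emeasure lborel (Pair s -` A) \<le> ennreal (2 * r) * indicator Dr s"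
    using h unfolding h_flat_def
  proof eventually_elim
    case (elim s)
    show ?case
    proof (cases "\<bar>s - x1\<bar> < r \<and> s \<in> {0<..<1}")
      case False
      have "Pair s -` A = {}"
      proof (rule equals0I)
        fix t assume "t \<in> Pair s -` A"
        then have "s \<in> {0<..<1}" "norm ((s, t) - (x1, x2)) < r" by (auto simp: A_def x)
        moreover have "\<bar>s - x1\<bar> \<le> norm ((s, t) - (x1, x2))" using norm_fst_le[of "s - x1" "t - x2"] by simp
        ultimately show False using False by auto
      qed
      then show ?thesis by simp
    next
      case s: True
      then have sx: "\<bar>(f (s, x2) + x2 * s) - (f (x1, x2) + x2 * x1)\<bar> \<le> m * \<bar>s - x1\<bar>"
        using elim r(2) by (simp add: x)
      show ?thesis
      proof (cases "(s, x2) \<in> V")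
        case True
        have "AE t in lborel. t \<notin> Pair s -` A"
          using V(2)[OF True] unfolding h_flat_def
        proof eventually_elim
          case (elim t)
          show ?case
          proof
            assume "t \<in> Pair s -` A"
            then have t: "t \<in> {0<..<1}" "norm ((s, t) - (x1, x2)) < r"
              "\<epsilon> * norm ((s, t) - (x1, x2)) < \<bar>f (s, t) - f (x1, x2) - (- x2, x1) \<bullet> ((s, t) - (x1, x2))\<bar>"
              by (auto simp: A_def x)
            have "\<bar>t - x2\<bar> \<le> norm ((s, t) - (x1, x2))" using norm_snd_le[of "t - x2" "s - x1"] by simp
            then have "\<bar>t - x2\<bar> < d'" using t(2) r(3) by linarith
            then have "\<bar>(- f (s, t) + s * t) - (- f (s, x2) + s * x2)\<bar> \<le> m * \<bar>t - x2\<bar>"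
              using elim t(1) by simp
            from two_step_estimate[OF sx this] t(2) r(4)
            have "\<bar>f (s, t) - f (x1, x2) - (- x2, x1) \<bullet> ((s, t) - (x1, x2))\<bar> \<le> 3 * m * norm ((s, t) - (x1, x2))" by linarith
            also have "\<dots> \<le> \<epsilon> * norm ((s, t) - (x1, x2))" by (intro mult_right_mono \<epsilon>) simp
            finally show False using t(3) by linarith
          qed
        qed
        then have "emeasure lborel {t \<in> space lborel. t \<in> Pair s -` A} = 0" by (rule emeasure_eq_0_AE)
        then have "emeasure lborel (Pair s -` A) = 0" by (simp add: vimage_def)
        then show ?thesis by simp
      next
        case False
        then have "s \<in> Dr" using s by (simp add: Dr_def x)
        have "Pair s -` A \<subseteq> {x2 - r..x2 + r}"
        proof
          fix t assume "t \<in> Pair s -` A"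
          then have "norm ((s, t) - (x1, x2)) < r" by (auto simp: A_def x)
          moreover have "\<bar>t - x2\<bar> \<le> norm ((s, t) - (x1, x2))" using norm_snd_le[of "t - x2" "s - x1"] by simp
          ultimately show "t \<in> {x2 - r..x2 + r}" by auto
        qed
        then have "emeasure lborel (Pair s -` A) \<le> emeasure lborel {x2 - r..x2 + r}" by (rule emeasure_mono) simp
        also have "\<dots> = ennreal (2 * r)" using r(1) by (subst emeasure_lborel_Icc) auto
        finally show ?thesis using \<open>s \<in> Dr\<close> by simp
      qed
    qed
  qed
  have "emeasure lborel A = emeasure (lborel \<Otimes>\<^sub>M lborel) A" by (simp only: lborel_prod)
  also have "\<dots> = (\<integral>\<^sup>+s. emeasure lborel (Pair s -` A) \<partial>lborel)"
    by (rule lborel.emeasure_pair_measure_alt) (unfold lborel_prod, use A in simp)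
  also have "\<dots> \<le> (\<integral>\<^sup>+s. ennreal (2 * r) * indicator Dr s \<partial>lborel)" by (rule nn_integral_mono_AE[OF slice])
  also have "\<dots> = ennreal (2 * r) * emeasure lborel Dr" by (rule nn_integral_cmult_indicator) simp
  finally show "emeasure lborel A \<le> ennreal (2 * r) * emeasure lborel {s. \<bar>s - fst x\<bar> \<le> r \<and> (s, snd x) \<notin> V}"
    by (simp add: Dr_def)
qed

lemma measure_ball_R2: "0 \<le> r \<Longrightarrow> measure lebesgue (ball (x :: real \<times> real) r) = pi * r\<^sup>2"
  using content_ball[of r x] by (simp add: unit_ball_vol_2 power2_eq_square)

lemma has_ap_gradient_of_flat:
  assumes fm: "f \<in> borel_measurable borel" and gf: "AE y in lborel. y \<in> unit_sq \<longrightarrow> g y = f y" and gx: "g x = f x"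
    and h: "\<And>n::nat. \<exists>k::nat. h_flat f (1 / Suc n) (1 / Suc k) x"
    and v: "\<And>n::nat. \<exists>k::nat. row_dense (v_flat_set f (1 / Suc n) (1 / Suc k)) x"
  shows "has_ap_gradient unit_sq g x (- snd x, fst x)"
  unfolding has_ap_gradient_def density_zero_at_def
proof (intro allI impI)
  fix \<epsilon> :: real assume "0 < \<epsilon>"
  let ?Bad = "{y \<in> unit_sq. \<epsilon> * norm (y - x) < \<bar>g y - g x - (- snd x, fst x) \<bullet> (y - x)\<bar>}"
  have "0 < \<epsilon> / 3" using \<open>0 < \<epsilon>\<close> by simp
  then obtain n :: nat where "1 / Suc n < \<epsilon> / 3" using reals_Archimedean by (metis inverse_eq_divide)
  then have n: "3 * (1 / Suc n) \<le> \<epsilon>" by simp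
  obtain k where k: "h_flat f (1 / Suc n) (1 / Suc k) x" using h by blast
  obtain k' where k': "row_dense (v_flat_set f (1 / Suc n) (1 / Suc k')) x"
    using v by blast
  define V where "V = v_flat_set f (1 / Suc n) (1 / Suc k')"
  have V: "V \<in> sets borel" unfolding V_def by (rule v_flat_set_measurable[OF fm])
  have rd: "row_dense V x" using k' by (simp only: V_def)
  \<comment> \<open>Flatness concerns \<open>f\<close>, the conclusion concerns \<open>g\<close>. A
    null set does not affect densities, but the values at \<open>x\<close> itself have to agree,
    which is \<open>gx\<close>.\<close>
  define Z where "Z = {y. \<not> (y \<in> unit_sq \<longrightarrow> g y = f y)}"
  have Z: "Z \<in> null_sets lebesgue"
    using gf unfolding AE_lborel_iff_negligible negligible_iff_null_sets Z_def .
  show "((\<lambda>r. measure lebesgue (?Bad \<inter> ball x r) / measure lebesgue (ball x r)) \<longlongrightarrow> 0) (at_right 0)"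
  proof (rule tendstoI)
    fix e :: real assume "0 < e"
    then have "0 < e / 4" by simp
    then obtain l :: nat where "1 / Suc l < e / 4" using reals_Archimedean by (metis inverse_eq_divide)
    \<comment> \<open>The bad part of the ball will have measure at most
      \<open>2 * r * (2 * r / Suc l)\<close>, to be compared with the area
      \<open>pi * r^2\<close>.\<close>
    then have l: "4 / Suc l < e" by (simp add: field_simps)
    obtain R where R: "R > 0" "\<And>r. 0 < r \<Longrightarrow> r < R \<Longrightarrow>
      emeasure lborel {s. \<bar>s - fst x\<bar> \<le> r \<and> (s, snd x) \<notin> V} \<le> ennreal (2 * r / Suc l)"
      using row_dense_all_radii[OF rd V, of l] by blast
    \<comment> \<open>Besides the ranges of the density bound and of both flatness estimates, the
      radius stays below \<open>1 / Suc n\<close>, as the mixed term in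
      \<open>two_step_estimate\<close> requires.\<close>
    define R' where "R' = min R (min (1 / Suc k) (min (1 / Suc k') (1 / Suc n)))"
    have R': "0 < R'" "R' \<le> R" "R' \<le> 1 / Suc k" "R' \<le> 1 / Suc k'" "R' \<le> 1 / Suc n"
      using R(1) unfolding R'_def by auto
    have "dist (measure lebesgue (?Bad \<inter> ball x r) / measure lebesgue (ball x r)) 0 < e" if r: "0 < r" "r < R'" for r
    proof -
      define A where "A = {y. y \<in> unit_sq \<and> norm (y - x) < r \<and> \<epsilon> * norm (y - x) < \<bar>f y - f x - (- snd x, fst x) \<bullet> (y - x)\<bar>}"
      have Vf: "h_flat (\<lambda>y. - f (snd y, fst y)) (1 / Suc n) (1 / Suc k') (snd y, fst y)" if "y \<in> V" for y
        using that unfolding V_def v_flat_set_def by blast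
      have rr: "r \<le> 1 / Suc k" "r \<le> 1 / Suc k'" "r \<le> 1 / Suc n" using r R' by linarith+
      have Ab: "A \<in> sets borel" and "emeasure lborel A \<le> ennreal (2 * r) * emeasure lborel {s. \<bar>s - fst x\<bar> \<le> r \<and> (s, snd x) \<notin> V}"
        unfolding A_def using emeasure_bad_set_le[OF fm k V Vf r(1) rr n] by blast+
      note this(2)
      also have "\<dots> \<le> ennreal (2 * r) * ennreal (2 * r / Suc l)" using r R' by (intro mult_left_mono R(2)) auto
      also have "\<dots> = ennreal (4 * r\<^sup>2 / Suc l)"
        using r by (subst ennreal_mult[symmetric]) (auto simp: power2_eq_square)
      finally have Ae: "emeasure lborel A \<le> ennreal (4 * r\<^sup>2 / Suc l)" .
      have "?Bad \<inter> ball x r \<subseteq> A \<union> Z"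
        by (auto simp: A_def Z_def gx dist_norm norm_minus_commute)
      then have "emeasure lebesgue (?Bad \<inter> ball x r) \<le> emeasure lebesgue (A \<union> Z)"
        by (rule emeasure_mono) (use Ab Z in auto)
      also have "\<dots> = emeasure lborel A" using emeasure_Un_null_set[OF _ Z] Ab by simp
      finally have "emeasure lebesgue (?Bad \<inter> ball x r) \<le> ennreal (4 * r\<^sup>2 / Suc l)" using Ae by (rule order_trans)
      then have "measure lebesgue (?Bad \<inter> ball x r) \<le> 4 * r\<^sup>2 / Suc l"
        unfolding measure_def by (intro enn2real_leI) auto
      then have "measure lebesgue (?Bad \<inter> ball x r) / measure lebesgue (ball x r) \<le> (4 * r\<^sup>2 / Suc l) / (pi * r\<^sup>2)"
        unfolding measure_ball_R2[OF less_imp_le[OF r(1)]] by (rule divide_right_mono) simp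
      also have "\<dots> = (4 / Suc l) / pi" using r by simp
      also have "\<dots> \<le> (4 / Suc l) / 1" using pi_gt3 by (intro divide_left_mono) auto
      also have "\<dots> < e" using l by simp
      finally show ?thesis by (simp add: dist_real_def)
    qed
    then show "\<forall>\<^sub>F r in at_right 0. dist (measure lebesgue (?Bad \<inter> ball x r) / measure lebesgue (ball x r)) 0 < e"
      unfolding eventually_at_right_field using R'(1) by blast
  qed
qed

theorem theorem6p3:
  fixes g :: "real \<times> real \<Rightarrow> real" and \<alpha> :: real
  assumes "2 \<le> \<alpha>" and "\<alpha> < 3"
    and "BV_on ({0<..<1} \<times> {0<..<1}) g"
    and "hausdorff_measure cc_dist \<alpha>
           {(x1, x2, g (x1, x2)) | x1 x2. 0 < x1 \<and> x1 < 1 \<and> 0 < x2 \<and> x2 < 1} < top"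
  shows "AE x in lebesgue. x \<in> {0<..<1} \<times> {0<..<1} \<longrightarrow>
           has_ap_gradient ({0<..<1} \<times> {0<..<1}) g x (- snd x, fst x)"
proof -
  obtain f M where f: "integrable lborel f" and f0: "\<And>x. x \<notin> unit_sq \<Longrightarrow> f x = 0"
    and gf: "AE x in lborel. x \<in> unit_sq \<longrightarrow> g x = f x"
    and M: "h_variation_le f M" "h_variation_le (\<lambda>x. - f (snd x, fst x)) M"
    by (rule BV_on_unit_sq_Borel_version[OF assms(3)]) (rule that)
  have fm: "f \<in> borel_measurable borel" using borel_measurable_integrable[OF f] by simp
  \<comment> \<open>Rows of \<open>f2\<close> are columns of \<open>f\<close>; the sign is that of
    the height under the exchange of \<open>X1\<close> and \<open>X2\<close>.\<close>
  define f2 g2 where "f2 x = - f (snd x, fst x)" and "g2 x = - g (snd x, fst x)" for x :: "real \<times> real"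
  have f2: "integrable lborel f2"
  proof -
    have "integrable lborel (\<lambda>x. f (snd x, fst x))"
      using lborel_pair.integrable_product_swap_iff[of f] f by (simp add: lborel_prod case_prod_unfold)
    then show ?thesis by (simp add: f2_def[abs_def])
  qed
  have f20: "f2 x = 0" if "x \<notin> unit_sq" for x
    using f0[of "(snd x, fst x)"] that by (auto simp: f2_def mem_Times_iff)
  have gf2: "AE x in lborel. x \<in> unit_sq \<longrightarrow> g2 x = f2 x"
    using AE_lborel_swap[OF gf] by eventually_elim (auto simp: f2_def g2_def mem_Times_iff)
  let ?G = "{(x1, x2, g (x1, x2)) | x1 x2. 0 < x1 \<and> x1 < 1 \<and> 0 < x2 \<and> x2 < 1}"
  have cn: "cubically_null ?G" by (rule hausdorff_measure_finite_imp_cubically_null[OF assms(2,4)])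
  have "(\<lambda>q. (fst (snd q), fst q, - snd (snd q))) ` ?G
      = {(x1, x2, g2 (x1, x2)) | x1 x2. 0 < x1 \<and> x1 < 1 \<and> 0 < x2 \<and> x2 < 1}"
    by (force simp: g2_def image_iff)
  with cubically_null_swap[OF cn]
  have cn2: "cubically_null {(x1, x2, g2 (x1, x2)) | x1 x2. 0 < x1 \<and> x1 < 1 \<and> 0 < x2 \<and> x2 < 1}" by simp
  have hf: "AE x in lborel. x \<in> unit_sq \<longrightarrow> (\<forall>n::nat. \<exists>k::nat. h_flat f (1 / Suc n) (1 / Suc k) x)"
    by (rule AE_h_flat[OF f _ M(1) gf cubically_null_graph_imp_AE_negligible[OF cn]]) (rule f0)
  have "AE x in lborel. x \<in> unit_sq \<longrightarrow> (\<forall>n::nat. \<exists>k::nat. h_flat f2 (1 / Suc n) (1 / Suc k) x)"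
    by (rule AE_h_flat[OF f2 _ _ gf2 cubically_null_graph_imp_AE_negligible[OF cn2]])
      (use f20 M(2) in \<open>simp_all add: f2_def[abs_def]\<close>)
  from AE_lborel_swap[OF this]
  have vf: "AE x in lborel. (snd x, fst x) \<in> unit_sq \<longrightarrow> (\<forall>n::nat. \<exists>k::nat. h_flat f2 (1 / Suc n) (1 / Suc k) (snd x, fst x))" .
  define V where "V n k = v_flat_set f (1 / Suc n) (1 / Suc k)" for n k :: nat
  have Vm: "V n k \<in> sets borel" for n k unfolding V_def by (rule v_flat_set_measurable[OF fm])
  \<comment> \<open>The sets \<open>V n k\<close> are countable in number, so one null set serves
    them all. Column flatness at \<open>x\<close> places it in some \<open>V n k\<close>, and
    density then supplies most nearby row points with the same constants.\<close>
  have "AE x in lborel. \<forall>n k. x \<in> V n k \<longrightarrow> row_dense (V n k) x"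
    unfolding AE_all_countable using AE_row_dense[OF Vm] by blast
  with gf hf vf have "AE x in lborel. x \<in> unit_sq \<longrightarrow> has_ap_gradient unit_sq g x (- snd x, fst x)"
  proof eventually_elim
    case (elim x)
    show ?case
    proof
      assume x: "x \<in> unit_sq"
      have x': "(snd x, fst x) \<in> unit_sq" using x by (simp add: mem_Times_iff)
      have eq: "(\<lambda>y. - f (snd y, fst y)) = f2" by (simp add: f2_def[abs_def])
      show "has_ap_gradient unit_sq g x (- snd x, fst x)"
      proof (rule has_ap_gradient_of_flat[OF fm gf])
        show "g x = f x" using elim(1) x by blast
        show "\<exists>k::nat. h_flat f (1 / Suc n) (1 / Suc k) x" for n :: nat using elim(2) x by blast
        show "\<exists>k::nat. row_dense (v_flat_set f (1 / Suc n) (1 / Suc k)) x" for n :: nat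
        proof -
          obtain k :: nat where "h_flat f2 (1 / Suc n) (1 / Suc k) (snd x, fst x)" using elim(3) x' by blast
          then have "x \<in> V n k" using x unfolding V_def v_flat_set_def eq by blast
          then have "row_dense (V n k) x" using elim(4) by blast
          then show ?thesis unfolding V_def by blast
        qed
      qed
    qed
  qed
  then show ?thesis by (simp add: AE_completion_iff)
qed

end
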